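(* Let $A=T(V)/I$ where $I$ is generated by a space of relations $R=R_a\oplus R_b$ with $R_a$ and $R_b$ exclusive. The opposite $(a,b)$-homogeneous algebra $A^{\circ}=T(V)/\langle\tau(R)\rangle$ is $(a,b)$-Koszul if and only if $A$ is $(a,b)$-Koszul.
   Context: $k$ is a field, $V$ a finite-dimensional $k$-vector space, $V^{(n)}=V^{\otimes n}$. $2\le a<b$ are integers, $R_a\subseteq V^{(a)}$, $R_b\subseteq V^{(b)}$ are subspaces; they are exclusive if $(\sum_{i+j+a=b}V^{(i)}\otimes R_a\otimes V^{(j)})\cap R_b=0$. $I$ is the two-sided ideal of $T(V)$ generated by $R=R_a\oplus R_b$; $A=T(V)/I$ is graded with $A_n=V^{(n)}/I_n$, and $k$ is the trivial $A$-module via the augmentation. $\tau:T(V)\to T(V)$ is the $k$-linear anti-automorphism with $\tau(1)=1$ and $\tau(w_1\otimes w_2\otimes\cdots\otimes w_n)=w_n\otimes\cdots\otimes w_2\otimes w_1$ for $w_i\in V$; $A^\circ$ has space of relations $\tau(R)=\tau(R_a)\oplus\tau(R_b)$ (and $\tau(R_a),\tau(R_b)$ are again exclusive). For $s\in\{a,b\}$: $n_s(2l)=ls$, $n_s(2l+1)=ls+1$ for $l\ge0$. An algebra of the form $B=T(V)/\langle S_a\oplus S_b\rangle$, where $S_a\subseteq V^{(a)}$ and $S_b\subseteq V^{(b)}$ are exclusive subspaces and $\langle S_a\oplus S_b\rangle$ is the two-sided ideal of $T(V)$ they generate, is $(a,b)$-Koszul if for all $i\ge2$ the graded vector space $\operatorname{Tor}_i^B(k,k)$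 is $2$-pure in degrees $n_a(i)$ and $n_b(i)$, i.e. it is the direct sum of its components of degrees $n_a(i)$ and $n_b(i)$ (which may be zero). *)

theory Defs
  imports Complex_Main "HOL-Algebra.Module" "HOL-Algebra.QuotRing" "HOL-Algebra.Free_Abelian_Groups"
    "HOL-Library.Poly_Mapping"
begin

section \<open>The tensor algebra of a finite-dimensional vector space\<close>

text \<open>
  The space \<open>V\<close> is the type \<open>'v\<close> with a \<open>finite_dimensional_vector_space scale E\<close> structure, where
  \<open>E\<close> is the finite basis fixed by that locale. \<open>T(V)\<close> is realised as the free algebra on \<open>E\<close>:
  finitely supported functions on words, with the convolution product of \<open>Poly_Mapping\<close>, restricted
  to words with letters in \<open>E\<close>. An arbitrary vector of \<open>V\<close> enters through \<open>tensor_embed\<close>; the lemmas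
  \<open>tpow_eq_span\<close> and \<open>tau_pure_tensor\<close> below show that \<open>tpow\<close> and \<open>tau\<close> do not depend on the basis.
\<close>

datatype 'x fword = Word (letters: "'x list")

instantiation fword :: (type) monoid_add
begin

definition zero_fword :: "'a fword" where
  "0 = Word []"

definition plus_fword :: "'a fword \<Rightarrow> 'a fword \<Rightarrow> 'a fword" where
  "u + v = Word (letters u @ letters v)"

instance
  by standard (simp_all add: zero_fword_def plus_fword_def)

end

type_synonym ('v, 'k) tens = "'v fword \<Rightarrow>\<^sub>0 'k"

definition tscale :: "'k::field \<Rightarrow> ('v, 'k) tens \<Rightarrow> ('v, 'k) tens" where
  "tscale c t = Poly_Mapping.map ((*) c) t"

definition tensor_algebra :: "'v set \<Rightarrow> ('v, 'k::field) tens ring" where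
  "tensor_algebra E =
    \<lparr>carrier = {t. \<forall>w\<in>Poly_Mapping.keys t. set (letters w) \<subseteq> E},
     mult = (*), one = 1, ring.zero = 0, add = (+)\<rparr>"

definition tpow :: "'v set \<Rightarrow> nat \<Rightarrow> ('v, 'k::field) tens set" where
  "tpow E n = {t \<in> carrier (tensor_algebra E). \<forall>w\<in>Poly_Mapping.keys t. length (letters w) = n}"

definition tensor_embed ::
    "('k::field \<Rightarrow> 'v::ab_group_add \<Rightarrow> 'v) \<Rightarrow> 'v set \<Rightarrow> 'v \<Rightarrow> ('v, 'k) tens" where
  "tensor_embed scale E v =
    (\<Sum>e\<in>E. Poly_Mapping.single (Word [e]) (module.representation scale E v e))"

definition pure_tensor ::
    "('k::field \<Rightarrow> 'v::ab_group_add \<Rightarrow> 'v) \<Rightarrow> 'v set \<Rightarrow> 'v list \<Rightarrow> ('v, 'k) tens" where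
  "pure_tensor scale E vs = prod_list (map (tensor_embed scale E) vs)"

text \<open>The coefficient of \<open>tau t\<close> at a word is the coefficient of \<open>t\<close> at the reversed word.\<close>

definition tau :: "('v, 'k::field) tens \<Rightarrow> ('v, 'k) tens" where
  "tau = Poly_Mapping.map_key (\<lambda>w. Word (rev (letters w)))"


lemma tscale_lookup: "Poly_Mapping.lookup (tscale c t) w = c * Poly_Mapping.lookup t w"
  by (simp add: tscale_def Poly_Mapping.map.rep_eq when_def)

lemma vector_space_tscale: "vector_space tscale"
  by standard (auto intro!: poly_mapping_eqI simp: tscale_lookup lookup_add algebra_simps)

lemma inj_word_rev: "inj (\<lambda>w. Word (rev (letters w)))"
  by (auto intro!: injI simp: fword.expand)

lemma lookup_tau: "Poly_Mapping.lookup (tau t) w = Poly_Mapping.lookup t (Word (rev (letters w)))"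
  unfolding tau_def by (simp add: map_key.rep_eq[OF inj_word_rev])

lemma tau_add: "tau (s + t) = tau s + tau t"
  by (rule poly_mapping_eqI) (simp add: lookup_tau lookup_add)

lemma tau_tscale: "tau (tscale c t) = tscale c (tau t)"
  by (rule poly_mapping_eqI) (simp add: lookup_tau tscale_lookup)

lemma tau_single: "tau (Poly_Mapping.single w c) = Poly_Mapping.single (Word (rev (letters w))) c"
  by (rule poly_mapping_eqI) (metis (full_types) fword.collapse fword.sel lookup_single_eq lookup_single_not_eq lookup_tau rev_rev_ident)

lemma tau_zero: "tau 0 = 0"
  by (rule poly_mapping_eqI) (simp add: lookup_tau)

lemma tau_sum: "tau (sum f A) = (\<Sum>x\<in>A. tau (f x))"
  by (induction A rule: infinite_finite_induct) (simp_all add: tau_zero tau_add)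

lemma tau_one: "tau 1 = 1"
  by (simp flip: single_one add: tau_single zero_fword_def)

lemma tens_expand: "t = (\<Sum>w\<in>Poly_Mapping.keys t. Poly_Mapping.single w (Poly_Mapping.lookup t w))"
  by (rule poly_mapping_eqI) (simp add: lookup_sum lookup_single when_def in_keys_iff)

lemma tau_mult: "tau (s * t) = tau t * tau s"
proof -
  let ?e = "\<lambda>t. \<Sum>w\<in>Poly_Mapping.keys t. Poly_Mapping.single w (Poly_Mapping.lookup t w)"
  have "tau (?e s * ?e t) = tau (?e t) * tau (?e s)"
    unfolding sum_product mult_single tau_sum tau_single
    by (subst sum.swap) (simp add: plus_fword_def mult.commute)
  then show ?thesis by (simp flip: tens_expand)
qed

lemma tau_pure_tensor: "tau (pure_tensor scale E vs) = pure_tensor scale E (rev vs)"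
proof (induction vs)
  case Nil
  then show ?case by (simp add: pure_tensor_def tau_one)
next
  case (Cons v vs)
  have "tau (tensor_embed scale E v) = tensor_embed scale E v"
    by (simp add: tensor_embed_def tau_sum tau_single)
  with Cons show ?case by (simp add: pure_tensor_def tau_mult)
qed

lemma pure_tensor_basis:
  assumes "finite_dimensional_vector_space scale E" and "set es \<subseteq> E"
  shows "pure_tensor scale E es = Poly_Mapping.single (Word es) 1"
proof -
  interpret V: finite_dimensional_vector_space scale E by fact
  have "tensor_embed scale E e = Poly_Mapping.single (Word [e]) 1" if "e \<in> E" for e
  proof -
    have "tensor_embed scale E e = (\<Sum>x\<in>E. if x = e then Poly_Mapping.single (Word [e]) 1 else 0)"
      unfolding tensor_embed_def
      by (rule sum.cong) (auto simp: V.representation_basis[OF V.independent_Basis that])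
    then show ?thesis using that V.finite_Basis by simp
  qed
  with \<open>set es \<subseteq> E\<close> show ?thesis
    by (induction es)
       (auto simp: pure_tensor_def mult_single plus_fword_def zero_fword_def simp flip: single_one)
qed

lemma tpow_subspace: "module.subspace tscale (tpow E n :: ('a, 'b::field) tens set)"
proof -
  interpret vector_space tscale by (rule vector_space_tscale)
  have "Poly_Mapping.keys (tscale c t) \<subseteq> Poly_Mapping.keys t" for c :: "'b::field" and t :: "('a, 'b) tens"
    by (auto simp: in_keys_iff tscale_lookup)
  then show ?thesis
    using Poly_Mapping.keys_add
    by (fastforce intro!: subspaceI simp: tpow_def tensor_algebra_def)
qed

lemma tpow_mult:
  assumes "s \<in> tpow E m" "t \<in> tpow E n" shows "s * t \<in> tpow E (m + n)"
proof -
  have "\<exists>u\<in>Poly_Mapping.keys s. \<exists>v\<in>Poly_Mapping.keys t. w = u + v"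
    if "w \<in> Poly_Mapping.keys (s * t)" for w
    using that keys_mult[of s t] by blast
  with assms show ?thesis
    by (fastforce simp: tpow_def tensor_algebra_def plus_fword_def)
qed

lemma pure_tensor_in_tpow: "pure_tensor scale E vs \<in> tpow E (length vs)"
proof (induction vs)
  case Nil
  then show ?case
    by (auto simp: pure_tensor_def tpow_def tensor_algebra_def zero_fword_def simp flip: single_one split: if_splits)
next
  case (Cons v vs)
  interpret vector_space tscale by (rule vector_space_tscale)
  have "tensor_embed scale E v \<in> tpow E 1"
    unfolding tensor_embed_def
    by (rule subspace_sum[OF tpow_subspace])
       (auto simp: tpow_def tensor_algebra_def split: if_splits)
  from tpow_mult[OF this Cons] show ?case by (simp add: pure_tensor_def)
qed

lemma tpow_eq_span:
  assumes "finite_dimensional_vector_space scale E"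
  shows "tpow E n = module.span tscale (pure_tensor scale E ` {vs. length vs = n})"
proof -
  interpret vector_space tscale by (rule vector_space_tscale)
  show ?thesis
  proof
    show "tpow E n \<subseteq> span (pure_tensor scale E ` {vs. length vs = n})"
    proof
      fix t :: "('b, 'a) tens" assume t: "t \<in> tpow E n"
      have "Poly_Mapping.single w (Poly_Mapping.lookup t w) \<in> span (pure_tensor scale E ` {vs. length vs = n})"
        if "w \<in> Poly_Mapping.keys t" for w
      proof -
        have "set (letters w) \<subseteq> E" "length (letters w) = n"
          using t that by (auto simp: tpow_def tensor_algebra_def)
        moreover have "Poly_Mapping.single w (Poly_Mapping.lookup t w) =
            tscale (Poly_Mapping.lookup t w) (Poly_Mapping.single (Word (letters w)) 1)"
          by (simp add: tscale_def)
        ultimately show ?thesis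
          by (metis (mono_tags, lifting) assms imageI mem_Collect_eq pure_tensor_basis span_base span_scale)
      qed
      then show "t \<in> span (pure_tensor scale E ` {vs. length vs = n})"
        by (subst tens_expand) (rule span_sum)
    qed
    show "span (pure_tensor scale E ` {vs. length vs = n}) \<subseteq> tpow E n"
      by (rule span_minimal[OF _ tpow_subspace]) (auto intro: pure_tensor_in_tpow)
  qed
qed


section \<open>Exclusive relations and the algebra they define\<close>

definition exclusive :: "'v set \<Rightarrow> nat \<Rightarrow> nat \<Rightarrow> ('v, 'k::field) tens set \<Rightarrow> ('v, 'k) tens set \<Rightarrow> bool" where
  "exclusive E a b Sa Sb \<longleftrightarrow>
    module.span tscale {u * r * v | i j u r v. i + j + a = b \<and> u \<in> tpow E i \<and> r \<in> Sa \<and> v \<in> tpow E j}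
      \<inter> Sb = {0}"

definition relation_ideal :: "'v set \<Rightarrow> ('v, 'k::field) tens set \<Rightarrow> ('v, 'k) tens set \<Rightarrow> ('v, 'k) tens set" where
  "relation_ideal E Sa Sb = genideal (tensor_algebra E) {x + y | x y. x \<in> Sa \<and> y \<in> Sb}"

definition quotient_algebra :: "'v set \<Rightarrow> ('v, 'k::field) tens set \<Rightarrow> ('v, 'k) tens set ring" where
  "quotient_algebra E J = tensor_algebra E Quot J"

definition quotient_component :: "'v set \<Rightarrow> ('v, 'k::field) tens set \<Rightarrow> nat \<Rightarrow> ('v, 'k) tens set set" where
  "quotient_component E J n = (\<lambda>t. J +>\<^bsub>tensor_algebra E\<^esub> t) ` tpow E n"

text \<open>
  The augmentation of \<open>T(V)/J\<close>, induced by the coefficient at the empty word; this is constant on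
  cosets when \<open>J\<close> lies in positive degrees (\<open>augmentation_coset\<close> below).
\<close>

definition augmentation :: "('v, 'k::field) tens set \<Rightarrow> 'k" where
  "augmentation z = the_elem ((\<lambda>t. Poly_Mapping.lookup t 0) ` z)"

lemma augmentation_coset:
  assumes "\<forall>x\<in>J. Poly_Mapping.lookup x 0 = 0" and "J \<noteq> {}"
  shows "augmentation (J +>\<^bsub>tensor_algebra E\<^esub> t) = Poly_Mapping.lookup t 0"
proof -
  have "(\<lambda>t. Poly_Mapping.lookup t 0) ` (J +>\<^bsub>tensor_algebra E\<^esub> t) = {Poly_Mapping.lookup t 0}"
    using assms by (auto simp: a_r_coset_def' tensor_algebra_def lookup_add image_iff)
  then show ?thesis by (simp add: augmentation_def)
qed

text \<open>
  The fields \<open>mult\<close> and \<open>one\<close> of the record type \<open>module\<close> play no role for modules. The record below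
  is used both as left and as right module, the two actions being the same.
\<close>

definition trivial_module :: "(('v, 'k::field) tens set, 'k) module" where
  "trivial_module =
    \<lparr>carrier = UNIV, mult = undefined, one = undefined, ring.zero = 0, add = (+),
     smult = (\<lambda>z c. augmentation z * c)\<rparr>"

definition trivial_component :: "nat \<Rightarrow> 'k::field set" where
  "trivial_component n = (if n = 0 then UNIV else {0})"


section \<open>Graded free resolutions\<close>

text \<open>
  \<open>HOL-Algebra\<close> has modules over commutative rings only, so the notions needed over a graded ring
  \<open>(R, RC)\<close>, with \<open>RC n\<close> the component of degree \<open>n\<close>, are given here. \<open>free_module R X\<close> is the free
  left module on the set \<open>X\<close>, and \<open>dg x\<close> is the degree of the basis element \<open>x\<close>.
\<close>

definition free_module :: "('r, 'z) ring_scheme \<Rightarrow> nat set \<Rightarrow> ('r, nat \<Rightarrow> 'r) module" where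
  "free_module R X =
    \<lparr>carrier = {f. (\<forall>x\<in>X. f x \<in> carrier R) \<and> (\<forall>x. x \<notin> X \<longrightarrow> f x = \<zero>\<^bsub>R\<^esub>) \<and> finite {x. f x \<noteq> \<zero>\<^bsub>R\<^esub>}},
     mult = undefined, one = undefined, ring.zero = (\<lambda>x. \<zero>\<^bsub>R\<^esub>), add = (\<lambda>f g x. f x \<oplus>\<^bsub>R\<^esub> g x),
     smult = (\<lambda>r f x. r \<otimes>\<^bsub>R\<^esub> f x)\<rparr>"

definition free_component ::
    "('r, 'z) ring_scheme \<Rightarrow> (nat \<Rightarrow> 'r set) \<Rightarrow> nat set \<Rightarrow> (nat \<Rightarrow> nat) \<Rightarrow> nat \<Rightarrow> (nat \<Rightarrow> 'r) set" where
  "free_component R RC X dg n =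
    {f \<in> carrier (free_module R X). \<forall>x\<in>X. f x \<noteq> \<zero>\<^bsub>R\<^esub> \<longrightarrow> dg x \<le> n \<and> f x \<in> RC (n - dg x)}"

definition graded_linear ::
    "('r, 'z) ring_scheme \<Rightarrow> ('r, 'm, 'y) module_scheme \<Rightarrow> (nat \<Rightarrow> 'm set) \<Rightarrow>
     ('r, 'n, 'x) module_scheme \<Rightarrow> (nat \<Rightarrow> 'n set) \<Rightarrow> ('m \<Rightarrow> 'n) \<Rightarrow> bool" where
  "graded_linear R M MC N NC f \<longleftrightarrow>
    f \<in> carrier M \<rightarrow> carrier N \<and>
    (\<forall>x\<in>carrier M. \<forall>y\<in>carrier M. f (x \<oplus>\<^bsub>M\<^esub> y) = f x \<oplus>\<^bsub>N\<^esub> f y) \<and>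
    (\<forall>r\<in>carrier R. \<forall>x\<in>carrier M. f (r \<odot>\<^bsub>M\<^esub> x) = r \<odot>\<^bsub>N\<^esub> f x) \<and>
    (\<forall>n. f ` MC n \<subseteq> NC n)"

record ('r, 'n) free_complex =
  gens :: "nat \<Rightarrow> nat set"
  gdeg :: "nat \<Rightarrow> nat \<Rightarrow> nat"
  differential :: "nat \<Rightarrow> (nat \<Rightarrow> 'r) \<Rightarrow> (nat \<Rightarrow> 'r)"
  augment :: "(nat \<Rightarrow> 'r) \<Rightarrow> 'n"

abbreviation res_module ::
    "('r, 'z) ring_scheme \<Rightarrow> ('r, 'n) free_complex \<Rightarrow> nat \<Rightarrow> ('r, nat \<Rightarrow> 'r) module" where
  "res_module R F i \<equiv> free_module R (gens F i)"

abbreviation res_component ::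
    "('r, 'z) ring_scheme \<Rightarrow> (nat \<Rightarrow> 'r set) \<Rightarrow> ('r, 'n) free_complex \<Rightarrow> nat \<Rightarrow> nat \<Rightarrow> (nat \<Rightarrow> 'r) set" where
  "res_component R RC F i \<equiv> free_component R RC (gens F i) (gdeg F i)"

text \<open>
  \<open>\<dots> \<rightarrow> P\<^sub>2 \<rightarrow> P\<^sub>1 \<rightarrow> P\<^sub>0 \<rightarrow> N \<rightarrow> 0\<close> is exact, with maps of degree \<open>0\<close>; \<open>differential F i\<close> goes from
  \<open>P\<^sub>i\<^sub>+\<^sub>1\<close> to \<open>P\<^sub>i\<close>.
\<close>

definition graded_free_resolution ::
    "('r, 'z) ring_scheme \<Rightarrow> (nat \<Rightarrow> 'r set) \<Rightarrow> ('r, 'n, 'x) module_scheme \<Rightarrow> (nat \<Rightarrow> 'n set) \<Rightarrow>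
     ('r, 'n) free_complex \<Rightarrow> bool" where
  "graded_free_resolution R RC N NC F \<longleftrightarrow>
    graded_linear R (res_module R F 0) (res_component R RC F 0) N NC (augment F) \<and>
    (\<forall>i. graded_linear R (res_module R F (Suc i)) (res_component R RC F (Suc i))
           (res_module R F i) (res_component R RC F i) (differential F i)) \<and>
    augment F ` carrier (res_module R F 0) = carrier N \<and>
    {x \<in> carrier (res_module R F 0). augment F x = \<zero>\<^bsub>N\<^esub>}
      = differential F 0 ` carrier (res_module R F 1) \<and>
    (\<forall>i. {x \<in> carrier (res_module R F (Suc i)). differential F i x = \<zero>\<^bsub>res_module R F i\<^esub>}
           = differential F (Suc i) ` carrier (res_module R F (Suc (Suc i))))"


section \<open>Tensor products and Tor\<close>

text \<open>
  The tensor product of a right module \<open>M\<close> and a left module \<open>N\<close>, as the quotient of the free abelian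
  group on the pairs by the bilinearity and balancing relations. For the right module \<open>M\<close>,
  \<open>r \<odot>\<^bsub>M\<^esub> x\<close> denotes \<open>x \<cdot> r\<close>.
\<close>

definition tensor_relations ::
    "('r, 'z) ring_scheme \<Rightarrow> ('r, 'm, 'y) module_scheme \<Rightarrow> ('r, 'n, 'x) module_scheme \<Rightarrow>
     ('m \<times> 'n \<Rightarrow>\<^sub>0 int) set" where
  "tensor_relations R M N =
     {frag_of (x \<oplus>\<^bsub>M\<^esub> x', y) - frag_of (x, y) - frag_of (x', y) | x x' y.
        x \<in> carrier M \<and> x' \<in> carrier M \<and> y \<in> carrier N} \<union>
     {frag_of (x, y \<oplus>\<^bsub>N\<^esub> y') - frag_of (x, y) - frag_of (x, y') | x y y'.
        x \<in> carrier M \<and> y \<in> carrier N \<and> y' \<in> carrier N} \<union>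
     {frag_of (r \<odot>\<^bsub>M\<^esub> x, y) - frag_of (x, r \<odot>\<^bsub>N\<^esub> y) | r x y.
        r \<in> carrier R \<and> x \<in> carrier M \<and> y \<in> carrier N}"

definition tensor_kernel ::
    "('r, 'z) ring_scheme \<Rightarrow> ('r, 'm, 'y) module_scheme \<Rightarrow> ('r, 'n, 'x) module_scheme \<Rightarrow>
     ('m \<times> 'n \<Rightarrow>\<^sub>0 int) set" where
  "tensor_kernel R M N =
    generate (free_Abelian_group (carrier M \<times> carrier N)) (tensor_relations R M N)"

definition tensor_product ::
    "('r, 'z) ring_scheme \<Rightarrow> ('r, 'm, 'y) module_scheme \<Rightarrow> ('r, 'n, 'x) module_scheme \<Rightarrow>
     ('m \<times> 'n \<Rightarrow>\<^sub>0 int) set monoid" where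
  "tensor_product R M N =
    free_Abelian_group (carrier M \<times> carrier N) Mod tensor_kernel R M N"

definition tensor_elem ::
    "('r, 'z) ring_scheme \<Rightarrow> ('r, 'm, 'y) module_scheme \<Rightarrow> ('r, 'n, 'x) module_scheme \<Rightarrow>
     'm \<Rightarrow> 'n \<Rightarrow> ('m \<times> 'n \<Rightarrow>\<^sub>0 int) set" where
  "tensor_elem R M N x y =
    tensor_kernel R M N #>\<^bsub>free_Abelian_group (carrier M \<times> carrier N)\<^esub> frag_of (x, y)"

definition tensor_component ::
    "('r, 'z) ring_scheme \<Rightarrow> ('r, 'm, 'y) module_scheme \<Rightarrow> (nat \<Rightarrow> 'm set) \<Rightarrow>
     ('r, 'n, 'x) module_scheme \<Rightarrow> (nat \<Rightarrow> 'n set) \<Rightarrow> nat \<Rightarrow> ('m \<times> 'n \<Rightarrow>\<^sub>0 int) set set" where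
  "tensor_component R M MC N NC n =
    generate (tensor_product R M N)
      {tensor_elem R M N x y | i j x y. i + j = n \<and> x \<in> MC i \<and> y \<in> NC j}"

text \<open>
  The map \<open>id \<otimes> f\<close>: the image of a coset \<open>Z\<close> under \<open>(x, y) \<mapsto> (x, f y)\<close> lies in a single coset, and
  adding \<open>tensor_kernel R M N'\<close> gives that coset.
\<close>

definition tensor_map ::
    "('r, 'z) ring_scheme \<Rightarrow> ('r, 'm, 'y) module_scheme \<Rightarrow> ('r, 'n, 'x) module_scheme \<Rightarrow>
     ('l \<Rightarrow> 'n) \<Rightarrow> ('m \<times> 'l \<Rightarrow>\<^sub>0 int) set \<Rightarrow> ('m \<times> 'n \<Rightarrow>\<^sub>0 int) set" where
  "tensor_map R M N' f Z =
    tensor_kernel R M N' <#>\<^bsub>free_Abelian_group (carrier M \<times> carrier N')\<^esub>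
      (frag_extend (\<lambda>(x, y). frag_of (x, f y)) ` Z)"

text \<open>
  \<open>Tor\<^sub>i(M, N)\<close>, for a right module \<open>M\<close>, computed from a graded free resolution \<open>F\<close> of the left
  module \<open>N\<close>: the homology of \<open>M \<otimes> P\<^sub>\<bullet>\<close>, where the components of homology are the classes of the
  homogeneous cycles.
\<close>

abbreviation tor_chains ::
    "('r, 'z) ring_scheme \<Rightarrow> ('r, 'm, 'y) module_scheme \<Rightarrow> ('r, 'n) free_complex \<Rightarrow> nat \<Rightarrow>
     ('m \<times> (nat \<Rightarrow> 'r) \<Rightarrow>\<^sub>0 int) set monoid" where
  "tor_chains R M F i \<equiv> tensor_product R M (res_module R F i)"

definition tor_differential ::
    "('r, 'z) ring_scheme \<Rightarrow> ('r, 'm, 'y) module_scheme \<Rightarrow> ('r, 'n) free_complex \<Rightarrow> nat \<Rightarrow>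
     ('m \<times> (nat \<Rightarrow> 'r) \<Rightarrow>\<^sub>0 int) set \<Rightarrow> ('m \<times> (nat \<Rightarrow> 'r) \<Rightarrow>\<^sub>0 int) set" where
  "tor_differential R M F i = tensor_map R M (res_module R F i) (differential F i)"

fun tor_cycles ::
    "('r, 'z) ring_scheme \<Rightarrow> ('r, 'm, 'y) module_scheme \<Rightarrow> ('r, 'n) free_complex \<Rightarrow> nat \<Rightarrow>
     ('m \<times> (nat \<Rightarrow> 'r) \<Rightarrow>\<^sub>0 int) set set" where
  "tor_cycles R M F 0 = carrier (tor_chains R M F 0)"
| "tor_cycles R M F (Suc i) =
    kernel (tor_chains R M F (Suc i)) (tor_chains R M F i) (tor_differential R M F i)"

definition tor_boundaries ::
    "('r, 'z) ring_scheme \<Rightarrow> ('r, 'm, 'y) module_scheme \<Rightarrow> ('r, 'n) free_complex \<Rightarrow> nat \<Rightarrow>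
     ('m \<times> (nat \<Rightarrow> 'r) \<Rightarrow>\<^sub>0 int) set set" where
  "tor_boundaries R M F i = tor_differential R M F i ` carrier (tor_chains R M F (Suc i))"

definition Tor ::
    "('r, 'z) ring_scheme \<Rightarrow> ('r, 'm, 'y) module_scheme \<Rightarrow> ('r, 'n) free_complex \<Rightarrow> nat \<Rightarrow>
     ('m \<times> (nat \<Rightarrow> 'r) \<Rightarrow>\<^sub>0 int) set set monoid" where
  "Tor R M F i = (tor_chains R M F i)\<lparr>carrier := tor_cycles R M F i\<rparr> Mod tor_boundaries R M F i"

definition Tor_component ::
    "('r, 'z) ring_scheme \<Rightarrow> (nat \<Rightarrow> 'r set) \<Rightarrow> ('r, 'm, 'y) module_scheme \<Rightarrow> (nat \<Rightarrow> 'm set) \<Rightarrow>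
     ('r, 'n) free_complex \<Rightarrow> nat \<Rightarrow> nat \<Rightarrow> ('m \<times> (nat \<Rightarrow> 'r) \<Rightarrow>\<^sub>0 int) set set set" where
  "Tor_component R RC M MC F i n =
    (\<lambda>z. tor_boundaries R M F i #>\<^bsub>tor_chains R M F i\<^esub> z) `
      (tor_cycles R M F i \<inter> tensor_component R M MC (res_module R F i) (res_component R RC F i) n)"


section \<open>(a,b)-Koszul algebras\<close>

definition koszul_degree :: "nat \<Rightarrow> nat \<Rightarrow> nat" where
  "koszul_degree s i = (if even i then (i div 2) * s else (i div 2) * s + 1)"

text \<open>\<open>G\<close> is the internal direct sum of its components of degrees \<open>p\<close> and \<open>q\<close> (\<open>p \<noteq> q\<close>).\<close>

definition two_pure :: "('g, 'z) monoid_scheme \<Rightarrow> (nat \<Rightarrow> 'g set) \<Rightarrow> nat \<Rightarrow> nat \<Rightarrow> bool" where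
  "two_pure G GC p q \<longleftrightarrow> carrier G = GC p <#>\<^bsub>G\<^esub> GC q \<and> GC p \<inter> GC q = {\<one>\<^bsub>G\<^esub>}"

text \<open>
  \<open>Tor\<close> does not depend on the resolution, so it is the same to ask for purity for one graded free
  resolution or for all of them. Resolutions whose free modules have at most countably many
  generators, here indexed by natural numbers, always exist: the algebra has countable dimension
  over \<open>k\<close>, hence so do all the successive kernels.
\<close>

definition ab_koszul ::
    "'v set \<Rightarrow> nat \<Rightarrow> nat \<Rightarrow> ('v, 'k::field) tens set \<Rightarrow> ('v, 'k) tens set \<Rightarrow> bool" where
  "ab_koszul E a b Sa Sb \<longleftrightarrow>
    (let J = relation_ideal E Sa Sb;
         B = quotient_algebra E J;
         BC = quotient_component E J
     in \<forall>F. graded_free_resolution B BC trivial_module trivial_component F \<longrightarrow>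
          (\<forall>i\<ge>2. two_pure (Tor B trivial_module F i)
                   (Tor_component B BC trivial_module trivial_component F i)
                   (koszul_degree a i) (koszul_degree b i)))"

end

theory Submission
  imports Defs "HOL-Library.Function_Algebras"
begin

text \<open>
  Since \<open>tau\<close> is an anti-automorphism carrying the ideal of relations of \<open>A\<close> to that of the opposite
  algebra, left modules over the opposite algebra are right modules over \<open>A\<close>, and the claim is that
  \<open>Tor(k, k)\<close> can be computed from a resolution of either argument. Let \<open>F\<close> and \<open>G\<close> be graded free
  resolutions of \<open>k\<close> over \<open>A\<close> and over the opposite algebra. In the double complex \<open>G \<otimes> F\<close>, augmented by
  \<open>k \<otimes> F\<close> and \<open>G \<otimes> k\<close>, all rows and columns except these two are exact, so Bergman's salamander lemma
  carries the vanishing of the homology of \<open>k \<otimes> F\<close> in a given place and degree along a zigzag to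
  that of \<open>G \<otimes> k\<close>. Elements of \<open>G \<otimes> F\<close> are represented by finite matrices over \<open>T(V)\<close>, considered modulo
  the ideal of relations: there the differentials are multiplications by matrices from the left and
  from the right, which commute by associativity.
\<close>

section \<open>Graded ideals of the tensor algebra\<close>

text \<open>The definition of \<open>ab_koszul\<close> quantifies over all resolutions. In the
  conclusion the resolution over the opposite algebra is therefore arbitrary, while over
  \<open>A\<close> a resolution has to be constructed before the hypothesis can be applied; so the
  proof passes both ways between resolutions over the quotient algebra and matrices over
  \<open>T(V)\<close>. What crosses from one algebra to the other is the vanishing of Tor in a
  single internal degree: purity is the conjunction of these vanishings over all degrees but two, so
  no isomorphism of Tor groups is built. Matrices are taken over \<open>T(V)\<close> because
  \<open>tau\<close> maps \<open>T(V)\<close> to itself, whereas on quotients it relates two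
  different algebras; the price is that composites of differentials vanish only modulo an ideal. For
  the augmented complexes to obey the same rules as the resolutions, \<open>k\<close> is treated as
  one more free module, of rank one, whose entries are read modulo the augmentation ideal instead of
  modulo \<open>J\<close>. As \<open>tau\<close> is an involution, one implication suffices.\<close>

abbreviation tens_carrier :: "'v set \<Rightarrow> ('v, 'k::field) tens set" where
  "tens_carrier E \<equiv> carrier (tensor_algebra E)"

lemma tens_carrier_iff:
  "t \<in> tens_carrier E \<longleftrightarrow> (\<forall>w\<in>Poly_Mapping.keys t. set (letters w) \<subseteq> E)"
  by (simp add: tensor_algebra_def)

lemma tensor_algebra_simps [simp]:
  "mult (tensor_algebra E) = (*)" "one (tensor_algebra E) = 1"
  "ring.zero (tensor_algebra E) = 0" "add (tensor_algebra E) = (+)"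
  by (simp_all add: tensor_algebra_def)

lemma zero_in_tens_carrier [simp]: "0 \<in> tens_carrier E"
  by (simp add: tens_carrier_iff)

lemma single_zero_in_tens_carrier [simp]: "Poly_Mapping.single 0 c \<in> tens_carrier E"
  by (auto simp: tens_carrier_iff zero_fword_def split: if_splits)

lemma one_in_tens_carrier [simp]: "1 \<in> tens_carrier E"
  using single_zero_in_tens_carrier[of 1 E] by simp

lemma add_in_tens_carrier [simp]:
  "s \<in> tens_carrier E \<Longrightarrow> t \<in> tens_carrier E \<Longrightarrow> s + t \<in> tens_carrier E"
  using Poly_Mapping.keys_add[of s t] by (auto simp: tens_carrier_iff)

lemma uminus_in_tens_carrier [simp]: "t \<in> tens_carrier E \<Longrightarrow> - t \<in> tens_carrier E"
  by (auto simp: tens_carrier_iff in_keys_iff)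

lemma diff_in_tens_carrier [simp]:
  "s \<in> tens_carrier E \<Longrightarrow> t \<in> tens_carrier E \<Longrightarrow> s - t \<in> tens_carrier E"
  using add_in_tens_carrier[of s E "- t"] by simp

lemma mult_in_tens_carrier [simp]:
  "s \<in> tens_carrier E \<Longrightarrow> t \<in> tens_carrier E \<Longrightarrow> s * t \<in> tens_carrier E"
  using keys_mult[of s t] by (fastforce simp: tens_carrier_iff plus_fword_def)

lemma sum_in_tens_carrier [simp]:
  "(\<And>i. i \<in> I \<Longrightarrow> f i \<in> tens_carrier E) \<Longrightarrow> sum f I \<in> tens_carrier E"
  by (induction I rule: infinite_finite_induct) auto

lemma tau_in_tens_carrier [simp]: "tau t \<in> tens_carrier E \<longleftrightarrow> t \<in> tens_carrier E"
proof -
  have *: "tau t \<in> tens_carrier E" if "t \<in> tens_carrier E" for t :: "('a, 'b) tens"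
    unfolding tens_carrier_iff
  proof
    fix w assume "w \<in> Poly_Mapping.keys (tau t)"
    then have "Word (rev (letters w)) \<in> Poly_Mapping.keys t" by (simp add: in_keys_iff lookup_tau)
    with that show "set (letters w) \<subseteq> E" unfolding tens_carrier_iff by fastforce
  qed
  have "tau (tau t) = t" by (rule poly_mapping_eqI) (simp add: lookup_tau)
  with *[of "tau t"] *[of t] show ?thesis by auto
qed

lemma tau_tau [simp]: "tau (tau t) = t"
  by (rule poly_mapping_eqI) (simp add: lookup_tau)

lemma tau_diff: "tau (s - t) = tau s - tau t"
  by (rule poly_mapping_eqI) (simp add: lookup_tau lookup_minus)

lemma lookup_tau_zero [simp]: "Poly_Mapping.lookup (tau t) 0 = Poly_Mapping.lookup t 0"
  by (simp add: lookup_tau zero_fword_def)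

lemma tau_eq_0_iff [simp]: "tau t = 0 \<longleftrightarrow> t = 0"
  by (metis tau_tau tau_zero)

lemma tpow_iff:
  "t \<in> tpow E n \<longleftrightarrow> t \<in> tens_carrier E \<and> (\<forall>w\<in>Poly_Mapping.keys t. length (letters w) = n)"
  by (simp add: tpow_def)

lemma tpow_subset_tens_carrier: "t \<in> tpow E n \<Longrightarrow> t \<in> tens_carrier E"
  by (simp add: tpow_iff)

lemma zero_in_tpow [simp]: "0 \<in> tpow E n"
  by (simp add: tpow_iff)

lemma add_in_tpow: "s \<in> tpow E n \<Longrightarrow> t \<in> tpow E n \<Longrightarrow> s + t \<in> tpow E n"
  using Poly_Mapping.keys_add[of s t] by (auto simp: tpow_iff)

lemma uminus_in_tpow: "t \<in> tpow E n \<Longrightarrow> - t \<in> tpow E n"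
  by (auto simp: tpow_iff in_keys_iff)

lemma diff_in_tpow: "s \<in> tpow E n \<Longrightarrow> t \<in> tpow E n \<Longrightarrow> s - t \<in> tpow E n"
  using add_in_tpow[of s E n "- t"] uminus_in_tpow by auto

lemma sum_in_tpow: "(\<And>i. i \<in> I \<Longrightarrow> f i \<in> tpow E n) \<Longrightarrow> sum f I \<in> tpow E n"
  by (induction I rule: infinite_finite_induct) (auto intro: add_in_tpow)

lemma single_zero_in_tpow: "Poly_Mapping.single 0 c \<in> tpow E 0"
  using single_zero_in_tens_carrier[of c E] by (simp add: tpow_iff) (simp add: zero_fword_def)

lemma tau_in_tpow [simp]: "tau t \<in> tpow E n \<longleftrightarrow> t \<in> tpow E n"
proof -
  have *: "tau t \<in> tpow E n" if "t \<in> tpow E n" for t :: "('a, 'b) tens"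
    unfolding tpow_iff
  proof
    show "tau t \<in> tens_carrier E" using that by (simp add: tpow_iff)
    show "\<forall>w\<in>Poly_Mapping.keys (tau t). length (letters w) = n"
    proof
      fix w assume "w \<in> Poly_Mapping.keys (tau t)"
      then have "Word (rev (letters w)) \<in> Poly_Mapping.keys t" by (simp add: in_keys_iff lookup_tau)
      with that show "length (letters w) = n" unfolding tpow_iff by fastforce
    qed
  qed
  from *[of "tau t"] *[of t] show ?thesis by auto
qed

text \<open>The coefficient at the empty word is the augmentation of \<open>T(V)\<close>; it is
  multiplicative because a concatenation is empty only if both words are. Both sides are biadditive,
  so monomials suffice.\<close>

lemma lookup_zero_mult:
  "Poly_Mapping.lookup (s * t) 0 = Poly_Mapping.lookup s 0 * Poly_Mapping.lookup t (0::'v fword)"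
  for s t :: "('v, 'k::field) tens"
proof -
  let ?e = "\<lambda>t :: ('v, 'k) tens. \<Sum>w\<in>Poly_Mapping.keys t. Poly_Mapping.single w (Poly_Mapping.lookup t w)"
  have *: "Poly_Mapping.lookup (Poly_Mapping.single u c * Poly_Mapping.single v d) (0::'v fword) =
     Poly_Mapping.lookup (Poly_Mapping.single u c) 0 * Poly_Mapping.lookup (Poly_Mapping.single v d) 0" for u v and c d :: 'k
    by (auto simp: mult_single lookup_single when_def zero_fword_def plus_fword_def)
       (metis append_is_Nil_conv fword.collapse)+
  have "Poly_Mapping.lookup (?e s * ?e t) 0 = Poly_Mapping.lookup (?e s) 0 * Poly_Mapping.lookup (?e t) 0"
    by (simp only: sum_product lookup_sum *)
  then show ?thesis by (simp flip: tens_expand)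
qed

lemma lookup_zero_tpow: "t \<in> tpow E n \<Longrightarrow> 0 < n \<Longrightarrow> Poly_Mapping.lookup t 0 = 0"
  by (rule ccontr) (auto simp: tpow_iff zero_fword_def simp flip: in_keys_iff)

section \<open>Homogeneous components of tensors\<close>

definition hproj :: "nat \<Rightarrow> ('v, 'k::field) tens \<Rightarrow> ('v, 'k) tens" where
  "hproj n t = (\<Sum>w\<in>{w \<in> Poly_Mapping.keys t. length (letters w) = n}. Poly_Mapping.single w (Poly_Mapping.lookup t w))"

lemma lookup_hproj:
  "Poly_Mapping.lookup (hproj n t) w = (if length (letters w) = n then Poly_Mapping.lookup t w else 0)"
proof -
  have "Poly_Mapping.lookup (hproj n t) w =
      (\<Sum>u\<in>{u \<in> Poly_Mapping.keys t. length (letters u) = n}. if u = w then Poly_Mapping.lookup t w else 0)"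
    unfolding hproj_def lookup_sum by (rule sum.cong) (auto simp: lookup_single when_def)
  then show ?thesis by (auto simp: sum.delta in_keys_iff)
qed

lemma hproj_in_tpow: "t \<in> tens_carrier E \<Longrightarrow> hproj n t \<in> tpow E n"
  by (auto simp: tpow_iff tens_carrier_iff in_keys_iff lookup_hproj split: if_splits)

lemma hproj_add: "hproj n (s + t) = hproj n s + hproj n t"
  by (rule poly_mapping_eqI) (simp add: lookup_hproj lookup_add)

lemma hproj_diff: "hproj n (s - t) = hproj n s - hproj n t"
  by (rule poly_mapping_eqI) (simp add: lookup_hproj lookup_minus)

lemma hproj_zero [simp]: "hproj n 0 = 0"
  by (rule poly_mapping_eqI) (simp add: lookup_hproj)

lemma hproj_sum: "hproj n (sum f A) = (\<Sum>x\<in>A. hproj n (f x))"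
  by (induction A rule: infinite_finite_induct) (simp_all add: hproj_add)

lemma hproj_tpow: "t \<in> tpow E m \<Longrightarrow> hproj n t = (if n = m then t else 0)"
  by (rule poly_mapping_eqI) (auto simp: lookup_hproj tpow_iff in_keys_iff)

lemma hproj_tau: "hproj n (tau t) = tau (hproj n t)"
  by (rule poly_mapping_eqI) (simp add: lookup_hproj lookup_tau)

text \<open>For two monomials at most one summand survives, the one with \<open>j\<close> the length
  of the right-hand word; biadditivity gives the rest.\<close>

lemma hproj_mult: "hproj n (s * t) = (\<Sum>j\<le>n. hproj (n - j) s * hproj j t)"
  for s t :: "('v, 'k::field) tens"
proof -
  let ?e = "\<lambda>t :: ('v, 'k) tens. \<Sum>w\<in>Poly_Mapping.keys t. Poly_Mapping.single w (Poly_Mapping.lookup t w)"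
  have h: "hproj m (Poly_Mapping.single u c) = (if length (letters u) = m then Poly_Mapping.single u c else 0)"
    for m and u :: "'v fword" and c :: 'k
    by (rule poly_mapping_eqI) (auto simp: lookup_hproj lookup_single when_def)
  have *: "hproj n (Poly_Mapping.single u c * Poly_Mapping.single v d) =
     (\<Sum>j\<le>n. hproj (n - j) (Poly_Mapping.single u c) * hproj j (Poly_Mapping.single v d))" for u v :: "'v fword" and c d :: 'k
  proof -
    have "(\<Sum>j\<le>n. hproj (n - j) (Poly_Mapping.single u c) * hproj j (Poly_Mapping.single v d)) =
      (\<Sum>j\<le>n. if j = length (letters v) then
         (if length (letters u) + length (letters v) = n then Poly_Mapping.single u c * Poly_Mapping.single v d else 0) else 0)"
      by (rule sum.cong) (auto simp: h)
    also have "\<dots> = (if length (letters u) + length (letters v) = n then Poly_Mapping.single u c * Poly_Mapping.single v d else 0)"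
      by (auto simp: sum.delta)
    also have "\<dots> = hproj n (Poly_Mapping.single u c * Poly_Mapping.single v d)"
      by (simp add: mult_single h plus_fword_def)
    finally show ?thesis by simp
  qed
  have "hproj n (?e s * ?e t) = (\<Sum>j\<le>n. hproj (n - j) (?e s) * hproj j (?e t))"
    unfolding sum_product hproj_sum *
    by (subst sum.swap[of _ _ "{..n}"], rule sum.cong[OF refl], rule sum.swap)
  then show ?thesis by (simp flip: tens_expand)
qed

text \<open>The case distinction is due to truncated subtraction: for \<open>n < d\<close> the
  product has no component of degree \<open>n\<close>, whereas \<open>hproj (n - d) s\<close> would
  be the constant part of \<open>s\<close>.\<close>

lemma hproj_mult_tpow:
  assumes "t \<in> tpow E d"
  shows "hproj n (s * t) = (if d \<le> n then hproj (n - d) s * t else 0)"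
proof -
  have "hproj n (s * t) = (\<Sum>j\<le>n. if j = d then hproj (n - j) s * t else 0)"
    unfolding hproj_mult by (rule sum.cong) (auto simp: hproj_tpow[OF assms])
  then show ?thesis by (simp add: sum.delta)
qed

section \<open>Graded two-sided ideals in positive degrees\<close>

lemma ring_tensor_algebra: "ring (tensor_algebra E :: ('v, 'k::field) tens ring)"
proof (rule ringI)
  show "abelian_group (tensor_algebra E :: ('v, 'k) tens ring)"
  proof (rule abelian_groupI)
    fix t :: "('v, 'k) tens" assume "t \<in> tens_carrier E"
    then show "\<exists>s\<in>tens_carrier E. s \<oplus>\<^bsub>tensor_algebra E\<^esub> t = \<zero>\<^bsub>tensor_algebra E\<^esub>"
      by (intro bexI[of _ "- t"]) auto
  qed (auto simp: algebra_simps)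
  show "Group.monoid (tensor_algebra E :: ('v, 'k) tens ring)"
    by (rule monoidI) (auto simp: algebra_simps)
qed (auto simp: algebra_simps)

text \<open>The interface to the ideal of relations: positivity lets the augmentation descend to the
  quotient, and homogeneity lets lifts modulo \<open>J\<close> be replaced by their homogeneous
  components.\<close>

locale positive_graded_ideal =
  fixes E :: "'v set" and J :: "('v, 'k::field) tens set"
  assumes ideal: "ideal J (tensor_algebra E)"
    and lookup_zero: "t \<in> J \<Longrightarrow> Poly_Mapping.lookup t 0 = 0"
    and hproj_closed: "t \<in> J \<Longrightarrow> hproj n t \<in> J"
begin

sublocale I: ideal J "tensor_algebra E" by (rule ideal)

lemma J_carrier: "t \<in> J \<Longrightarrow> t \<in> tens_carrier E" by (rule I.a_Hcarr)
lemma J_zero [simp]: "0 \<in> J" 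
  using additive_subgroup.zero_closed[OF I.is_additive_subgroup] by simp
lemma J_add: "s \<in> J \<Longrightarrow> t \<in> J \<Longrightarrow> s + t \<in> J"
  using additive_subgroup.a_closed[OF I.is_additive_subgroup, of s t] by simp
lemma J_lmult: "t \<in> J \<Longrightarrow> s \<in> tens_carrier E \<Longrightarrow> s * t \<in> J" using I.I_l_closed by simp
lemma J_rmult: "t \<in> J \<Longrightarrow> s \<in> tens_carrier E \<Longrightarrow> t * s \<in> J" using I.I_r_closed by simp
lemma J_uminus: "t \<in> J \<Longrightarrow> - t \<in> J"
  using J_lmult[of t "- 1"] by simp
lemma J_diff: "s \<in> J \<Longrightarrow> t \<in> J \<Longrightarrow> s - t \<in> J"
  using J_add[of s "- t"] J_uminus by simp
lemma J_sum: "(\<And>i. i \<in> A \<Longrightarrow> f i \<in> J) \<Longrightarrow> sum f A \<in> J"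
  by (induction A rule: infinite_finite_induct) (auto intro: J_add)

end

text \<open>Closure under negation comes from left multiplication by \<open>- 1\<close>.\<close>

lemma ideal_tens_carrierI:
  fixes J :: "('v, 'k::field) tens set"
  assumes "J \<subseteq> tens_carrier E" "0 \<in> J" "\<And>s t. s \<in> J \<Longrightarrow> t \<in> J \<Longrightarrow> s + t \<in> J"
    and "\<And>s t :: ('v, 'k) tens. t \<in> J \<Longrightarrow> s \<in> tens_carrier E \<Longrightarrow> s * t \<in> J"
    and "\<And>s t :: ('v, 'k) tens. t \<in> J \<Longrightarrow> s \<in> tens_carrier E \<Longrightarrow> t * s \<in> J"
  shows "ideal J (tensor_algebra E)"
proof (rule idealI)
  show "ring (tensor_algebra E :: ('v, 'k) tens ring)" by (rule ring_tensor_algebra)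
  then interpret R: ring "tensor_algebra E :: ('v, 'k) tens ring" .
  show "subgroup J (add_monoid (tensor_algebra E))"
  proof (rule group.subgroupI)
    show "Group.group (add_monoid (tensor_algebra E :: ('v, 'k) tens ring))" by (rule R.a_group)
    fix t assume t: "t \<in> J"
    have "\<ominus>\<^bsub>tensor_algebra E\<^esub> t = - t"
      using t assms(1) by (intro R.minus_equality) auto
    moreover have "(- 1) * t \<in> J" using assms(4)[OF t, of "- 1"] by simp
    ultimately show "inv\<^bsub>add_monoid (tensor_algebra E)\<^esub> t \<in> J" by (simp add: a_inv_def)
  qed (use assms in auto)
qed (use assms in auto)

text \<open>\<open>tau\<close> exchanges left and right multiplication, so a two-sided ideal goes to
  a two-sided ideal; it fixes the constant term and commutes with the homogeneous
  projections.\<close>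

lemma positive_graded_ideal_tau:
  fixes J :: "('v, 'k::field) tens set"
  assumes "positive_graded_ideal E J"
  shows "positive_graded_ideal E (tau ` J)"
proof -
  interpret positive_graded_ideal E J by fact
  show ?thesis
  proof (rule positive_graded_ideal.intro)
    show "ideal (tau ` J) (tensor_algebra E)"
    proof (rule ideal_tens_carrierI)
      fix s t :: "('v, 'k) tens" assume t: "t \<in> tau ` J" and s: "s \<in> tens_carrier E"
      then obtain t' where t': "t = tau t'" "t' \<in> J" by blast
      have "s * t = tau (t' * tau s)" "t * s = tau (tau s * t')" by (simp_all add: tau_mult t')
      moreover have "t' * tau s \<in> J" "tau s * t' \<in> J"
        using s t' by (simp_all add: J_lmult J_rmult)
      ultimately show "s * t \<in> tau ` J" "t * s \<in> tau ` J" by auto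
    next
      show "0 \<in> tau ` J" using J_zero tau_zero by (metis imageI)
    qed (auto simp: J_carrier simp flip: tau_add intro: J_add)
  next
    fix t n assume "t \<in> tau ` J"
    then show "Poly_Mapping.lookup t 0 = 0" "hproj n t \<in> tau ` J"
      by (auto simp: lookup_zero hproj_tau hproj_closed)
  qed
qed

lemma genideal_closed:
  assumes "ideal K (tensor_algebra E)" "S \<subseteq> K"
  shows "genideal (tensor_algebra E) S \<subseteq> K"
  using assms by (auto simp: genideal_def)

text \<open>A generated ideal is contained in every ideal containing its generators. This is applied
  to the augmentation ideal \<open>?M\<close>, for positivity, and to the set \<open>?H\<close> of
  members all of whose components are members, for homogeneity. Since \<open>0\<close> lies in both
  spaces, each of them separately is part of the generating set of sums.\<close>

lemma relation_ideal_positive_graded: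
  fixes Sa Sb :: "('v, 'k::field) tens set"
  assumes "2 \<le> a" "2 \<le> b" and Sa: "Sa \<subseteq> tpow E a" and Sb: "Sb \<subseteq> tpow E b" and z: "0 \<in> Sa" "0 \<in> Sb"
  shows "positive_graded_ideal E (relation_ideal E Sa Sb)"
proof -
  let ?G = "{x + y | x y. x \<in> Sa \<and> y \<in> Sb}"
  let ?J = "relation_ideal E Sa Sb"
  interpret R: ring "tensor_algebra E :: ('v, 'k) tens ring" by (rule ring_tensor_algebra)
  have G: "?G \<subseteq> tens_carrier E"
    using Sa Sb by (auto intro!: add_in_tens_carrier dest!: subsetD intro: tpow_subset_tens_carrier)
  have id: "ideal ?J (tensor_algebra E)"
    unfolding relation_ideal_def by (rule R.genideal_ideal[OF G])
  have GJ: "?G \<subseteq> ?J" unfolding relation_ideal_def by (rule R.genideal_self[OF G])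
  then have SaJ: "Sa \<subseteq> ?J" and SbJ: "Sb \<subseteq> ?J" using z by force+
  interpret I: ideal ?J "tensor_algebra E" by (rule id)
  have add: "s + t \<in> ?J" if "s \<in> ?J" "t \<in> ?J" for s t 
    using additive_subgroup.a_closed[OF I.is_additive_subgroup that] by simp
  have lm: "s * t \<in> ?J" if "t \<in> ?J" "s \<in> tens_carrier E" for s t using I.I_l_closed[OF that] by simp
  have rm: "t * s \<in> ?J" if "t \<in> ?J" "s \<in> tens_carrier E" for s t using I.I_r_closed[OF that] by simp
  have zJ: "0 \<in> ?J" using additive_subgroup.zero_closed[OF I.is_additive_subgroup] by simp
  have sm: "(\<And>i. i \<in> A \<Longrightarrow> f i \<in> ?J) \<Longrightarrow> sum f A \<in> ?J" for f :: "nat \<Rightarrow> _" and A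
    by (induction A rule: infinite_finite_induct) (auto intro: add zJ)
  let ?M = "{t \<in> tens_carrier E. Poly_Mapping.lookup t 0 = 0}"
  have "ideal ?M (tensor_algebra E)"
    by (rule ideal_tens_carrierI) (auto simp: lookup_add lookup_zero_mult)
  moreover have "?G \<subseteq> ?M"
  proof -
    have "Poly_Mapping.lookup x 0 = 0" if "x \<in> Sa \<or> x \<in> Sb" for x
      using that Sa Sb assms(1,2) lookup_zero_tpow[of x E a] lookup_zero_tpow[of x E b] by auto
    then show ?thesis using G by (auto simp: lookup_add)
  qed
  ultimately have JM: "?J \<subseteq> ?M" unfolding relation_ideal_def by (rule genideal_closed)
  let ?H = "{t \<in> ?J. \<forall>n. hproj n t \<in> ?J}"
  have hc: "hproj n s \<in> tens_carrier E" if "s \<in> tens_carrier E" for s :: "('v, 'k) tens" and n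
    using hproj_in_tpow[OF that] tpow_subset_tens_carrier by blast
  have "ideal ?H (tensor_algebra E)"
  proof (rule ideal_tens_carrierI)
    show "?H \<subseteq> tens_carrier E" using I.a_subset by auto
  next
    fix s t :: "('v, 'k) tens" assume t: "t \<in> ?H" and s: "s \<in> tens_carrier E"
    have "hproj n (s * t) \<in> ?J" for n
      unfolding hproj_mult using t by (intro sm lm hc s) auto
    moreover have "hproj n (t * s) \<in> ?J" for n
      unfolding hproj_mult using t by (intro sm rm hc s) auto
    ultimately show "s * t \<in> ?H" "t * s \<in> ?H" using t s by (auto intro: lm rm)
  qed (auto simp: zJ hproj_add add)
  moreover have "?G \<subseteq> ?H"
  proof
    fix t assume t: "t \<in> ?G"
    then obtain x y where xy: "t = x + y" "x \<in> Sa" "y \<in> Sb" by blast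
    have "hproj n t \<in> ?J" for n
      using xy Sa Sb SaJ SbJ zJ by (auto simp: hproj_add hproj_tpow[of x E a] hproj_tpow[of y E b] subset_iff intro: add)
    with GJ t show "t \<in> ?H" by blast
  qed
  ultimately have "?J \<subseteq> ?H" unfolding relation_ideal_def by (rule genideal_closed)
  with JM id show ?thesis by unfold_locales auto
qed

lemma relation_ideal_tau_subset:
  fixes Sa Sb :: "('v, 'k::field) tens set"
  assumes "positive_graded_ideal E (relation_ideal E Sa Sb)"
    and "Sa \<subseteq> tens_carrier E" "Sb \<subseteq> tens_carrier E"
  shows "relation_ideal E (tau ` Sa) (tau ` Sb) \<subseteq> tau ` relation_ideal E Sa Sb"
proof -
  let ?G = "{x + y | x y. x \<in> Sa \<and> y \<in> Sb}"
  interpret R: ring "tensor_algebra E :: ('v, 'k) tens ring" by (rule ring_tensor_algebra)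
  interpret T: positive_graded_ideal E "tau ` relation_ideal E Sa Sb"
    by (rule positive_graded_ideal_tau) fact
  have "?G \<subseteq> relation_ideal E Sa Sb"
    unfolding relation_ideal_def using assms(2,3)
    by (intro R.genideal_self) (auto intro!: add_in_tens_carrier)
  then have "{x + y | x y. x \<in> tau ` Sa \<and> y \<in> tau ` Sb} \<subseteq> tau ` relation_ideal E Sa Sb"
    by (force simp flip: tau_add)
  then show ?thesis unfolding relation_ideal_def[of E "tau ` Sa"] by (rule genideal_closed[OF T.ideal])
qed

text \<open>Minimality of the generated ideal gives one inclusion; the other is the same inclusion
  for the reversed relations, carried back by \<open>tau\<close>.\<close>

lemma relation_ideal_tau:
  fixes Sa Sb :: "('v, 'k::field) tens set"
  assumes "2 \<le> a" "2 \<le> b" and Sa: "Sa \<subseteq> tpow E a" and Sb: "Sb \<subseteq> tpow E b" and z: "0 \<in> Sa" "0 \<in> Sb"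
  shows "relation_ideal E (tau ` Sa) (tau ` Sb) = tau ` relation_ideal E Sa Sb"
proof
  have 1: "positive_graded_ideal E (relation_ideal E Sa Sb)"
    using assms by (rule relation_ideal_positive_graded)
  have t: "tau ` Sa \<subseteq> tpow E a" "tau ` Sb \<subseteq> tpow E b" "0 \<in> tau ` Sa" "0 \<in> tau ` Sb"
    using Sa Sb z tau_zero by (auto intro: rev_image_eqI)
  have 2: "positive_graded_ideal E (relation_ideal E (tau ` Sa) (tau ` Sb))"
    using assms(1,2) t by (rule relation_ideal_positive_graded)
  show "relation_ideal E (tau ` Sa) (tau ` Sb) \<subseteq> tau ` relation_ideal E Sa Sb"
    using Sa Sb by (intro relation_ideal_tau_subset 1) (auto intro: tpow_subset_tens_carrier)
  have "relation_ideal E (tau ` tau ` Sa) (tau ` tau ` Sb) \<subseteq> tau ` relation_ideal E (tau ` Sa) (tau ` Sb)"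
    using t by (intro relation_ideal_tau_subset 2) (auto intro: tpow_subset_tens_carrier)
  then show "tau ` relation_ideal E Sa Sb \<subseteq> relation_ideal E (tau ` Sa) (tau ` Sb)"
    by (force simp: image_image)
qed

section \<open>Double complexes\<close>

text \<open>A double complex with terms \<open>C p q\<close> modulo \<open>N p q\<close>, kept as
  pairs so that no quotient is formed: equations of the quotient become membership in
  \<open>N\<close>. \<open>f\<close> lowers \<open>q\<close>, \<open>g\<close> lowers
  \<open>p\<close>, and the two commute without sign. Indices are truncated at \<open>0\<close>, so
  on the edges \<open>f\<close> and \<open>g\<close> map a position to itself. Row \<open>p\<close>
  is exact for \<open>p > 0\<close> and column \<open>q\<close> for \<open>q > 0\<close>; the row
  \<open>p = 0\<close> and the column \<open>q = 0\<close> carry the homology to be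
  compared.\<close>

locale double_complex =
  fixes C N :: "nat \<Rightarrow> nat \<Rightarrow> 'd::ab_group_add set"
    and f g :: "nat \<Rightarrow> nat \<Rightarrow> 'd \<Rightarrow> 'd"
  assumes C_diff: "c \<in> C p q \<Longrightarrow> d \<in> C p q \<Longrightarrow> c - d \<in> C p q"
    and N_subset: "c \<in> N p q \<Longrightarrow> c \<in> C p q"
    and N_diff: "c \<in> N p q \<Longrightarrow> d \<in> N p q \<Longrightarrow> c - d \<in> N p q"
    and f_closed: "c \<in> C p q \<Longrightarrow> f p q c \<in> C p (q - 1)"
    and g_closed: "c \<in> C p q \<Longrightarrow> g p q c \<in> C (p - 1) q"
    and f_N: "c \<in> N p q \<Longrightarrow> f p q c \<in> N p (q - 1)"
    and g_N: "c \<in> N p q \<Longrightarrow> g p q c \<in> N (p - 1) q"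
    and f_diff: "c \<in> C p q \<Longrightarrow> d \<in> C p q \<Longrightarrow> f p q (c - d) = f p q c - f p q d"
    and g_diff: "c \<in> C p q \<Longrightarrow> d \<in> C p q \<Longrightarrow> g p q (c - d) = g p q c - g p q d"
    and f_f: "c \<in> C p q \<Longrightarrow> f p (q - 1) (f p q c) \<in> N p (q - 1 - 1)"
    and g_g: "c \<in> C p q \<Longrightarrow> g (p - 1) q (g p q c) \<in> N (p - 1 - 1) q"
    and f_g: "c \<in> C p q \<Longrightarrow> f (p - 1) q (g p q c) = g p (q - 1) (f p q c)"
    and f_exact: "0 < p \<Longrightarrow> c \<in> C p q \<Longrightarrow> f p q c \<in> N p (q - 1) \<Longrightarrow>
      \<exists>b\<in>C p (Suc q). c - f p (Suc q) b \<in> N p q"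
    and g_exact: "0 < q \<Longrightarrow> c \<in> C p q \<Longrightarrow> g p q c \<in> N (p - 1) q \<Longrightarrow>
      \<exists>b\<in>C (Suc p) q. c - g (Suc p) q b \<in> N p q"
begin

text \<open>Vanishing of Bergman's receptor: the intersection of the kernels of the two outgoing
  maps, modulo the image of the incoming diagonal.\<close>

definition receptor_vanishes :: "nat \<Rightarrow> nat \<Rightarrow> bool" where
  "receptor_vanishes p q \<longleftrightarrow> (\<forall>c\<in>C p q. f p q c \<in> N p (q - 1) \<longrightarrow> g p q c \<in> N (p - 1) q \<longrightarrow>
    (\<exists>b\<in>C (Suc p) (Suc q). c - g (Suc p) q (f (Suc p) (Suc q) b) \<in> N p q))"

text \<open>Vanishing of Bergman's donor: the kernel of the outgoing diagonal, modulo the sum of the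
  images of the two incoming maps.\<close>

definition donor_vanishes :: "nat \<Rightarrow> nat \<Rightarrow> bool" where
  "donor_vanishes p q \<longleftrightarrow> (\<forall>c\<in>C p q. g p (q - 1) (f p q c) \<in> N (p - 1) (q - 1) \<longrightarrow>
    (\<exists>u\<in>C (Suc p) q. \<exists>v\<in>C p (Suc q). c - g (Suc p) q u - f p (Suc q) v \<in> N p q))"

lemma N_add: "c \<in> N p q \<Longrightarrow> d \<in> N p q \<Longrightarrow> c + d \<in> N p q"
  using N_diff[of c p q "d - d - d"] N_diff[of d p q d] N_diff[of "d - d" p q d] by simp

text \<open>\<open>g\<close> induces the extramural map from the donor at \<open>(Suc p, q)\<close>
  to the receptor at \<open>(p, q)\<close>; exactness of column \<open>q\<close> makes it
  injective.\<close>

lemma donor_if_receptor: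
  assumes "0 < q" "receptor_vanishes p q"
  shows "donor_vanishes (Suc p) q"
  unfolding donor_vanishes_def
proof (intro ballI impI)
  fix c assume c: "c \<in> C (Suc p) q" and gf: "g (Suc p) (q - 1) (f (Suc p) q c) \<in> N (Suc p - 1) (q - 1)"
  let ?d = "g (Suc p) q c"
  have d: "?d \<in> C p q" using g_closed[OF c] by simp
  have "f p q ?d \<in> N p (q - 1)" using gf f_g[OF c] by simp
  moreover have "g p q ?d \<in> N (p - 1) q" using g_g[OF c] by simp
  ultimately obtain b where b: "b \<in> C (Suc p) (Suc q)"
    and db: "?d - g (Suc p) q (f (Suc p) (Suc q) b) \<in> N p q"
    using assms(2) d unfolding receptor_vanishes_def by blast
  have fb: "f (Suc p) (Suc q) b \<in> C (Suc p) q" using f_closed[OF b] by simp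
  have "g (Suc p) q (c - f (Suc p) (Suc q) b) \<in> N (Suc p - 1) q"
    using db g_diff[OF c fb] by simp
  from g_exact[OF assms(1) C_diff[OF c fb] this] obtain u
    where "u \<in> C (Suc (Suc p)) q" "c - f (Suc p) (Suc q) b - g (Suc (Suc p)) q u \<in> N (Suc p) q"
    by blast
  with b show "\<exists>u\<in>C (Suc (Suc p)) q. \<exists>v\<in>C (Suc p) (Suc q).
      c - g (Suc (Suc p)) q u - f (Suc p) (Suc q) v \<in> N (Suc p) q"
    by (intro bexI[of _ u] bexI[of _ b]) (simp_all add: algebra_simps)
qed

text \<open>\<open>f\<close> induces the extramural map from the donor at \<open>(p, Suc q)\<close>
  to the receptor at \<open>(p, q)\<close>; exactness of row \<open>p\<close> makes it surjective. A
  lift \<open>b\<close> of \<open>c\<close> along \<open>f\<close> is killed by the diagonal, hence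
  comes from the two incoming maps, and the part coming along \<open>f\<close> is killed by the next
  \<open>f\<close>.\<close>

lemma receptor_if_donor:
  assumes "0 < p" "donor_vanishes p (Suc q)"
  shows "receptor_vanishes p q"
  unfolding receptor_vanishes_def
proof (intro ballI impI)
  fix c assume c: "c \<in> C p q" and fc: "f p q c \<in> N p (q - 1)" and gc: "g p q c \<in> N (p - 1) q"
  from f_exact[OF assms(1) c fc] obtain b where b: "b \<in> C p (Suc q)" and cb: "c - f p (Suc q) b \<in> N p q"
    by blast
  have fb: "f p (Suc q) b \<in> C p q" using f_closed[OF b] by simp
  have "g p q c - g p q (c - f p (Suc q) b) \<in> N (p - 1) q"
    using gc g_N[OF cb] by (rule N_diff)
  then have "g p (Suc q - 1) (f p (Suc q) b) \<in> N (p - 1) (Suc q - 1)"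
    by (simp add: g_diff[OF c fb])
  with assms(2) b obtain u v where u: "u \<in> C (Suc p) (Suc q)" and v: "v \<in> C p (Suc (Suc q))"
    and uv: "b - g (Suc p) (Suc q) u - f p (Suc (Suc q)) v \<in> N p (Suc q)"
    unfolding donor_vanishes_def by blast
  have gu: "g (Suc p) (Suc q) u \<in> C p (Suc q)" using g_closed[OF u] by simp
  have fv: "f p (Suc (Suc q)) v \<in> C p (Suc q)" using f_closed[OF v] by simp
  have "f p (Suc q) (b - g (Suc p) (Suc q) u - f p (Suc (Suc q)) v) \<in> N p q"
    using f_N[OF uv] by simp
  then have 1: "f p (Suc q) b - f p (Suc q) (g (Suc p) (Suc q) u) - f p (Suc q) (f p (Suc (Suc q)) v) \<in> N p q"
    using f_diff[OF C_diff[OF b gu] fv] f_diff[OF b gu] by simp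
  have 2: "f p (Suc q) (f p (Suc (Suc q)) v) \<in> N p q" using f_f[OF v] by simp
  have "f p (Suc q) b - f p (Suc q) (g (Suc p) (Suc q) u) \<in> N p q"
    using N_add[OF 1 2] by simp
  from N_add[OF cb this] have "c - f p (Suc q) (g (Suc p) (Suc q) u) \<in> N p q" by simp
  then show "\<exists>b\<in>C (Suc p) (Suc q). c - g (Suc p) q (f (Suc p) (Suc q) b) \<in> N p q"
    using u f_g[OF u] by (intro bexI[of _ u]) simp_all
qed

text \<open>Each step goes through the donor at \<open>(Suc p, Suc q)\<close> and uses one column
  and one row. Only columns with positive \<open>q\<close> and rows with positive \<open>p\<close>
  are met, so the two edges may fail to be exact.\<close>

lemma receptor_zigzag: "receptor_vanishes p q \<Longrightarrow> receptor_vanishes (p + q) 0"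
proof (induction q arbitrary: p)
  case (Suc q)
  have "donor_vanishes (Suc p) (Suc q)"
    by (rule donor_if_receptor[OF _ Suc.prems]) simp
  then have "receptor_vanishes (Suc p) q"
    by (intro receptor_if_donor) auto
  from Suc.IH[OF this] show ?case by simp
qed simp

end


section \<open>Resolutions by matrices over the tensor algebra\<close>

type_synonym ('v, 'k) tvec = "nat \<Rightarrow> ('v, 'k) tens"

text \<open>The component of degree \<open>n\<close> of the free left \<open>T(V)\<close>-module on
  \<open>X\<close> with generators in degrees \<open>dg\<close>. The condition
  \<open>dg x \<le> n\<close> excludes constants at generators of larger degree, which
  \<open>n - dg x = 0\<close> would admit.\<close>

definition hvecs :: "'v set \<Rightarrow> nat set \<Rightarrow> (nat \<Rightarrow> nat) \<Rightarrow> nat \<Rightarrow> (nat \<Rightarrow> ('v, 'k::field) tens) set" where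
  "hvecs E X dg n = {v. finite {x. v x \<noteq> 0} \<and> (\<forall>x. v x \<noteq> 0 \<longrightarrow> x \<in> X \<and> dg x \<le> n \<and> v x \<in> tpow E (n - dg x))}"

text \<open>A left-linear map of free modules multiplies row vectors by a matrix from the right; the
  row \<open>D x\<close> is the image of the generator \<open>x\<close>. Summing over the support of
  \<open>v\<close> allows infinitely many generators.\<close>

definition row_mult :: "(nat \<Rightarrow> 'a::ring_1) \<Rightarrow> (nat \<Rightarrow> nat \<Rightarrow> 'a) \<Rightarrow> nat \<Rightarrow> 'a" where
  "row_mult v D = (\<lambda>u. \<Sum>x | v x \<noteq> 0. v x * D x u)"

text \<open>The range of summation depends on the vector; a common finite range makes different
  vectors comparable.\<close>

lemma row_mult_superset:
  assumes "finite S" "{x. v x \<noteq> 0} \<subseteq> S"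
  shows "row_mult v D u = (\<Sum>x\<in>S. v x * D x u)"
  unfolding row_mult_def using assms by (intro sum.mono_neutral_left) auto

lemma row_mult_add:
  assumes "finite {x. v x \<noteq> 0}" "finite {x. w x \<noteq> 0}"
  shows "row_mult (v + w) D = row_mult v D + row_mult w D"
proof
  fix u
  let ?S = "{x. v x \<noteq> 0} \<union> {x. w x \<noteq> 0}"
  have "row_mult (v + w) D u = (\<Sum>x\<in>?S. (v + w) x * D x u)"
    using assms by (intro row_mult_superset) auto
  also have "\<dots> = (\<Sum>x\<in>?S. v x * D x u) + (\<Sum>x\<in>?S. w x * D x u)"
    by (simp add: algebra_simps sum.distrib)
  also have "\<dots> = row_mult v D u + row_mult w D u"
    using assms by (simp add: row_mult_superset[of ?S v] row_mult_superset[of ?S w])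
  finally show "row_mult (v + w) D u = (row_mult v D + row_mult w D) u" by simp
qed

lemma row_mult_diff:
  assumes "finite {x. v x \<noteq> 0}" "finite {x. w x \<noteq> 0}"
  shows "row_mult (v - w) D = row_mult v D - row_mult w D"
proof -
  have "finite {x. (v - w) x \<noteq> 0}"
    by (rule finite_subset[of _ "{x. v x \<noteq> 0} \<union> {x. w x \<noteq> 0}"]) (use assms in auto)
  from row_mult_add[OF this assms(2), of D] show ?thesis by (metis add_diff_cancel_right' diff_add_cancel)
qed

lemma row_mult_zero_left [simp]: "row_mult 0 D = 0" "row_mult (\<lambda>x. 0) D = 0"
  by (simp_all add: row_mult_def fun_eq_iff)

lemma row_mult_zero_right [simp]: "row_mult v (\<lambda>x u. 0) = 0" "row_mult v 0 = 0"
  by (simp_all add: row_mult_def fun_eq_iff)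

lemma row_mult_support: "{u. row_mult v D u \<noteq> 0} \<subseteq> (\<Union>x\<in>{x. v x \<noteq> 0}. {u. D x u \<noteq> 0})"
proof
  fix u assume "u \<in> {u. row_mult v D u \<noteq> 0}"
  then have "(\<Sum>x | v x \<noteq> 0. v x * D x u) \<noteq> 0" by (simp add: row_mult_def)
  then obtain x where "v x \<noteq> 0" "v x * D x u \<noteq> 0" by (metis (mono_tags, lifting) mem_Collect_eq sum.neutral)
  then show "u \<in> (\<Union>x\<in>{x. v x \<noteq> 0}. {u. D x u \<noteq> 0})" by force
qed

text \<open>Only finitely many rows of \<open>D\<close> enter, each of finite support, so the double
  sum runs over a finite rectangle and can be exchanged.\<close>

lemma row_mult_assoc:
  assumes v: "finite {x. v x \<noteq> 0}" and D: "\<And>x. v x \<noteq> 0 \<Longrightarrow> finite {y. D x y \<noteq> 0}"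
  shows "row_mult (row_mult v D) D' u = row_mult v (\<lambda>x. row_mult (D x) D') u"
proof -
  let ?S = "\<Union>x\<in>{x. v x \<noteq> 0}. {u. D x u \<noteq> 0}"
  have S: "finite ?S" using v D by auto
  have "row_mult (row_mult v D) D' u = (\<Sum>y\<in>?S. (\<Sum>x | v x \<noteq> 0. v x * D x y) * D' y u)"
    by (subst row_mult_superset[OF S row_mult_support]) (simp add: row_mult_def)
  also have "\<dots> = (\<Sum>x | v x \<noteq> 0. v x * (\<Sum>y\<in>?S. D x y * D' y u))"
    unfolding sum_distrib_left sum_distrib_right by (subst sum.swap) (simp add: mult.assoc)
  also have "\<dots> = (\<Sum>x | v x \<noteq> 0. v x * row_mult (D x) D' u)"
    using S by (intro sum.cong refl arg_cong2[where f = "(*)"] row_mult_superset[symmetric]) auto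
  finally show ?thesis by (simp add: row_mult_def)
qed

lemma hvecsD:
  assumes "v \<in> hvecs E X dg n"
  shows "finite {x. v x \<noteq> 0}" "v x \<in> tens_carrier E" "v x \<in> tpow E (n - dg x)"
    "v x \<noteq> 0 \<Longrightarrow> x \<in> X" "v x \<noteq> 0 \<Longrightarrow> dg x \<le> n"
  using assms by (auto simp: hvecs_def intro: tpow_subset_tens_carrier) (metis zero_in_tpow zero_in_tens_carrier tpow_subset_tens_carrier)+

lemma zero_in_hvecs [simp]: "0 \<in> hvecs E X dg n" "(\<lambda>x. 0) \<in> hvecs E X dg n"
  by (simp_all add: hvecs_def)

lemma diff_in_hvecs: "v \<in> hvecs E X dg n \<Longrightarrow> w \<in> hvecs E X dg n \<Longrightarrow> v - w \<in> hvecs E X dg n"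
proof -
  assume vw: "v \<in> hvecs E X dg n" "w \<in> hvecs E X dg n"
  have "finite {x. (v - w) x \<noteq> 0}"
    by (rule finite_subset[of _ "{x. v x \<noteq> 0} \<union> {x. w x \<noteq> 0}"]) (use vw in \<open>auto simp: hvecsD(1)\<close>)
  moreover have "x \<in> X \<and> dg x \<le> n \<and> (v - w) x \<in> tpow E (n - dg x)" if "(v - w) x \<noteq> 0" for x
  proof -
    from that have "v x \<noteq> 0 \<or> w x \<noteq> 0" by auto
    then show ?thesis using vw hvecsD[OF vw(1)] hvecsD[OF vw(2)] by (auto intro: diff_in_tpow)
  qed
  ultimately show ?thesis by (simp add: hvecs_def)
qed

text \<open>The degrees \<open>n - dg x\<close> and \<open>dg x - dg' u\<close> add up to
  \<open>n - dg' u\<close>; wherever a product is nonzero, the inequalities that this needs for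
  truncated subtraction are available.\<close>

lemma row_mult_in_hvecs:
  assumes v: "v \<in> hvecs E X dg n" and D: "\<And>x. x \<in> X \<Longrightarrow> D x \<in> hvecs E Y dg' (dg x)"
  shows "row_mult v D \<in> hvecs E Y dg' n"
  unfolding hvecs_def
proof (intro CollectI conjI allI impI)
  show "finite {u. row_mult v D u \<noteq> 0}"
    by (rule finite_subset[OF row_mult_support]) (use v D in \<open>auto intro!: hvecsD(1) dest: hvecsD(4)\<close>)
  fix u assume "row_mult v D u \<noteq> 0"
  then obtain x where x: "v x \<noteq> 0" "D x u \<noteq> 0" using row_mult_support[of v D] by blast
  with v have xX: "x \<in> X" and "dg x \<le> n" by (auto dest: hvecsD)
  with x D[OF xX] show u: "u \<in> Y" "dg' u \<le> n" by (auto dest: hvecsD)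
  show "row_mult v D u \<in> tpow E (n - dg' u)"
    unfolding row_mult_def
  proof (rule sum_in_tpow)
    fix y assume "y \<in> {x. v x \<noteq> 0}"
    then have y: "y \<in> X" "dg y \<le> n" "v y \<in> tpow E (n - dg y)" using v by (auto dest: hvecsD)
    show "v y * D y u \<in> tpow E (n - dg' u)"
    proof (cases "D y u = 0")
      case False
      with D[OF y(1)] have "dg' u \<le> dg y" "D y u \<in> tpow E (dg y - dg' u)" by (auto dest: hvecsD)
      with tpow_mult[OF y(3) this(2)] y(2) show ?thesis by simp
    qed simp
  qed
qed

definition aug_ideal :: "'v set \<Rightarrow> ('v, 'k::field) tens set" where
  "aug_ideal E = {t \<in> tens_carrier E. Poly_Mapping.lookup t 0 = 0}"

lemma aug_ideal_closed:
  "0 \<in> aug_ideal E"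
  "s \<in> aug_ideal E \<Longrightarrow> t \<in> aug_ideal E \<Longrightarrow> s + t \<in> aug_ideal E"
  "s \<in> aug_ideal E \<Longrightarrow> t \<in> aug_ideal E \<Longrightarrow> s - t \<in> aug_ideal E"
  "s \<in> tens_carrier E \<Longrightarrow> t \<in> aug_ideal E \<Longrightarrow> s * t \<in> aug_ideal E"
  "s \<in> tens_carrier E \<Longrightarrow> t \<in> aug_ideal E \<Longrightarrow> t * s \<in> aug_ideal E"
  "tau u \<in> aug_ideal E \<longleftrightarrow> u \<in> aug_ideal E"
  "finite A \<Longrightarrow> (\<And>i. i \<in> A \<Longrightarrow> h i \<in> aug_ideal E) \<Longrightarrow> sum h A \<in> aug_ideal E"
  by (auto simp: aug_ideal_def lookup_add lookup_minus lookup_zero_mult lookup_sum)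

text \<open>
  A graded free resolution of the trivial module, lifted to \<open>T(V)\<close>: the trivial module sits in
  position \<open>0\<close> as a quotient of \<open>T(V)\<close>, so that the module \<open>P\<^sub>i\<close> of the resolution is in position
  \<open>i + 1\<close>, and \<open>D q\<close> is the matrix of the map from position \<open>q\<close> to position \<open>q - 1\<close> (which is the
  zero map of position \<open>0\<close> for \<open>q = 0\<close>).
\<close>

locale matrix_resolution = positive_graded_ideal E J
  for E :: "'v set" and J :: "('v, 'k::field) tens set" +
  fixes X :: "nat \<Rightarrow> nat set" and dg :: "nat \<Rightarrow> nat \<Rightarrow> nat"
    and D :: "nat \<Rightarrow> nat \<Rightarrow> ('v, 'k) tvec"
  assumes X_0: "X 0 = {0}" and dg_0: "dg 0 0 = 0" and D_0: "D 0 = 0"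
    and D_hvecs: "x \<in> X q \<Longrightarrow> D q x \<in> hvecs E (X (q - 1)) (dg (q - 1)) (dg q x)"
    and D_D: "x \<in> X q \<Longrightarrow>
      row_mult (D q x) (D (q - 1)) u \<in> (if q \<le> 2 then aug_ideal E else J)"
    and exact: "v \<in> hvecs E (X q) (dg q) n \<Longrightarrow>
      (\<And>u. row_mult v (D q) u \<in> (if q \<le> 1 then aug_ideal E else J)) \<Longrightarrow>
      \<exists>w\<in>hvecs E (X (Suc q)) (dg (Suc q)) n. \<forall>x. v x - row_mult w (D (Suc q)) x \<in> (if q = 0 then aug_ideal E else J)"
begin

text \<open>k \<otimes> P is P with entries modulo the augmentation ideal, so for
  \<open>i > 0\<close> this says that Tor of index \<open>i\<close> is zero in degree
  \<open>n\<close>, in terms of lifts to \<open>T(V)\<close>. Position \<open>Suc i\<close> holds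
  the module of index \<open>i\<close>.\<close>

definition tor_vanishes :: "nat \<Rightarrow> nat \<Rightarrow> bool" where
  "tor_vanishes i n \<longleftrightarrow> (\<forall>v\<in>hvecs E (X (Suc i)) (dg (Suc i)) n.
    (\<forall>u. row_mult v (D (Suc i)) u \<in> aug_ideal E) \<longrightarrow>
    (\<exists>w\<in>hvecs E (X (Suc (Suc i))) (dg (Suc (Suc i))) n. \<forall>x. v x - row_mult w (D (Suc (Suc i))) x \<in> aug_ideal E))"

end

lemma (in positive_graded_ideal) J_aug: "t \<in> J \<Longrightarrow> t \<in> aug_ideal E"
  by (simp add: aug_ideal_def lookup_zero J_carrier)

text \<open>The entry \<open>c y x\<close> stands for the element y \<otimes> c \<otimes> x in the
  tensor product of a right free module on \<open>Y\<close> with a left free module on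
  \<open>X\<close>. Its degree is the sum of three degrees, whence \<open>n - (dy y + dx x)\<close>
  for the entry.\<close>

definition bimatrices :: "'v set \<Rightarrow> nat set \<Rightarrow> (nat \<Rightarrow> nat) \<Rightarrow> nat set \<Rightarrow> (nat \<Rightarrow> nat) \<Rightarrow> nat \<Rightarrow>
    (nat \<Rightarrow> nat \<Rightarrow> ('v, 'k::field) tens) set" where
  "bimatrices E Y dy X dx n = {c. finite {(y, x). c y x \<noteq> 0} \<and>
     (\<forall>y x. c y x \<noteq> 0 \<longrightarrow> y \<in> Y \<and> x \<in> X \<and> dy y + dx x \<le> n \<and> c y x \<in> tpow E (n - (dy y + dx x)))}"

text \<open>Transposition with \<open>tau\<close> on the entries: it exchanges the two tensor
  factors and the two sides of multiplication, so that one row-wise multiplication serves for both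
  differentials.\<close>

definition flip :: "(nat \<Rightarrow> nat \<Rightarrow> ('v, 'k::field) tens) \<Rightarrow> nat \<Rightarrow> ('v, 'k) tvec" where
  "flip c = (\<lambda>x y. tau (c y x))"

lemma flip_flip [simp]: "flip (flip c) = c"
  by (simp add: flip_def)

lemma flip_diff: "flip (c - d) = flip c - flip d"
  by (simp add: flip_def tau_diff fun_eq_iff)

lemma flip_in_bimatrices: "c \<in> bimatrices E Y dy X dx n \<Longrightarrow> flip c \<in> bimatrices E X dx Y dy n"
proof -
  assume c: "c \<in> bimatrices E Y dy X dx n"
  have "{(x, y). flip c x y \<noteq> 0} = prod.swap ` {(y, x). c y x \<noteq> 0}"
    by (auto simp: flip_def)
  with c show ?thesis by (auto simp: bimatrices_def flip_def add.commute)
qed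

lemma bimatrices_row:
  assumes c: "c \<in> bimatrices E Y dy X dx n"
  shows "finite {y. c y \<noteq> 0}" "c y \<noteq> 0 \<Longrightarrow> y \<in> Y" "c y \<noteq> 0 \<Longrightarrow> dy y \<le> n" "c y \<in> hvecs E X dx (n - dy y)"
proof -
  have fin: "finite {(y, x). c y x \<noteq> 0}" using c by (simp add: bimatrices_def)
  have "{y. c y \<noteq> 0} \<subseteq> fst ` {(y, x). c y x \<noteq> 0}" by (force simp: fun_eq_iff)
  then show "finite {y. c y \<noteq> 0}" using fin by (meson finite_imageI finite_subset)
  show "c y \<noteq> 0 \<Longrightarrow> y \<in> Y" "c y \<noteq> 0 \<Longrightarrow> dy y \<le> n"
    using c by (auto simp: bimatrices_def fun_eq_iff dest: add_leD1)
  have "{x. c y x \<noteq> 0} \<subseteq> snd ` {(y, x). c y x \<noteq> 0}" by force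
  then have "finite {x. c y x \<noteq> 0}" using fin by (meson finite_imageI finite_subset)
  with c show "c y \<in> hvecs E X dx (n - dy y)" by (fastforce simp: bimatrices_def hvecs_def)
qed

lemma bimatricesI:
  assumes "finite {y. c y \<noteq> 0}" and "\<And>y. c y \<noteq> 0 \<Longrightarrow> y \<in> Y \<and> dy y \<le> n \<and> c y \<in> hvecs E X dx (n - dy y)"
  shows "c \<in> bimatrices E Y dy X dx n"
proof -
  have nz: "c y \<noteq> 0" if "c y x \<noteq> 0" for x y using that by (auto simp: fun_eq_iff)
  have "{(y, x). c y x \<noteq> 0} \<subseteq> (SIGMA y:{y. c y \<noteq> 0}. {x. c y x \<noteq> 0})" using nz by auto
  moreover have "finite (SIGMA y:{y. c y \<noteq> 0}. {x. c y x \<noteq> 0})"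
    using assms by (auto simp: hvecs_def)
  ultimately have "finite {(y, x). c y x \<noteq> 0}" by (rule finite_subset)
  moreover have "y \<in> Y \<and> x \<in> X \<and> dy y + dx x \<le> n \<and> c y x \<in> tpow E (n - (dy y + dx x))" if "c y x \<noteq> 0" for x y
  proof -
    have "dx x \<le> n - dy y" "c y x \<in> tpow E (n - dy y - dx x)" "x \<in> X"
      using assms(2)[OF nz[OF that]] that by (auto dest: hvecsD)
    then show ?thesis using assms(2)[OF nz[OF that]] by auto
  qed
  ultimately show ?thesis by (auto simp: bimatrices_def)
qed

lemma diff_in_bimatrices:
  assumes "c \<in> bimatrices E Y dy X dx n" "d \<in> bimatrices E Y dy X dx n"
  shows "c - d \<in> bimatrices E Y dy X dx n"
proof (rule bimatricesI)
  show "finite {y. (c - d) y \<noteq> 0}"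
    by (rule finite_subset[of _ "{y. c y \<noteq> 0} \<union> {y. d y \<noteq> 0}"])
       (use assms in \<open>auto simp: bimatrices_row(1)\<close>)
  fix y assume "(c - d) y \<noteq> 0"
  then have "c y \<noteq> 0 \<or> d y \<noteq> 0" by auto
  then show "y \<in> Y \<and> dy y \<le> n \<and> (c - d) y \<in> hvecs E X dx (n - dy y)"
    using bimatrices_row[OF assms(1)] bimatrices_row[OF assms(2)] by (auto intro: diff_in_hvecs)
qed

definition rows_mult :: "(nat \<Rightarrow> nat \<Rightarrow> 'a::ring_1) \<Rightarrow> (nat \<Rightarrow> nat \<Rightarrow> 'a) \<Rightarrow> nat \<Rightarrow> nat \<Rightarrow> 'a" where
  "rows_mult c D = (\<lambda>y. row_mult (c y) D)"

lemma rows_mult_in_bimatrices: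
  assumes c: "c \<in> bimatrices E Y dy X dx n" and D: "\<And>x. x \<in> X \<Longrightarrow> D x \<in> hvecs E Z dz (dx x)"
  shows "rows_mult c D \<in> bimatrices E Y dy Z dz n"
proof (rule bimatricesI)
  have *: "{y. rows_mult c D y \<noteq> 0} \<subseteq> {y. c y \<noteq> 0}"
    by (auto simp: rows_mult_def)
  then show "finite {y. rows_mult c D y \<noteq> 0}"
    using bimatrices_row(1)[OF c] by (rule finite_subset)
  fix y assume "rows_mult c D y \<noteq> 0"
  then have "c y \<noteq> 0" using * by auto
  then show "y \<in> Y \<and> dy y \<le> n \<and> rows_mult c D y \<in> hvecs E Z dz (n - dy y)"
    using bimatrices_row[OF c] row_mult_in_hvecs[OF bimatrices_row(4)[OF c], of D Z dz y] D
    unfolding rows_mult_def by auto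
qed

lemma rows_mult_diff:
  assumes "c \<in> bimatrices E Y dy X dx n" "d \<in> bimatrices E Y dy X dx n"
  shows "rows_mult (c - d) D = rows_mult c D - rows_mult d D"
proof -
  have "row_mult ((c - d) y) D = row_mult (c y) D - row_mult (d y) D" for y
    using bimatrices_row(4)[OF assms(1), of y] bimatrices_row(4)[OF assms(2), of y]
    by (simp add: row_mult_diff hvecsD(1))
  then show ?thesis by (auto simp: rows_mult_def fun_eq_iff)
qed

lemma bimatrices_finite_box:
  assumes "c \<in> bimatrices E Y dy X dx n"
  obtains S T where "finite S" "finite T" "\<And>y x. c y x \<noteq> 0 \<Longrightarrow> y \<in> S \<and> x \<in> T"
proof
  let ?A = "{(y, x). c y x \<noteq> 0}"
  have "finite ?A" using assms by (simp add: bimatrices_def)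
  then show "finite (fst ` ?A)" "finite (snd ` ?A)" by simp_all
  fix y x assume "c y x \<noteq> 0"
  then show "y \<in> fst ` ?A \<and> x \<in> snd ` ?A" by force
qed

text \<open>At \<open>(u, z)\<close> both sides are the sum over \<open>y\<close> and
  \<open>x\<close> of \<open>tau (D' y u) * c y x * D x z\<close>, so this is associativity:
  \<open>tau\<close> reverses factors and thereby turns a right multiplication of the flipped matrix
  into a left multiplication of \<open>c\<close>.\<close>

lemma rows_mult_flip_commute:
  assumes c: "c \<in> bimatrices E Y dy X dx n"
  shows "rows_mult (flip (rows_mult (flip c) D')) D = flip (rows_mult (flip (rows_mult c D)) D')"
proof (intro ext)
  fix u z
  obtain S T where ST: "finite S" "finite T" and supp: "\<And>y x. c y x \<noteq> 0 \<Longrightarrow> y \<in> S \<and> x \<in> T"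
    using bimatrices_finite_box[OF c] by blast
  have 1: "row_mult (c y) D v = (\<Sum>x\<in>T. c y x * D x v)" for y v
    using ST supp by (intro row_mult_superset) auto
  have 2: "row_mult (\<lambda>y. tau (c y x)) D' v = (\<Sum>y\<in>S. tau (c y x) * D' y v)" for x v
    using ST supp by (intro row_mult_superset) auto
  have "row_mult (\<lambda>x. tau (row_mult (\<lambda>y. tau (c y x)) D' u)) D z =
      (\<Sum>x\<in>T. tau (row_mult (\<lambda>y. tau (c y x)) D' u) * D x z)"
  proof (rule row_mult_superset[OF ST(2)], rule subsetI, rule ccontr)
    fix x assume "x \<in> {x. tau (row_mult (\<lambda>y. tau (c y x)) D' u) \<noteq> 0}" "x \<notin> T"
    moreover from this supp have "(\<lambda>y. tau (c y x)) = (\<lambda>y. 0)" by (auto simp: fun_eq_iff)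
    ultimately show False by simp
  qed
  also have "\<dots> = (\<Sum>x\<in>T. (\<Sum>y\<in>S. tau (D' y u) * c y x) * D x z)"
    by (simp add: 2 tau_sum tau_mult)
  also have "\<dots> = (\<Sum>y\<in>S. tau (D' y u) * (\<Sum>x\<in>T. c y x * D x z))"
    unfolding sum_distrib_left sum_distrib_right by (subst sum.swap) (simp add: mult.assoc)
  also have "\<dots> = tau (\<Sum>y\<in>S. tau (row_mult (c y) D z) * D' y u)"
    by (simp add: 1 tau_sum tau_mult)
  also have "(\<Sum>y\<in>S. tau (row_mult (c y) D z) * D' y u) = row_mult (\<lambda>y. tau (row_mult (c y) D z)) D' u"
  proof (rule row_mult_superset[symmetric, OF ST(1)], rule subsetI, rule ccontr)
    fix y assume "y \<in> {y. tau (row_mult (c y) D z) \<noteq> 0}" "y \<notin> S"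
    moreover from this supp have "c y = (\<lambda>x. 0)" by (auto simp: fun_eq_iff)
    ultimately show False by simp
  qed
  finally show "rows_mult (flip (rows_mult (flip c) D')) D u z = flip (rows_mult (flip (rows_mult c D)) D') u z"
    by (simp add: rows_mult_def flip_def)
qed


text \<open>The ideal modulo which entries are read: the augmentation ideal where the module is
  \<open>k\<close>, and \<open>J\<close> elsewhere. The tests \<open>q = 0\<close>,
  \<open>q \<le> 1\<close> and \<open>q \<le> 2\<close> of \<open>matrix_resolution\<close> ask
  whether position \<open>q\<close>, \<open>q - 1\<close> or \<open>q - 1 - 1\<close> is the one of
  \<open>k\<close>.\<close>

definition level :: "'v set \<Rightarrow> ('v, 'k::field) tens set \<Rightarrow> bool \<Rightarrow> ('v, 'k) tens set" where
  "level E J b = (if b then aug_ideal E else J)"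

section \<open>Multiplying the rows of a bimatrix by the differential of a resolution\<close>

context matrix_resolution
begin

lemma level_zero [simp]: "0 \<in> level E J b"
  and level_add: "s \<in> level E J b \<Longrightarrow> t \<in> level E J b \<Longrightarrow> s + t \<in> level E J b"
  and level_diff: "s \<in> level E J b \<Longrightarrow> t \<in> level E J b \<Longrightarrow> s - t \<in> level E J b"
  and level_lmult: "t \<in> level E J b \<Longrightarrow> s \<in> tens_carrier E \<Longrightarrow> s * t \<in> level E J b"
  and level_rmult: "t \<in> level E J b \<Longrightarrow> s \<in> tens_carrier E \<Longrightarrow> t * s \<in> level E J b"
  by (auto simp: level_def aug_ideal_closed J_add J_diff J_lmult J_rmult)

lemma level_mono: "t \<in> level E J b \<Longrightarrow> (b \<Longrightarrow> b') \<Longrightarrow> t \<in> level E J b'"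
  by (auto simp: level_def J_aug split: if_splits)

lemma level_sum: "(\<And>i. i \<in> A \<Longrightarrow> h i \<in> level E J b) \<Longrightarrow> sum h A \<in> level E J b"
  by (induction A rule: infinite_finite_induct) (auto intro: level_add)

lemma D_carrier: "x \<in> X q \<Longrightarrow> D q x u \<in> tens_carrier E"
  using D_hvecs hvecsD(2) by blast

lemma rows_closed:
  "c \<in> bimatrices E Y dy (X q) (dg q) n \<Longrightarrow>
    rows_mult c (D q) \<in> bimatrices E Y dy (X (q - 1)) (dg (q - 1)) n"
  by (erule rows_mult_in_bimatrices) (rule D_hvecs)

text \<open>The flag \<open>b\<close> says that the other index of the double complex is
  \<open>0\<close>, in which case the modulus is the augmentation ideal whatever \<open>q\<close>
  is. Passing from \<open>q\<close> to \<open>q - 1\<close> can only enlarge the modulus.\<close>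

lemma rows_level:
  assumes "c \<in> bimatrices E Y dy (X q) (dg q) n" "\<And>y x. c y x \<in> level E J (b \<or> q = 0)"
  shows "rows_mult c (D q) y u \<in> level E J (b \<or> q - 1 = 0)"
  unfolding rows_mult_def row_mult_def
proof (rule level_sum)
  fix x assume "x \<in> {x. c y x \<noteq> 0}"
  then have "x \<in> X q" using hvecsD(4)[OF bimatrices_row(4)[OF assms(1)]] by blast
  then show "c y x * D q x u \<in> level E J (b \<or> q - 1 = 0)"
    using assms(2)[of y x] by (intro level_rmult D_carrier) (auto elim: level_mono)
qed

lemma rows_rows:
  assumes c: "c \<in> bimatrices E Y dy (X q) (dg q) n"
  shows "rows_mult (rows_mult c (D q)) (D (q - 1)) y u \<in> level E J (b \<or> q - 1 - 1 = 0)"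
proof -
  note cy = bimatrices_row(4)[OF c, of y]
  have "row_mult (row_mult (c y) (D q)) (D (q - 1)) u = row_mult (c y) (\<lambda>x. row_mult (D q x) (D (q - 1))) u"
    using hvecsD[OF cy] hvecsD(1)[OF D_hvecs] by (intro row_mult_assoc) auto
  also have "\<dots> \<in> level E J (b \<or> q - 1 - 1 = 0)"
    unfolding row_mult_def[of "c y"]
  proof (rule level_sum)
    fix x assume "x \<in> {x. c y x \<noteq> 0}"
    then have "x \<in> X q" using hvecsD(4)[OF cy] by blast
    from D_D[OF this, of u] show "c y x * row_mult (D q x) (D (q - 1)) u \<in> level E J (b \<or> q - 1 - 1 = 0)"
      by (intro level_lmult hvecsD(2)[OF cy]) (cases "q \<le> 2"; auto simp: level_def J_aug)
  qed
  finally show ?thesis by (simp add: rows_mult_def)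
qed

text \<open>Without a flag, because this is the situation where the other tensor factor is free:
  exactness of the resolution is then applied to each row.\<close>

lemma rows_exact:
  assumes c: "c \<in> bimatrices E Y dy (X q) (dg q) n"
    and z: "\<And>y u. rows_mult c (D q) y u \<in> level E J (q - 1 = 0)"
  obtains w where "w \<in> bimatrices E Y dy (X (Suc q)) (dg (Suc q)) n"
    and "\<And>y x. c y x - rows_mult w (D (Suc q)) y x \<in> level E J (q = 0)"
proof -
  \<comment> \<open>Zero rows are lifted to zero, to keep the number of nonzero rows finite.\<close>
  have "\<exists>w\<in>hvecs E (X (Suc q)) (dg (Suc q)) (n - dy y).
      (\<forall>x. c y x - row_mult w (D (Suc q)) x \<in> level E J (q = 0)) \<and> (c y = 0 \<longrightarrow> w = 0)" for y
  proof (cases "c y = 0")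
    case False
    have "(q - 1 = 0) = (q \<le> 1)" by auto
    with z have "row_mult (c y) (D q) u \<in> (if q \<le> 1 then aug_ideal E else J)" for u
      unfolding rows_mult_def level_def by metis
    from exact[OF bimatrices_row(4)[OF c] this] False show ?thesis
      unfolding level_def by blast
  qed (auto intro: bexI[of _ 0])
  then obtain w where w: "\<And>y. w y \<in> hvecs E (X (Suc q)) (dg (Suc q)) (n - dy y)"
      "\<And>y x. c y x - row_mult (w y) (D (Suc q)) x \<in> level E J (q = 0)" "\<And>y. c y = 0 \<Longrightarrow> w y = 0"
    by metis
  have "w \<in> bimatrices E Y dy (X (Suc q)) (dg (Suc q)) n"
  proof (rule bimatricesI)
    show "finite {y. w y \<noteq> 0}"
      by (rule finite_subset[OF _ bimatrices_row(1)[OF c]]) (use w(3) in blast)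
    fix y assume "w y \<noteq> 0"
    then have "c y \<noteq> 0" using w(3) by blast
    then show "y \<in> Y \<and> dy y \<le> n \<and> w y \<in> hvecs E (X (Suc q)) (dg (Suc q)) (n - dy y)"
      using bimatrices_row(2,3)[OF c] w(1) by blast
  qed
  with w(2) show ?thesis by (intro that[of w]) (simp_all add: rows_mult_def)
qed

text \<open>At position \<open>0\<close> every vector is a cycle because \<open>D 0 = 0\<close>;
  exactness there is surjectivity of the augmentation onto \<open>k\<close>.\<close>

lemma rows_surj:
  assumes c: "c \<in> bimatrices E Y dy (X 0) (dg 0) n"
  obtains w where "w \<in> bimatrices E Y dy (X 1) (dg 1) n"
    and "\<And>y x. c y x - rows_mult w (D 1) y x \<in> aug_ideal E"
proof -
  have "rows_mult c (D 0) y u \<in> level E J (0 - 1 = (0::nat))" for y u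
    by (simp add: rows_mult_def D_0)
  from rows_exact[OF c this] that show ?thesis by (auto simp: level_def)
qed

end

section \<open>The double complex of a resolution over \<open>A\<close> and one over the opposite
  algebra\<close>

locale resolution_pair =
  A: matrix_resolution E J X dg D + B: matrix_resolution E "tau ` J" X' dg' D'
  for E :: "'v set" and J :: "('v, 'k::field) tens set"
    and X dg D and X' dg' D'
begin

text \<open>\<open>p\<close> is the position in the resolution over the opposite algebra, read as a
  complex of right modules over \<open>A\<close>, and \<open>q\<close> the position in the one over
  \<open>A\<close>.\<close>

definition chains :: "nat \<Rightarrow> nat \<Rightarrow> nat \<Rightarrow> (nat \<Rightarrow> ('v, 'k) tvec) set" where
  "chains n p q = bimatrices E (X' p) (dg' p) (X q) (dg q) n"

text \<open>On the edges one tensor factor is \<open>k\<close>, so entries are read modulo the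
  augmentation ideal there, and modulo \<open>J\<close> in the interior.\<close>

definition null_chains :: "nat \<Rightarrow> nat \<Rightarrow> nat \<Rightarrow> (nat \<Rightarrow> ('v, 'k) tvec) set" where
  "null_chains n p q = {c \<in> chains n p q. \<forall>y x. c y x \<in> level E J (p = 0 \<or> q = 0)}"

definition horizontal :: "nat \<Rightarrow> nat \<Rightarrow> (nat \<Rightarrow> ('v, 'k) tvec) \<Rightarrow> nat \<Rightarrow> ('v, 'k) tvec" where
  "horizontal p q c = rows_mult c (D q)"

definition vertical :: "nat \<Rightarrow> nat \<Rightarrow> (nat \<Rightarrow> ('v, 'k) tvec) \<Rightarrow> nat \<Rightarrow> ('v, 'k) tvec" where
  "vertical p q c = flip (rows_mult (flip c) (D' p))"

lemma tau_level: "tau t \<in> level E (tau ` J) b \<longleftrightarrow> t \<in> level E J b"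
  by (auto simp: level_def aug_ideal_closed(6) image_iff) (metis tau_tau)

lemma level_tau: "t \<in> level E (tau ` J) b \<longleftrightarrow> tau t \<in> level E J b"
  using tau_level[of "tau t"] by simp

lemma flip_chains:
  "c \<in> chains n p q \<Longrightarrow> flip c \<in> bimatrices E (X q) (dg q) (X' p) (dg' p) n"
  "d \<in> bimatrices E (X q) (dg q) (X' p) (dg' p) n \<Longrightarrow> flip d \<in> chains n p q"
  by (simp_all add: chains_def flip_in_bimatrices)

text \<open>Statements on rows are those for \<open>A\<close>; statements on columns are those for
  the opposite algebra after \<open>flip\<close>, with \<open>J\<close> replaced by its image under
  \<open>tau\<close>. For \<open>p > 0\<close> the modulus at \<open>(p, q)\<close> depends on
  \<open>q\<close> alone, so exactness of the resolution over \<open>A\<close> applies, and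
  symmetrically for columns.\<close>

sublocale double_complex "chains n" "null_chains n" horizontal vertical for n
proof
  show "c - d \<in> chains n p q" if "c \<in> chains n p q" "d \<in> chains n p q" for c d p q
    using that unfolding chains_def by (rule diff_in_bimatrices)
  then show "c - d \<in> null_chains n p q" if "c \<in> null_chains n p q" "d \<in> null_chains n p q" for c d p q
    using that by (auto simp: null_chains_def intro: A.level_diff)
  show "c \<in> chains n p q" if "c \<in> null_chains n p q" for c p q
    using that by (simp add: null_chains_def)
  show hc: "horizontal p q c \<in> chains n p (q - 1)" if "c \<in> chains n p q" for c p q
    using that unfolding chains_def horizontal_def by (rule A.rows_closed)
  show vc: "vertical p q c \<in> chains n (p - 1) q" if "c \<in> chains n p q" for c p q
    unfolding vertical_def by (intro flip_chains(2) B.rows_closed flip_chains(1) that)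
  show "horizontal p q c \<in> null_chains n p (q - 1)" if c: "c \<in> null_chains n p q" for c p q
  proof -
    have c': "c \<in> chains n p q" using c by (simp add: null_chains_def)
    have "horizontal p q c y x \<in> level E J (p = 0 \<or> q - 1 = 0)" for y x
      using c unfolding horizontal_def null_chains_def
      by (intro A.rows_level[OF c'[unfolded chains_def]]) auto
    with hc[OF c'] show ?thesis by (simp add: null_chains_def)
  qed
  show "vertical p q c \<in> null_chains n (p - 1) q" if c: "c \<in> null_chains n p q" for c p q
  proof -
    have c': "c \<in> chains n p q" using c by (simp add: null_chains_def)
    have "flip c x y \<in> level E (tau ` J) (q = 0 \<or> p = 0)" for x y
      using c by (auto simp: null_chains_def flip_def tau_level disj_commute)
    from B.rows_level[OF flip_chains(1)[OF c'] this] vc[OF c'] show ?thesis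
      by (auto simp: null_chains_def vertical_def flip_def level_tau disj_commute)
  qed
  show "horizontal p q (c - d) = horizontal p q c - horizontal p q d"
    if "c \<in> chains n p q" "d \<in> chains n p q" for c d p q
    using that unfolding chains_def horizontal_def by (rule rows_mult_diff)
  show "vertical p q (c - d) = vertical p q c - vertical p q d"
    if "c \<in> chains n p q" "d \<in> chains n p q" for c d p q
    unfolding vertical_def flip_diff
    by (subst rows_mult_diff[OF flip_chains(1)[OF that(1)] flip_chains(1)[OF that(2)]]) (rule flip_diff)
  show "horizontal p (q - 1) (horizontal p q c) \<in> null_chains n p (q - 1 - 1)"
    if c: "c \<in> chains n p q" for c p q
    using A.rows_rows[OF c[unfolded chains_def]] hc[OF hc[OF c]]
    by (simp add: null_chains_def horizontal_def)
  show "vertical (p - 1) q (vertical p q c) \<in> null_chains n (p - 1 - 1) q"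
    if c: "c \<in> chains n p q" for c p q
    using B.rows_rows[OF flip_chains(1)[OF c], of _ _ "q = 0"] vc[OF vc[OF c]]
    by (simp add: null_chains_def vertical_def) (simp add: flip_def level_tau disj_commute)
  show "horizontal (p - 1) q (vertical p q c) = vertical p (q - 1) (horizontal p q c)"
    if c: "c \<in> chains n p q" for c p q
    using rows_mult_flip_commute[OF c[unfolded chains_def]] by (simp add: horizontal_def vertical_def)
  show "\<exists>b\<in>chains n p (Suc q). c - horizontal p (Suc q) b \<in> null_chains n p q"
    if p: "0 < p" and c: "c \<in> chains n p q" and h: "horizontal p q c \<in> null_chains n p (q - 1)" for c p q
  proof -
    have "rows_mult c (D q) y u \<in> level E J (q - 1 = 0)" for y u
      using h p by (simp add: null_chains_def horizontal_def)
    from A.rows_exact[OF c[unfolded chains_def] this] obtain w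
      where w: "w \<in> chains n p (Suc q)" "\<And>y x. c y x - rows_mult w (D (Suc q)) y x \<in> level E J (q = 0)"
      unfolding chains_def by blast
    have "c - horizontal p (Suc q) w \<in> chains n p q"
      using c hc[OF w(1)] unfolding chains_def by (auto intro: diff_in_bimatrices)
    with w p show ?thesis by (auto simp: null_chains_def horizontal_def intro!: bexI[of _ w])
  qed
  show "\<exists>b\<in>chains n (Suc p) q. c - vertical (Suc p) q b \<in> null_chains n p q"
    if q: "0 < q" and c: "c \<in> chains n p q" and h: "vertical p q c \<in> null_chains n (p - 1) q" for c p q
  proof -
    have "rows_mult (flip c) (D' p) y u \<in> level E (tau ` J) (p - 1 = 0)" for y u
      using h q by (simp add: null_chains_def vertical_def) (simp add: flip_def level_tau)
    from B.rows_exact[OF flip_chains(1)[OF c] this] obtain w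
      where w: "w \<in> bimatrices E (X q) (dg q) (X' (Suc p)) (dg' (Suc p)) n"
        "\<And>y x. flip c y x - rows_mult w (D' (Suc p)) y x \<in> level E (tau ` J) (p = 0)"
      by blast
    have fw: "flip w \<in> chains n (Suc p) q" using w(1) by (rule flip_chains(2))
    have "c - vertical (Suc p) q (flip w) \<in> chains n p q"
      using c vc[OF fw] unfolding chains_def by (auto intro: diff_in_bimatrices)
    moreover have "(c - vertical (Suc p) q (flip w)) y x \<in> level E J (p = 0)" for y x
    proof -
      have "(c - vertical (Suc p) q (flip w)) y x = tau (flip c x y - rows_mult w (D' (Suc p)) x y)"
        by (simp add: vertical_def) (simp add: flip_def tau_diff)
      then show ?thesis using w(2)[of x y] by (simp add: level_tau)
    qed
    ultimately show ?thesis using fw q by (auto simp: null_chains_def intro!: bexI[of _ "flip w"])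
  qed
qed

text \<open>For \<open>p = 0\<close> a bimatrix has the single row \<open>0\<close> and represents
  an element of k \<otimes> P. The receptor asks for more than a bounding chain \<open>W\<close>: it
  has to come from \<open>p = 1\<close>. Up to null chains it does, since the augmentation of the
  other resolution is onto \<open>k\<close>.\<close>

lemma receptor_if_tor_vanishes:
  assumes "A.tor_vanishes i n"
  shows "receptor_vanishes n 0 (Suc i)"
  unfolding receptor_vanishes_def
proof (intro ballI impI)
  fix c assume c: "c \<in> chains n 0 (Suc i)" and hc: "horizontal 0 (Suc i) c \<in> null_chains n 0 (Suc i - 1)"
  have row: "d y = 0" if "d \<in> chains n 0 q" "y \<noteq> 0" for d q y
    using bimatrices_row(2)[OF that(1)[unfolded chains_def], of y] that(2) B.X_0 by auto
  have "c 0 \<in> hvecs E (X (Suc i)) (dg (Suc i)) n"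
    using bimatrices_row(4)[OF c[unfolded chains_def], of 0] by (simp add: B.dg_0)
  moreover have "row_mult (c 0) (D (Suc i)) u \<in> aug_ideal E" for u
    using hc by (simp add: null_chains_def horizontal_def rows_mult_def level_def)
  ultimately obtain w where w: "w \<in> hvecs E (X (Suc (Suc i))) (dg (Suc (Suc i))) n"
    and cw: "\<And>x. c 0 x - row_mult w (D (Suc (Suc i))) x \<in> aug_ideal E"
    using assms unfolding A.tor_vanishes_def by blast
  \<comment> \<open>The vector \<open>w\<close> as a bimatrix whose only row is the one of the
    generator of \<open>k\<close>.\<close>
  define W where "W = (\<lambda>y::nat. if y = 0 then w else (0::nat \<Rightarrow> ('v, 'k) tens))"
  have W: "W \<in> chains n 0 (Suc (Suc i))"
    unfolding chains_def
  proof (rule bimatricesI)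
    show "finite {y. W y \<noteq> 0}" by (rule finite_subset[of _ "{0}"]) (auto simp: W_def)
  qed (use w in \<open>auto simp: W_def B.X_0 B.dg_0 split: if_splits\<close>)
  have "(c - horizontal 0 (Suc (Suc i)) W) y x \<in> aug_ideal E" for y x
  proof (cases "y = 0")
    case True
    then show ?thesis using cw by (simp add: horizontal_def rows_mult_def W_def)
  next
    case False
    then show ?thesis using row[OF c] by (simp add: horizontal_def rows_mult_def W_def aug_ideal_closed)
  qed
  then have cW: "c - horizontal 0 (Suc (Suc i)) W \<in> null_chains n 0 (Suc i)"
    using C_diff[OF c f_closed[OF W, simplified]] by (simp add: null_chains_def level_def)
  obtain b where b: "b \<in> bimatrices E (X (Suc (Suc i))) (dg (Suc (Suc i))) (X' 1) (dg' 1) n"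
    "\<And>y x. flip W y x - rows_mult b (D' 1) y x \<in> aug_ideal E"
    using B.rows_surj[OF flip_chains(1)[OF W]] by blast
  have fb: "flip b \<in> chains n 1 (Suc (Suc i))" using b(1) by (rule flip_chains(2))
  have "(W - vertical 1 (Suc (Suc i)) (flip b)) y x \<in> aug_ideal E" for y x
  proof -
    have "(W - vertical 1 (Suc (Suc i)) (flip b)) y x = tau (flip W x y - rows_mult b (D' 1) x y)"
      by (simp add: vertical_def) (simp add: flip_def tau_diff)
    then show ?thesis using b(2)[of x y] by (simp add: aug_ideal_closed)
  qed
  then have "W - vertical 1 (Suc (Suc i)) (flip b) \<in> null_chains n 0 (Suc (Suc i))"
    using C_diff[OF W g_closed[OF fb, simplified]] by (simp add: null_chains_def level_def)
  from f_N[OF this] have "horizontal 0 (Suc (Suc i)) W - horizontal 0 (Suc (Suc i)) (vertical 1 (Suc (Suc i)) (flip b)) \<in> null_chains n 0 (Suc i)"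
    using f_diff[OF W g_closed[OF fb, simplified]] by simp
  from N_add[OF cW this] show "\<exists>b\<in>chains n (Suc 0) (Suc (Suc i)).
      c - vertical (Suc 0) (Suc i) (horizontal (Suc 0) (Suc (Suc i)) b) \<in> null_chains n 0 (Suc i)"
    using fb f_g[OF fb] by (intro bexI[of _ "flip b"]) simp_all
qed

text \<open>For \<open>q = 0\<close> the horizontal map is \<open>0\<close>, so a vertical cycle
  satisfies both conditions of the receptor. The horizontal image of the chain found at
  \<open>(Suc (Suc i), Suc 0)\<close> consists of a single column, which bounds the cycle.\<close>

lemma tor_vanishes_if_receptor:
  assumes "receptor_vanishes n (Suc i) 0"
  shows "B.tor_vanishes i n"
  unfolding B.tor_vanishes_def
proof (intro ballI impI)
  fix v assume v: "v \<in> hvecs E (X' (Suc i)) (dg' (Suc i)) n"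
    and vD: "\<forall>u. row_mult v (D' (Suc i)) u \<in> aug_ideal E"
  define d where "d = (\<lambda>x::nat. if x = 0 then v else (0::nat \<Rightarrow> ('v, 'k) tens))"
  have d: "d \<in> bimatrices E (X 0) (dg 0) (X' (Suc i)) (dg' (Suc i)) n"
  proof (rule bimatricesI)
    show "finite {y. d y \<noteq> 0}" by (rule finite_subset[of _ "{0}"]) (auto simp: d_def)
  qed (use v in \<open>auto simp: d_def A.X_0 A.dg_0 split: if_splits\<close>)
  then have c: "flip d \<in> chains n (Suc i) 0" by (rule flip_chains(2))
  have "horizontal (Suc i) 0 (flip d) = 0"
    by (simp add: horizontal_def A.D_0 rows_mult_def fun_eq_iff)
  then have 1: "horizontal (Suc i) 0 (flip d) \<in> null_chains n (Suc i) (0 - 1)"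
    using f_closed[OF c] by (simp add: null_chains_def)
  have "vertical (Suc i) 0 (flip d) y x \<in> aug_ideal E" for y x
    using vD by (simp add: vertical_def) (simp add: flip_def rows_mult_def d_def aug_ideal_closed)
  then have 2: "vertical (Suc i) 0 (flip d) \<in> null_chains n (Suc i - 1) 0"
    using g_closed[OF c] by (simp add: null_chains_def level_def)
  from assms c 1 2 obtain b where b: "b \<in> chains n (Suc (Suc i)) (Suc 0)"
    and db: "flip d - vertical (Suc (Suc i)) 0 (horizontal (Suc (Suc i)) (Suc 0) b) \<in> null_chains n (Suc i) 0"
    unfolding receptor_vanishes_def by blast
  let ?h = "horizontal (Suc (Suc i)) (Suc 0) b"
  have h: "?h \<in> chains n (Suc (Suc i)) 0" using f_closed[OF b] by simp
  let ?w = "flip ?h 0"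
  have "?w \<in> hvecs E (X' (Suc (Suc i))) (dg' (Suc (Suc i))) n"
    using bimatrices_row(4)[OF flip_chains(1)[OF h], of 0] by (simp add: A.dg_0)
  moreover have "v x - row_mult ?w (D' (Suc (Suc i))) x \<in> aug_ideal E" for x
  proof -
    have "(flip d - vertical (Suc (Suc i)) 0 ?h) x 0 = tau (v x - row_mult ?w (D' (Suc (Suc i))) x)"
      by (simp add: vertical_def tau_diff) (simp add: flip_def rows_mult_def d_def)
    moreover have "(flip d - vertical (Suc (Suc i)) 0 ?h) x 0 \<in> aug_ideal E"
      using db by (simp only: null_chains_def level_def) simp
    ultimately show ?thesis by (simp add: aug_ideal_closed)
  qed
  ultimately show "\<exists>w\<in>hvecs E (X' (Suc (Suc i))) (dg' (Suc (Suc i))) n.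
      \<forall>x. v x - row_mult w (D' (Suc (Suc i))) x \<in> aug_ideal E" by blast
qed

text \<open>The zigzag runs from \<open>(0, Suc i)\<close> to \<open>(Suc i, 0)\<close>; at both
  ends position \<open>Suc i\<close> is the module of index \<open>i\<close>.\<close>

lemma tor_vanishes_balanced: "A.tor_vanishes i n \<Longrightarrow> B.tor_vanishes i n"
  using receptor_if_tor_vanishes receptor_zigzag[of n 0 "Suc i"] tor_vanishes_if_receptor by simp

end

section \<open>Existence of resolutions\<close>

lemma sum_fun_apply: "(\<Sum>i\<in>A. f i) x = (\<Sum>i\<in>A. f i x)"
  for f :: "'i \<Rightarrow> 'a \<Rightarrow> 'b::ab_group_add"
  by (induction A rule: infinite_finite_induct) auto

definition fscale :: "'k::field \<Rightarrow> ('v, 'k) tvec \<Rightarrow> nat \<Rightarrow> ('v, 'k) tens" where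
  "fscale c v = (\<lambda>x. tscale c (v x))"

text \<open>Scalars are constants of \<open>T(V)\<close>, so linear combinations of rows are row
  multiplications by vectors of constants.\<close>

lemma tscale_eq_mult: "tscale c t = Poly_Mapping.single 0 c * t"
proof -
  let ?e = "\<Sum>w\<in>Poly_Mapping.keys t. Poly_Mapping.single w (Poly_Mapping.lookup t w)"
  interpret vector_space tscale by (rule vector_space_tscale)
  have "tscale c ?e = (\<Sum>w\<in>Poly_Mapping.keys t. Poly_Mapping.single 0 c * Poly_Mapping.single w (Poly_Mapping.lookup t w))"
    unfolding scale_sum_right
    by (rule sum.cong) (simp_all add: mult_single tscale_def)
  also have "\<dots> = Poly_Mapping.single 0 c * ?e" by (simp add: sum_distrib_left)
  finally show ?thesis by (simp flip: tens_expand)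
qed

lemma vector_space_fscale: "vector_space fscale"
proof -
  interpret vector_space tscale by (rule vector_space_tscale)
  show ?thesis
    by standard (auto simp: fscale_def fun_eq_iff scale_right_distrib scale_left_distrib)
qed

text \<open>Degree \<open>n\<close> is spanned by the pairs of a generator of degree at most
  \<open>n\<close> and a word of the complementary length in the letters \<open>E\<close>; both
  choices are finite.\<close>

lemma hvecs_finite_span:
  assumes E: "finite E" and X: "finite {x \<in> X. dg x \<le> n}"
  obtains G where "finite G" "(hvecs E X dg n :: (nat \<Rightarrow> ('v, 'k::field) tens) set) \<subseteq> module.span fscale G"
proof -
  interpret vector_space "fscale :: 'k \<Rightarrow> _ \<Rightarrow> nat \<Rightarrow> ('v, 'k) tens" by (rule vector_space_fscale)
  define e where "e = (\<lambda>(x :: nat, l) y. if y = x then Poly_Mapping.single (Word l) (1::'k) else 0 :: ('v, 'k) tens)"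
  define G where "G = e ` (SIGMA x:{x \<in> X. dg x \<le> n}. {l. set l \<subseteq> E \<and> length l = n - dg x})"
  have "finite G"
    unfolding G_def using X finite_lists_length_eq[OF E] by auto
  moreover have "v \<in> span G" if v: "v \<in> hvecs E X dg n" for v
  proof -
    have "v = (\<Sum>x | v x \<noteq> 0. \<Sum>w\<in>Poly_Mapping.keys (v x). fscale (Poly_Mapping.lookup (v x) w) (e (x, letters w)))"
    proof
      fix y
      have *: "(\<Sum>w\<in>Poly_Mapping.keys (v x). fscale (Poly_Mapping.lookup (v x) w) (e (x, letters w))) y
          = (if y = x then v y else 0)" for x
      proof (cases "y = x")
        case True
        then show ?thesis
          by (subst (3) tens_expand) (simp add: sum_fun_apply fscale_def e_def tscale_def)
      next
        case False
        then show ?thesis by (simp add: sum_fun_apply fscale_def e_def tscale_eq_mult)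
      qed
      show "v y = (\<Sum>x | v x \<noteq> 0. \<Sum>w\<in>Poly_Mapping.keys (v x). fscale (Poly_Mapping.lookup (v x) w) (e (x, letters w))) y"
        unfolding sum_fun_apply[of _ "{x. v x \<noteq> 0}"] *
        using hvecsD(1)[OF v] by (simp add: sum.delta)
    qed
    also have "\<dots> \<in> span G"
    proof (intro span_sum span_scale span_base)
      fix x w assume "x \<in> {x. v x \<noteq> 0}" "w \<in> Poly_Mapping.keys (v x)"
      with v show "e (x, letters w) \<in> G"
        by (fastforce simp: G_def hvecs_def tpow_iff tens_carrier_iff)
    qed
    finally show ?thesis .
  qed
  ultimately show ?thesis using that by blast
qed

context positive_graded_ideal
begin

text \<open>The resolution is far from minimal: in every degree a whole basis of the kernel becomes
  a set of generators, so a kernel element of degree \<open>n\<close> is a combination, with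
  constant coefficients, of generators of the same degree. Finite dimension in each degree leaves
  finitely many generators below any bound, which the next step needs again.\<close>

lemma resolution_step:
  fixes D :: "nat \<Rightarrow> ('v, 'k) tvec" and L :: "('v, 'k) tens set"
  assumes E: "finite E" and X: "\<And>n. finite {x \<in> X. dg x \<le> n}"
  defines "K n \<equiv> {v \<in> hvecs E X dg n. \<forall>u. row_mult v D u \<in> L}"
  shows "\<exists>X' dg' D'. (\<forall>n. finite {x \<in> X'. dg' x \<le> n}) \<and> (\<forall>x\<in>X'. D' x \<in> K (dg' x)) \<and>
    (\<forall>n. \<forall>v\<in>K n. \<exists>w\<in>hvecs E X' dg' n. v = row_mult w D')"
proof -
  interpret vector_space "fscale :: 'k \<Rightarrow> _ \<Rightarrow> nat \<Rightarrow> ('v, 'k) tens" by (rule vector_space_fscale)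
  \<comment> \<open>A maximal independent subset of \<open>K n\<close> is finite because it lies in
    the span of finitely many monomials.\<close>
  have "\<exists>B. finite B \<and> B \<subseteq> K n \<and> K n \<subseteq> span B" for n
  proof -
    obtain B where B: "B \<subseteq> K n" "independent B" "K n \<subseteq> span B"
      using maximal_independent_subset[of "K n"] by blast
    obtain G where G: "finite G" "hvecs E X dg n \<subseteq> span G"
      using hvecs_finite_span[OF E X] by metis
    have "B \<subseteq> span G" using B(1) G(2) by (auto simp: K_def)
    from independent_span_bound[OF G(1) B(2) this] B show ?thesis by blast
  qed
  then obtain B where B: "\<And>n. finite (B n)" "\<And>n. B n \<subseteq> K n" "\<And>n. K n \<subseteq> span (B n)"
    by metis
  \<comment> \<open>Generators have to be natural numbers, so pairs of a degree and a basis vector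
    are numbered; the pair remembers the degree.\<close>
  define P where "P = (SIGMA n:UNIV. B n)"
  have P: "countable P" unfolding P_def using B(1) by (intro countable_SIGMA) (auto intro: countable_finite)
  define e where "e = to_nat_on P"
  have e: "inj_on e P" unfolding e_def by (rule inj_on_to_nat_on[OF P])
  define r where "r = inv_into P e"
  have r: "r (e p) = p" if "p \<in> P" for p unfolding r_def using e that by (rule inv_into_f_f)
  define X' where "X' = e ` P"
  define dg' where "dg' = (\<lambda>x. fst (r x))"
  define D' where "D' = (\<lambda>x. snd (r x))"
  have "finite {x \<in> X'. dg' x \<le> n}" for n
  proof (rule finite_subset)
    show "{x \<in> X'. dg' x \<le> n} \<subseteq> e ` (SIGMA m:{..n}. B m)"
      by (auto simp: X'_def dg'_def r P_def image_iff)
    show "finite (e ` (SIGMA m:{..n}. B m))" using B(1) by auto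
  qed
  moreover have "D' x \<in> K (dg' x)" if "x \<in> X'" for x
  proof -
    from that obtain p where p: "p \<in> P" "x = e p" by (auto simp: X'_def)
    then show ?thesis using subsetD[OF B(2)] by (auto simp: D'_def dg'_def r P_def)
  qed
  moreover have "\<exists>w\<in>hvecs E X' dg' n. v = row_mult w D'" if "v \<in> K n" for n v
  proof -
    have "v \<in> span (B n)" using that B(3) by blast
    then obtain c where c: "v = (\<Sum>b\<in>B n. fscale (c b) b)"
      unfolding span_finite[OF B(1)] by blast
    \<comment> \<open>\<open>S\<close> collects the numbers of the generators of degree
      \<open>n\<close>; the lift \<open>w\<close> carries the constant \<open>c b\<close> at the
      number of \<open>b\<close>.\<close>
    define S where "S = (\<lambda>b. e (n, b)) ` B n"
    have S: "finite S" using B(1) by (simp add: S_def)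
    define w where "w = (\<lambda>x. if x \<in> S then Poly_Mapping.single 0 (c (D' x)) else 0 :: ('v, 'k) tens)"
    have inj: "inj_on (\<lambda>b. e (n, b)) (B n)"
      using e by (auto simp: inj_on_def P_def)
    have De: "D' (e (n, b)) = b" "dg' (e (n, b)) = n" "e (n, b) \<in> X'" if "b \<in> B n" for b
      using that r[of "(n, b)"] by (auto simp: D'_def dg'_def P_def X'_def)
    have "w \<in> hvecs E X' dg' n"
      unfolding hvecs_def
    proof (intro CollectI conjI allI impI)
      show "finite {x. w x \<noteq> 0}" by (rule finite_subset[OF _ S]) (auto simp: w_def)
      fix x assume "w x \<noteq> 0"
      then have "x \<in> S" unfolding w_def by meson
      then obtain b where b: "b \<in> B n" "x = e (n, b)" by (auto simp: S_def)
      show "x \<in> X'" "dg' x \<le> n" "w x \<in> tpow E (n - dg' x)"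
        using De b \<open>x \<in> S\<close> by (auto simp: w_def intro: single_zero_in_tpow)
    qed
    moreover have "v u = row_mult w D' u" for u
    proof -
      have "row_mult w D' u = (\<Sum>x\<in>S. w x * D' x u)"
        by (rule row_mult_superset[OF S]) (auto simp: w_def)
      also have "\<dots> = (\<Sum>b\<in>B n. Poly_Mapping.single 0 (c b) * b u)"
        unfolding S_def
        by (subst sum.reindex[OF inj]) (auto intro!: sum.cong simp: De w_def S_def)
      also have "\<dots> = v u" by (simp add: c sum_fun_apply fscale_def tscale_eq_mult)
      finally show ?thesis by simp
    qed
    ultimately show ?thesis by (intro bexI[of _ w]) auto
  qed
  ultimately show ?thesis by blast
qed

text \<open>The step is iterated by dependent choice, starting with \<open>k\<close> at position
  \<open>0\<close>. There the map is \<open>0\<close> and its kernel is all of \<open>T(V)\<close>,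
  so the generators at position \<open>1\<close> reach all of \<open>T(V)\<close> and not only the
  constants; their images in positive degrees vanish modulo the augmentation ideal.\<close>

lemma matrix_resolution_exists:
  assumes E: "finite E"
  obtains X dg D where "matrix_resolution E J X dg D"
proof -
  \<comment> \<open>\<open>lev q\<close> is the modulus at position \<open>q - 1\<close>, where the
    image of position \<open>q\<close> lies.\<close>
  define lev where "lev = (\<lambda>q::nat. if q \<le> 1 then aug_ideal E else J)"
  define K where "K = (\<lambda>(q :: nat) (X, dg, D) n. {v \<in> hvecs E X dg n. \<forall>u. row_mult v D u \<in> lev q})"
  define fin where "fin = (\<lambda>(X :: nat set, dg :: nat \<Rightarrow> nat, D :: nat \<Rightarrow> ('v, 'k) tvec). \<forall>n. finite {x \<in> X. dg x \<le> n})"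
  let ?init = "({0}, \<lambda>_. 0, \<lambda>_ _. 0) :: nat set \<times> (nat \<Rightarrow> nat) \<times> (nat \<Rightarrow> ('v, 'k) tvec)"
  define succ where "succ = (\<lambda>(q :: nat) s (X', dg', D'). (\<forall>x\<in>X'. D' x \<in> K q s (dg' x)) \<and>
    (\<forall>n. \<forall>v\<in>K q s n. \<exists>w\<in>hvecs E X' dg' n. v = row_mult w D'))"
  have "\<exists>S. \<forall>q. (fin (S q) \<and> (q = 0 \<longrightarrow> S q = ?init)) \<and> succ q (S q) (S (Suc q))"
  proof (rule dependent_nat_choice)
    show "\<exists>s. fin s \<and> (0 = (0::nat) \<longrightarrow> s = ?init)" by (auto simp: fin_def)
    fix s and q :: nat assume s: "fin s \<and> (q = 0 \<longrightarrow> s = ?init)"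
    obtain X dg D where [simp]: "s = (X, dg, D)" by (cases s)
    have "\<And>n. finite {x \<in> X. dg x \<le> n}" using s by (simp add: fin_def)
    from resolution_step[OF E this, of D "lev q"]
    obtain X' dg' D' where "\<forall>n. finite {x \<in> X'. dg' x \<le> n}" "\<forall>x\<in>X'. D' x \<in> K q s (dg' x)"
      "\<forall>n. \<forall>v\<in>K q s n. \<exists>w\<in>hvecs E X' dg' n. v = row_mult w D'"
      by (auto simp: K_def)
    then show "\<exists>s'. (fin s' \<and> (Suc q = 0 \<longrightarrow> s' = ?init)) \<and> succ q s s'"
      by (intro exI[of _ "(X', dg', D')"]) (simp add: fin_def succ_def)
  qed
  then obtain S where S: "S 0 = ?init" "\<And>q. succ q (S q) (S (Suc q))" by blast
  define X where "X = (\<lambda>q. fst (S q))"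
  define dg where "dg = (\<lambda>q. fst (snd (S q)))"
  define D where "D = (\<lambda>q. snd (snd (S q)))"
  have init: "X 0 = {0}" "dg 0 = (\<lambda>_. 0)" "D 0 = 0" using S(1) by (auto simp: X_def dg_def D_def zero_fun_def)
  have K: "K q (S q) n = {v \<in> hvecs E (X q) (dg q) n. \<forall>u. row_mult v (D q) u \<in> lev q}" for q n
    by (simp add: K_def X_def dg_def D_def split: prod.split)
  have step: "x \<in> X (Suc q) \<Longrightarrow> D (Suc q) x \<in> K q (S q) (dg (Suc q) x)"
    "v \<in> K q (S q) n \<Longrightarrow> \<exists>w\<in>hvecs E (X (Suc q)) (dg (Suc q)) n. v = row_mult w (D (Suc q))" for q x v n
    using S(2)[of q] by (auto simp: succ_def X_def dg_def D_def split: prod.splits)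
  have "matrix_resolution E J X dg D"
  proof
    fix x q u assume x: "x \<in> X q"
    show "D q x \<in> hvecs E (X (q - 1)) (dg (q - 1)) (dg q x)"
      using x step(1)[of x "q - 1"] by (cases q) (simp_all add: init K)
    show "row_mult (D q x) (D (q - 1)) u \<in> (if q \<le> 2 then aug_ideal E else J)"
      using x step(1)[of x "q - 1"] by (cases q) (auto simp: init K lev_def aug_ideal_closed split: if_splits)
  next
    fix v q n assume "v \<in> hvecs E (X q) (dg q) n" "\<And>u. row_mult v (D q) u \<in> (if q \<le> 1 then aug_ideal E else J)"
    then have "v \<in> K q (S q) n" by (simp add: K lev_def)
    from step(2)[OF this] obtain w where "w \<in> hvecs E (X (Suc q)) (dg (Suc q)) n" "v = row_mult w (D (Suc q))"
      by blast
    then show "\<exists>w\<in>hvecs E (X (Suc q)) (dg (Suc q)) n.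
        \<forall>x. v x - row_mult w (D (Suc q)) x \<in> (if q = 0 then aug_ideal E else J)"
      by (intro bexI[of _ w]) (auto simp: aug_ideal_closed)
  qed (simp_all add: init)
  then show ?thesis by (rule that)
qed

end

section \<open>Free modules over the quotient algebra\<close>

definition vecs :: "'v set \<Rightarrow> nat set \<Rightarrow> (nat \<Rightarrow> ('v, 'k::field) tens) set" where
  "vecs E X = {v. finite {x. v x \<noteq> 0} \<and> (\<forall>x. v x \<in> tens_carrier E) \<and> (\<forall>x. v x \<noteq> 0 \<longrightarrow> x \<in> X)}"

definition svec :: "nat \<Rightarrow> 'a::zero \<Rightarrow> nat \<Rightarrow> 'a" where
  "svec x t = (\<lambda>y. if y = x then t else 0)"

lemma vecsD:
  assumes "v \<in> vecs E X"
  shows "finite {x. v x \<noteq> 0}" "v x \<in> tens_carrier E" "v x \<noteq> 0 \<Longrightarrow> x \<in> X" "x \<notin> X \<Longrightarrow> v x = 0"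
  using assms by (auto simp: vecs_def)

lemma hvecs_subset_vecs: "v \<in> hvecs E X dg n \<Longrightarrow> v \<in> vecs E X"
  by (auto simp: vecs_def dest: hvecsD)

lemma zero_in_vecs [simp]: "0 \<in> vecs E X"
  by (simp add: vecs_def)

lemma vecs_subsetI:
  "finite S \<Longrightarrow> {x. v x \<noteq> 0} \<subseteq> S \<Longrightarrow> S \<subseteq> X \<Longrightarrow> (\<And>x. v x \<in> tens_carrier E) \<Longrightarrow> v \<in> vecs E X"
  unfolding vecs_def by (auto intro: finite_subset)

lemma add_in_vecs: "v \<in> vecs E X \<Longrightarrow> w \<in> vecs E X \<Longrightarrow> v + w \<in> vecs E X"
  by (rule vecs_subsetI[of "{x. v x \<noteq> 0} \<union> {x. w x \<noteq> 0}"]) (auto simp: vecs_def)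

lemma diff_in_vecs: "v \<in> vecs E X \<Longrightarrow> w \<in> vecs E X \<Longrightarrow> v - w \<in> vecs E X"
  by (rule vecs_subsetI[of "{x. v x \<noteq> 0} \<union> {x. w x \<noteq> 0}"]) (auto simp: vecs_def)

lemma lmult_in_vecs: "v \<in> vecs E X \<Longrightarrow> r \<in> tens_carrier E \<Longrightarrow> (\<lambda>x. r * v x) \<in> vecs E X"
  by (rule vecs_subsetI[of "{x. v x \<noteq> 0}"]) (auto simp: vecs_def)

lemma sum_in_vecs: "(\<And>i. i \<in> A \<Longrightarrow> f i \<in> vecs E X) \<Longrightarrow> sum f A \<in> vecs E X"
  by (induction A rule: infinite_finite_induct) (auto intro: add_in_vecs)

lemma svec_in_vecs: "x \<in> X \<Longrightarrow> t \<in> tens_carrier E \<Longrightarrow> svec x t \<in> vecs E X"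
  unfolding vecs_def svec_def by (auto intro: finite_subset[of _ "{x}"])

lemma svec_in_hvecs: "x \<in> X \<Longrightarrow> dg x \<le> n \<Longrightarrow> t \<in> tpow E (n - dg x) \<Longrightarrow> svec x t \<in> hvecs E X dg n"
  unfolding hvecs_def svec_def by (auto intro: finite_subset[of _ "{x}"])

text \<open>Vectors of finite support are sums of one-entry vectors; one point of the support is
  removed at a time.\<close>

lemma vecs_induct [consumes 1, case_names zero add single]:
  fixes v :: "nat \<Rightarrow> ('v, 'k::field) tens" and P :: "('v, 'k) tvec \<Rightarrow> bool"
  assumes v: "v \<in> vecs E X" and z: "P 0"
    and add: "\<And>v w :: ('v, 'k) tvec. v \<in> vecs E X \<Longrightarrow> w \<in> vecs E X \<Longrightarrow> P v \<Longrightarrow> P w \<Longrightarrow> P (v + w)"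
    and single: "\<And>x t. x \<in> X \<Longrightarrow> t \<in> tens_carrier E \<Longrightarrow> P (svec x t)"
  shows "P v"
proof -
  have "\<forall>v :: ('v, 'k) tvec. v \<in> vecs E X \<and> {x. v x \<noteq> 0} \<subseteq> S \<longrightarrow> P v" if "finite S" for S
    using that
  proof (induction S)
    case empty
    have "v = 0" if "{x. v x \<noteq> 0} \<subseteq> {}" for v :: "('v, 'k) tvec" using that by (auto simp: fun_eq_iff)
    with z show ?case by blast
  next
    case (insert x S)
    show ?case
    proof (intro allI impI)
      fix v :: "('v, 'k) tvec" assume v: "v \<in> vecs E X \<and> {x. v x \<noteq> 0} \<subseteq> insert x S"
      show "P v"
      proof (cases "v x = 0")
        case True
        then have "{x. v x \<noteq> 0} \<subseteq> S" using v by auto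
        with v insert.IH show ?thesis by blast
      next
        case False
        let ?s = "svec x (v x)"
        have s: "?s \<in> vecs E X" using v False by (intro svec_in_vecs) (auto dest: vecsD)
        have d: "v - ?s \<in> vecs E X" using v s by (auto intro: diff_in_vecs)
        have "{y. (v - ?s) y \<noteq> 0} \<subseteq> S" using v by (auto simp: svec_def)
        with d insert.IH have "P (v - ?s)" by blast
        moreover have "P ?s" using v False by (intro single) (auto dest: vecsD)
        ultimately have "P ((v - ?s) + ?s)" using d s by (intro add)
        then show ?thesis by simp
      qed
    qed
  qed
  from this[OF vecsD(1)[OF v]] v show ?thesis by blast
qed

lemma row_mult_sum:
  fixes f :: "'i \<Rightarrow> nat \<Rightarrow> ('v, 'k::field) tens" and D :: "nat \<Rightarrow> ('v, 'k) tvec"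
  assumes "\<And>i. i \<in> A \<Longrightarrow> f i \<in> vecs E X"
  shows "row_mult (sum f A) D = (\<Sum>i\<in>A. row_mult (f i) D)"
  using assms
proof (induction A rule: infinite_finite_induct)
  case (insert i A)
  then have fin: "finite {x. f i x \<noteq> 0}" "finite {x. sum f A x \<noteq> 0}"
    using vecsD(1)[of "f i" E X] vecsD(1)[of "sum f A" E X] sum_in_vecs[of A f E X] by auto
  have IH: "row_mult (sum f A) D = (\<Sum>i\<in>A. row_mult (f i) D)"
    using insert.IH insert.prems by blast
  show ?case unfolding sum.insert[OF insert.hyps] row_mult_add[OF fin] IH ..
qed simp_all

lemma row_mult_lmult:
  assumes "finite {x. v x \<noteq> 0}"
  shows "row_mult (\<lambda>x. r * v x) D u = r * row_mult v D u"
proof -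
  have "row_mult (\<lambda>x. r * v x) D u = (\<Sum>x | v x \<noteq> 0. (r * v x) * D x u)"
    using assms by (intro row_mult_superset) auto
  then show ?thesis by (simp add: row_mult_def sum_distrib_left mult.assoc)
qed

lemma row_mult_svec [simp]: "row_mult (svec x t) D u = t * D x u"
  by (subst row_mult_superset[of "{x}"]) (auto simp: svec_def)

lemma row_mult_in_vecs:
  fixes v :: "nat \<Rightarrow> ('v, 'k::field) tens" and D :: "nat \<Rightarrow> ('v, 'k) tvec"
  assumes v: "v \<in> vecs E X" and D: "\<And>x. x \<in> X \<Longrightarrow> D x \<in> vecs E Y"
  shows "row_mult v D \<in> vecs E Y"
  using v
proof (induction rule: vecs_induct)
  case (add v w)
  show ?case
    unfolding row_mult_add[OF vecsD(1)[OF add(1)] vecsD(1)[OF add(2)]]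
    using add(3,4) by (rule add_in_vecs)
next
  case (single x t)
  have "row_mult (svec x t) D = (\<lambda>u. t * D x u)" by (simp add: fun_eq_iff)
  with single D show ?case by (simp add: lmult_in_vecs)
next
  case zero
  have "row_mult 0 D \<in> vecs E Y" by simp
  then show ?case .
qed

definition hpart :: "(nat \<Rightarrow> nat) \<Rightarrow> nat \<Rightarrow> (nat \<Rightarrow> ('v, 'k::field) tens) \<Rightarrow> nat \<Rightarrow> ('v, 'k) tens" where
  "hpart dg n v = (\<lambda>x. if dg x \<le> n then hproj (n - dg x) (v x) else 0)"

lemma hpart_in_hvecs: "v \<in> vecs E X \<Longrightarrow> hpart dg n v \<in> hvecs E X dg n"
  unfolding hvecs_def hpart_def vecs_def
  by (auto intro: hproj_in_tpow elim!: finite_subset[rotated])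
     (metis hproj_zero)

lemma hpart_hvecs: "v \<in> hvecs E X dg n \<Longrightarrow> hpart dg n v = v"
proof
  fix x assume v: "v \<in> hvecs E X dg n"
  show "hpart dg n v x = v x"
  proof (cases "v x = 0")
    case False
    then show ?thesis using hvecsD(3)[OF v, of x] hvecsD(5)[OF v, of x] by (simp add: hpart_def hproj_tpow[of _ E "n - dg x"])
  qed (simp add: hpart_def)
qed

lemma hpart_add: "hpart dg n (v + w) = hpart dg n v + hpart dg n w"
  by (simp add: hpart_def hproj_add fun_eq_iff)

text \<open>The row of a generator is homogeneous of the degree of that generator, so the matrix is
  a map of degree \<open>0\<close> and commutes with taking components. On a one-entry vector this
  is \<open>hproj_mult_tpow\<close>.\<close>

lemma hpart_row_mult:
  fixes v :: "nat \<Rightarrow> ('v, 'k::field) tens" and D :: "nat \<Rightarrow> ('v, 'k) tvec"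
  assumes v: "v \<in> vecs E X" and D: "\<And>x. x \<in> X \<Longrightarrow> D x \<in> hvecs E Y dg' (dg x)"
  shows "hpart dg' n (row_mult v D) = row_mult (hpart dg n v) D"
  using v
proof (induction rule: vecs_induct)
  case zero
  have "hpart d n 0 = (0 :: ('v, 'k) tvec)" for d by (simp add: hpart_def fun_eq_iff)
  then have "hpart dg' n (row_mult 0 D) = row_mult (hpart dg n 0) D" by simp
  then show ?case .
next
  case (add v w)
  have "hpart dg' n (row_mult (v + w) D) = row_mult (hpart dg n v) D + row_mult (hpart dg n w) D"
    using add by (simp add: row_mult_add[of v w] vecsD(1) hpart_add)
  also have "\<dots> = row_mult (hpart dg n (v + w)) D"
    unfolding hpart_add
    using add(1,2)[THEN hpart_in_hvecs, THEN hvecsD(1)] by (rule row_mult_add[symmetric])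
  finally show ?case .
next
  case (single x t)
  have *: "hpart dg n (svec x t) = svec x (if dg x \<le> n then hproj (n - dg x) t else 0)"
    by (auto simp: hpart_def svec_def)
  show ?case
  proof
    fix u
    show "hpart dg' n (row_mult (svec x t) D) u = row_mult (hpart dg n (svec x t)) D u"
    proof (cases "D x u = 0")
      case True
      then show ?thesis unfolding * row_mult_svec by (simp add: hpart_def)
    next
      case False
      with D[OF single(1)] have "dg' u \<le> dg x" "D x u \<in> tpow E (dg x - dg' u)" by (auto dest: hvecsD)
      then show ?thesis unfolding * row_mult_svec by (auto simp: hpart_def hproj_mult_tpow[of _ E "dg x - dg' u"])
    qed
  qed
qed

lemma hpart_sum:
  fixes v :: "nat \<Rightarrow> ('v, 'k::field) tens"
  assumes "v \<in> vecs E X"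
  obtains L where "v = (\<Sum>n\<le>L. hpart dg n v)"
proof -
  \<comment> \<open>Every larger bound works as well; in this form two summands can share the
    maximum of their bounds.\<close>
  have "\<exists>L. \<forall>M\<ge>L. v = (\<Sum>n\<le>M. hpart dg n v)"
    using assms
  proof (induction rule: vecs_induct)
    case zero
    have "hpart d n 0 = (0 :: ('v, 'k) tvec)" for d n by (simp add: hpart_def fun_eq_iff)
    then have "\<exists>L. \<forall>M\<ge>L. 0 = (\<Sum>n\<le>M. hpart dg n (0 :: ('v, 'k) tvec))" by simp
    then show ?case .
  next
    case (add v w)
    then obtain L M where L: "\<forall>N\<ge>L. v = (\<Sum>n\<le>N. hpart dg n v)" and M: "\<forall>N\<ge>M. w = (\<Sum>n\<le>N. hpart dg n w)" by blast
    show ?case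
    proof (intro exI[of _ "max L M"] allI impI)
      fix N assume "N \<ge> max L M"
      then have "v = (\<Sum>n\<le>N. hpart dg n v)" "w = (\<Sum>n\<le>N. hpart dg n w)" using L M by auto
      then show "v + w = (\<Sum>n\<le>N. hpart dg n (v + w))" by (simp add: hpart_add sum.distrib)
    qed
  next
    case (single x t)
    define l where "l = Max ((\<lambda>w. length (letters w)) ` Poly_Mapping.keys t)"
    have l: "length (letters w) \<le> l" if "w \<in> Poly_Mapping.keys t" for w
      unfolding l_def using that by (intro Max_ge) auto
    show ?case
    proof (intro exI[of _ "dg x + l"] allI impI ext poly_mapping_eqI)
      fix N y w assume N: "dg x + l \<le> N"
      have "Poly_Mapping.lookup ((\<Sum>n\<le>N. hpart dg n (svec x t)) y) w =
         (\<Sum>n\<le>N. if n = dg x + length (letters w) then Poly_Mapping.lookup (svec x t y) w else 0)"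
        unfolding sum_fun_apply lookup_sum
        by (rule sum.cong) (auto simp: hpart_def lookup_hproj svec_def)
      also have "\<dots> = Poly_Mapping.lookup (svec x t y) w"
        using N l[of w] by (cases "w \<in> Poly_Mapping.keys t") (auto simp: sum.delta svec_def in_keys_iff)
      finally show "Poly_Mapping.lookup (svec x t y) w = Poly_Mapping.lookup ((\<Sum>n\<le>N. hpart dg n (svec x t)) y) w"
        by simp
    qed
  qed
  then show ?thesis using that by blast
qed

section \<open>Classes of tensors and of vectors modulo the ideal\<close>

context positive_graded_ideal
begin

abbreviation "B \<equiv> quotient_algebra E J"
abbreviation "BC \<equiv> quotient_component E J"

definition cls :: "('v, 'k) tens \<Rightarrow> ('v, 'k) tens set" where
  "cls t = J +>\<^bsub>tensor_algebra E\<^esub> t"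

definition cvec :: "('v, 'k) tvec \<Rightarrow> nat \<Rightarrow> ('v, 'k) tens set" where
  "cvec v = (\<lambda>x. cls (v x))"

lemma cls_altdef: "cls t = {j + t | j. j \<in> J}"
  by (auto simp: cls_def a_r_coset_def')

lemma cls_eq_iff: "cls s = cls t \<longleftrightarrow> s - t \<in> J"
proof
  assume "cls s = cls t"
  moreover have "s \<in> cls s" unfolding cls_altdef by (auto intro: exI[of _ 0])
  ultimately obtain j where "s = j + t" "j \<in> J" by (auto simp: cls_altdef)
  then show "s - t \<in> J" by simp
next
  assume st: "s - t \<in> J"
  show "cls s = cls t"
  proof (intro equalityI subsetI)
    fix x assume "x \<in> cls s"
    then obtain j where "x = j + s" "j \<in> J" by (auto simp: cls_altdef)
    then have "x = (j + (s - t)) + t" "j + (s - t) \<in> J" using st by (auto intro: J_add)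
    then show "x \<in> cls t" unfolding cls_altdef by blast
  next
    fix x assume "x \<in> cls t"
    then obtain j where "x = j + t" "j \<in> J" by (auto simp: cls_altdef)
    then have "x = (j - (s - t)) + s" "j - (s - t) \<in> J" using st by (auto intro: J_diff)
    then show "x \<in> cls s" unfolding cls_altdef by blast
  qed
qed

lemma cls_zero: "cls 0 = J"
  by (auto simp: cls_altdef)

lemma carrier_B: "carrier B = cls ` tens_carrier E"
  by (auto simp: quotient_algebra_def FactRing_def A_RCOSETS_def RCOSETS_def cls_def a_r_coset_def)

lemma zero_B [simp]: "\<zero>\<^bsub>B\<^esub> = cls 0"
  by (simp add: quotient_algebra_def FactRing_def cls_zero)

lemma add_B [simp]: "s \<in> tens_carrier E \<Longrightarrow> t \<in> tens_carrier E \<Longrightarrow> cls s \<oplus>\<^bsub>B\<^esub> cls t = cls (s + t)"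
  using I.a_rcos_sum[of s t] by (simp add: quotient_algebra_def FactRing_def cls_def)

lemma mult_B [simp]: "s \<in> tens_carrier E \<Longrightarrow> t \<in> tens_carrier E \<Longrightarrow> cls s \<otimes>\<^bsub>B\<^esub> cls t = cls (s * t)"
  using I.rcoset_mult_add[of s t] by (simp add: quotient_algebra_def FactRing_def cls_def)

lemma BC_eq: "BC n = cls ` tpow E n"
  by (simp add: quotient_component_def cls_def)

lemma augmentation_cls [simp]: "augmentation (cls t) = Poly_Mapping.lookup t 0"
  unfolding cls_def using lookup_zero J_zero by (intro augmentation_coset) (auto simp del: J_zero)

lemma cvec_eq_iff: "cvec v = cvec w \<longleftrightarrow> (\<forall>x. v x - w x \<in> J)"
  by (simp add: cvec_def fun_eq_iff cls_eq_iff)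

lemma cvec_in_free_module: "v \<in> vecs E X \<Longrightarrow> cvec v \<in> carrier (free_module B X)"
  unfolding free_module_def cvec_def vecs_def carrier_B
  using J_zero by (auto simp: cls_eq_iff elim!: finite_subset[rotated]) (metis J_zero)

text \<open>An element lifts to a vector over \<open>T(V)\<close> of the same finite support,
  provided the zero class is represented by \<open>0\<close>.\<close>

lemma carrier_free_module: "carrier (free_module B X) = cvec ` vecs E X"
proof (intro equalityI subsetI)
  fix f assume f: "f \<in> carrier (free_module B X)"
  have "\<exists>t\<in>tens_carrier E. f x = cls t \<and> (f x = cls 0 \<longrightarrow> t = 0)" for x
  proof (cases "f x = cls 0")
    case False
    then have "x \<in> X" using f by (auto simp: free_module_def)
    then show ?thesis using f False by (auto simp: free_module_def carrier_B)
  qed auto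
  then obtain v where v: "\<And>x. v x \<in> tens_carrier E" "\<And>x. f x = cls (v x)" "\<And>x. f x = cls 0 \<Longrightarrow> v x = 0"
    by metis
  have nz: "v x \<noteq> 0 \<longleftrightarrow> f x \<noteq> cls 0" for x using v(2,3) by metis
  have "v \<in> vecs E X" using f v(1) by (auto simp: vecs_def nz free_module_def)
  moreover have "f = cvec v" by (simp add: cvec_def fun_eq_iff v(2))
  ultimately show "f \<in> cvec ` vecs E X" by blast
qed (auto intro: cvec_in_free_module)

lemma free_component_eq: "free_component B BC X dg n = cvec ` hvecs E X dg n"
proof (intro equalityI subsetI)
  fix f assume f: "f \<in> free_component B BC X dg n"
  have "\<exists>t\<in>tpow E (n - dg x). f x = cls t \<and> (f x = cls 0 \<longrightarrow> t = 0) \<and> (t \<noteq> 0 \<longrightarrow> x \<in> X \<and> dg x \<le> n)" for x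
  proof (cases "f x = cls 0")
    case False
    then have "x \<in> X" using f by (auto simp: free_module_def free_component_def)
    then show ?thesis using f False by (auto simp: free_component_def BC_eq)
  qed auto
  then obtain v where v: "\<And>x. v x \<in> tpow E (n - dg x)" "\<And>x. f x = cls (v x)" "\<And>x. f x = cls 0 \<Longrightarrow> v x = 0"
    "\<And>x. v x \<noteq> 0 \<Longrightarrow> x \<in> X \<and> dg x \<le> n"
    by metis
  have nz: "v x \<noteq> 0 \<longleftrightarrow> f x \<noteq> cls 0" for x using v(2,3) by metis
  have "finite {x. v x \<noteq> 0}" using f by (auto simp: nz free_component_def free_module_def)
  with v have "v \<in> hvecs E X dg n" by (auto simp: hvecs_def)
  moreover have "f = cvec v" by (simp add: cvec_def fun_eq_iff v(2))
  ultimately show "f \<in> cvec ` hvecs E X dg n" by blast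
next
  fix f assume "f \<in> cvec ` hvecs E X dg n"
  then obtain v where v: "v \<in> hvecs E X dg n" "f = cvec v" by blast
  have "dg x \<le> n \<and> f x \<in> BC (n - dg x)" if "f x \<noteq> cls 0" for x
  proof -
    have "v x \<noteq> 0" using that v by (auto simp: cvec_def)
    with hvecsD[OF v(1)] show ?thesis by (auto simp: v(2) BC_eq cvec_def)
  qed
  with cvec_in_free_module[OF hvecs_subset_vecs[OF v(1)]] v(2)
  show "f \<in> free_component B BC X dg n" by (auto simp: free_component_def)
qed

lemma free_module_add: "v \<in> vecs E X \<Longrightarrow> w \<in> vecs E X \<Longrightarrow> cvec v \<oplus>\<^bsub>free_module B Y\<^esub> cvec w = cvec (v + w)"
  by (auto simp: free_module_def cvec_def vecs_def)

lemma free_module_smult: "v \<in> vecs E X \<Longrightarrow> r \<in> tens_carrier E \<Longrightarrow> cls r \<odot>\<^bsub>free_module B Y\<^esub> cvec v = cvec (\<lambda>x. r * v x)"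
  by (auto simp: free_module_def cvec_def vecs_def)

lemma free_module_zero: "\<zero>\<^bsub>free_module B Y\<^esub> = cvec 0"
  by (simp add: free_module_def cvec_def)

text \<open>A linear map on a free module is determined on the generators, so any lifts
  \<open>D x\<close> of their images form a matrix for it.\<close>

lemma graded_linear_free_eq:
  assumes gl: "graded_linear B (free_module B X) MC (free_module B Y) NC f"
    and D: "\<And>x. x \<in> X \<Longrightarrow> D x \<in> vecs E Y" "\<And>x. x \<in> X \<Longrightarrow> f (cvec (svec x 1)) = cvec (D x)"
    and v: "v \<in> vecs E X"
  shows "f (cvec v) = cvec (row_mult v D)"
proof -
  have f_add: "f (cvec (v + w)) = f (cvec v) \<oplus>\<^bsub>free_module B Y\<^esub> f (cvec w)" if "v \<in> vecs E X" "w \<in> vecs E X" for v w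
    using gl that unfolding free_module_add[OF that, of X, symmetric]
    by (simp add: graded_linear_def carrier_free_module)
  have smult: "f (cvec (\<lambda>x. r * v x)) = cls r \<odot>\<^bsub>free_module B Y\<^esub> f (cvec v)"
    if "r \<in> tens_carrier E" "v \<in> vecs E X" for r v
    using gl that unfolding free_module_smult[OF that(2,1), of X, symmetric]
    by (simp add: graded_linear_def carrier_free_module carrier_B)
  show ?thesis using v
  proof (induction rule: vecs_induct)
    case zero
    \<comment> \<open>That \<open>f\<close> maps zero to zero is read off from linearity with the
      scalar \<open>0\<close>.\<close>
    have "f (cvec 0) \<in> cvec ` vecs E Y"
      using gl by (auto simp: graded_linear_def carrier_free_module)
    then obtain w where w: "w \<in> vecs E Y" "f (cvec 0) = cvec w" by blast
    have "f (cvec (\<lambda>x. 0 * (0 :: nat \<Rightarrow> _) x)) = cvec (\<lambda>x. 0 * w x)"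
      using smult[of 0 0] w by (simp add: free_module_smult)
    then show ?case by (simp add: zero_fun_def)
  next
    case (add v w)
    have "f (cvec (v + w)) = cvec (row_mult v D) \<oplus>\<^bsub>free_module B Y\<^esub> cvec (row_mult w D)"
      using f_add[OF add(1,2)] add(3,4) by simp
    also have "\<dots> = cvec (row_mult v D + row_mult w D)"
      using add(1,2) D(1) by (intro free_module_add row_mult_in_vecs)
    also have "row_mult v D + row_mult w D = row_mult (v + w) D"
      using add(1,2) by (intro row_mult_add[symmetric] vecsD(1))
    finally show ?case .
  next
    case (single x t)
    have "svec x t = (\<lambda>y. t * svec x 1 y)" by (auto simp: svec_def)
    then have "f (cvec (svec x t)) = cls t \<odot>\<^bsub>free_module B Y\<^esub> cvec (D x)"
      using smult[of t "svec x 1"] single D(2) by (simp add: svec_in_vecs)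
    also have "\<dots> = cvec (\<lambda>u. t * D x u)" using D(1)[OF single(1)] single(2) by (rule free_module_smult)
    also have "(\<lambda>u. t * D x u) = row_mult (svec x t) D" by (simp add: fun_eq_iff)
    finally show ?case .
  qed
qed

text \<open>The analogue for maps into \<open>k\<close>: one column \<open>u\<close> is relevant,
  and of its entries only the constant terms.\<close>

lemma graded_linear_trivial_eq:
  assumes gl: "graded_linear B (free_module B X) MC trivial_module NC f"
    and D: "\<And>x. x \<in> X \<Longrightarrow> f (cvec (svec x 1)) = Poly_Mapping.lookup (D x u) 0"
    and v: "v \<in> vecs E X"
  shows "f (cvec v) = Poly_Mapping.lookup (row_mult v D u) 0"
proof -
  have f_add: "f (cvec (v + w)) = f (cvec v) + f (cvec w)" if "v \<in> vecs E X" "w \<in> vecs E X" for v w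
    using gl that unfolding free_module_add[OF that, of X, symmetric]
    by (simp add: graded_linear_def carrier_free_module trivial_module_def)
  have smult: "f (cvec (\<lambda>x. r * v x)) = Poly_Mapping.lookup r 0 * f (cvec v)"
    if "r \<in> tens_carrier E" "v \<in> vecs E X" for r v
    using gl that unfolding free_module_smult[OF that(2,1), of X, symmetric]
    by (simp add: graded_linear_def carrier_free_module carrier_B trivial_module_def)
  show ?thesis using v
  proof (induction rule: vecs_induct)
    case zero
    have "f (cvec 0) + f (cvec 0) = f (cvec 0)" using f_add[of 0 0] by simp
    then have "f (cvec 0) = 0" by (metis add_left_cancel add.right_neutral)
    then have "f (cvec 0) = Poly_Mapping.lookup (row_mult 0 D u) 0" by simp
    then show ?case .
  next
    case (add v w)
    have "f (cvec (v + w)) = Poly_Mapping.lookup (row_mult v D u + row_mult w D u) 0"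
      using f_add[OF add(1,2)] add(3,4) by (simp add: lookup_add)
    also have "row_mult v D u + row_mult w D u = row_mult (v + w) D u"
      using row_mult_add[OF vecsD(1)[OF add(1)] vecsD(1)[OF add(2)], of D] by simp
    finally show ?case .
  next
    case (single x t)
    have "svec x t = (\<lambda>y. t * svec x 1 y)" by (auto simp: svec_def)
    then have "f (cvec (svec x t)) = Poly_Mapping.lookup t 0 * Poly_Mapping.lookup (D x u) 0"
      using smult[of t "svec x 1"] single D by (simp add: svec_in_vecs)
    then show ?case unfolding row_mult_svec lookup_zero_mult .
  qed
qed

end

section \<open>Lifting a graded free resolution to matrices\<close>

lemma one_in_tpow: "1 \<in> tpow E 0"
  using single_zero_in_tpow[of 1 E] by simp

lemma lookup_hproj_zero: "Poly_Mapping.lookup (hproj n t) 0 = (if n = 0 then Poly_Mapping.lookup t 0 else 0)"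
  by (simp add: lookup_hproj zero_fword_def)

lemma hproj_in_aug_ideal: "t \<in> aug_ideal E \<Longrightarrow> hproj n t \<in> aug_ideal E"
  using tpow_subset_tens_carrier[OF hproj_in_tpow[of t E n]] by (simp add: aug_ideal_def lookup_hproj_zero)

lemma hpart_diff: "hpart dg n (v - w) = hpart dg n v - hpart dg n w"
  by (simp add: hpart_def hproj_diff fun_eq_iff)

text \<open>Images of generators are lifted to homogeneous vectors over \<open>T(V)\<close>, and the
  augmentation becomes the matrix \<open>D (Suc 0)\<close> with one column of constants. Equalities
  in the resolution turn into congruences modulo \<open>J\<close>, or modulo the augmentation ideal
  where the target is \<open>k\<close>.\<close>

lemma (in positive_graded_ideal) resolution_matrices:
  assumes F: "graded_free_resolution B BC trivial_module trivial_component F"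
  obtains X dg D where "matrix_resolution E J X dg D"
    "\<And>i. X (Suc i) = gens F i" "\<And>i. dg (Suc i) = gdeg F i"
    "\<And>i v. v \<in> vecs E (gens F (Suc i)) \<Longrightarrow>
      differential F i (cvec v) = cvec (row_mult v (D (Suc (Suc i))))"
proof -
  have gl0: "graded_linear B (res_module B F 0) (res_component B BC F 0) trivial_module trivial_component (augment F)"
    and gl: "\<And>i. graded_linear B (res_module B F (Suc i)) (res_component B BC F (Suc i))
           (res_module B F i) (res_component B BC F i) (differential F i)"
    and surj: "augment F ` cvec ` vecs E (gens F 0) = UNIV"
    and ex0: "{x \<in> cvec ` vecs E (gens F 0). augment F x = 0} = differential F 0 ` cvec ` vecs E (gens F 1)"
    and ex: "\<And>i. {x \<in> cvec ` vecs E (gens F (Suc i)). differential F i x = cvec 0}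
           = differential F (Suc i) ` cvec ` vecs E (gens F (Suc (Suc i)))"
    using F unfolding graded_free_resolution_def carrier_free_module free_module_zero
    by (simp_all add: trivial_module_def)
  have unit: "svec x 1 \<in> hvecs E Y dy (dy x)" if "x \<in> Y" for x Y and dy :: "nat \<Rightarrow> nat"
    using that by (intro svec_in_hvecs) (auto intro: one_in_tpow)
  have "\<exists>d\<in>hvecs E (gens F i) (gdeg F i) (gdeg F (Suc i) x). differential F i (cvec (svec x 1)) = cvec d"
    if "x \<in> gens F (Suc i)" for i x
    using gl[of i] unit[OF that, of "gdeg F (Suc i)"] unfolding graded_linear_def free_component_eq by blast
  then have "\<forall>i x. \<exists>d. x \<in> gens F (Suc i) \<longrightarrow> d \<in> hvecs E (gens F i) (gdeg F i) (gdeg F (Suc i) x) \<and>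
      differential F i (cvec (svec x 1)) = cvec d" by blast
  then obtain d where "\<forall>i x. x \<in> gens F (Suc i) \<longrightarrow> d i x \<in> hvecs E (gens F i) (gdeg F i) (gdeg F (Suc i) x) \<and>
      differential F i (cvec (svec x 1)) = cvec (d i x)" unfolding choice_iff by blast
  then have d: "\<And>i x. x \<in> gens F (Suc i) \<Longrightarrow> d i x \<in> hvecs E (gens F i) (gdeg F i) (gdeg F (Suc i) x)"
    "\<And>i x. x \<in> gens F (Suc i) \<Longrightarrow> differential F i (cvec (svec x 1)) = cvec (d i x)"
    by auto
  define X where "X = (\<lambda>q. case q of 0 \<Rightarrow> {0} | Suc i \<Rightarrow> gens F i)"
  define dg where "dg = (\<lambda>q. case q of 0 \<Rightarrow> (\<lambda>_. 0) | Suc i \<Rightarrow> gdeg F i)"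
  define D where "D = (\<lambda>q. case q of 0 \<Rightarrow> 0
    | Suc r \<Rightarrow> (case r of 0 \<Rightarrow> (\<lambda>x. svec 0 (Poly_Mapping.single 0 (augment F (cvec (svec x 1))))) | Suc i \<Rightarrow> d i))"
  have X: "X 0 = {0}" "\<And>i. X (Suc i) = gens F i" by (simp_all add: X_def)
  have dg: "dg 0 = (\<lambda>_. 0)" "\<And>i. dg (Suc i) = gdeg F i" by (simp_all add: dg_def)
  have D: "D 0 = 0" "D (Suc 0) = (\<lambda>x. svec 0 (Poly_Mapping.single 0 (augment F (cvec (svec x 1)))))"
    "\<And>i. D (Suc (Suc i)) = d i" by (simp_all add: D_def)
  have diff: "differential F i (cvec v) = cvec (row_mult v (d i))" if "v \<in> vecs E (gens F (Suc i))" for i v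
    using gl[of i] d that by (intro graded_linear_free_eq) (auto intro: hvecs_subset_vecs)
  have aug: "augment F (cvec v) = Poly_Mapping.lookup (row_mult v (D (Suc 0)) 0) 0" if "v \<in> vecs E (gens F 0)" for v
    using gl0 that by (intro graded_linear_trivial_eq) (simp_all add: D svec_def)
  have D_hvecs: "D q x \<in> hvecs E (X (q - 1)) (dg (q - 1)) (dg q x)" if x: "x \<in> X q" for q x
  proof -
    consider "q = 0" | "q = Suc 0" | i where "q = Suc (Suc i)" by (metis not0_implies_Suc)
    then show ?thesis
    proof cases
      case 2
      \<comment> \<open>A generator of positive degree has augmentation \<open>0\<close> because
        \<open>k\<close> lies in degree \<open>0\<close>; a nonzero constant would not be
        homogeneous of the degree of the generator.\<close>
      have "augment F (cvec (svec x 1)) = 0" if "gdeg F 0 x \<noteq> 0"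
      proof -
        have "cvec (svec x 1) \<in> res_component B BC F 0 (gdeg F 0 x)"
          using x 2 unfolding free_component_eq by (intro imageI unit) (simp add: X)
        moreover have "augment F ` res_component B BC F 0 (gdeg F 0 x) \<subseteq> trivial_component (gdeg F 0 x)"
          using gl0 by (simp add: graded_linear_def)
        ultimately have "augment F (cvec (svec x 1)) \<in> trivial_component (gdeg F 0 x)" by blast
        with that show ?thesis by (simp add: trivial_component_def)
      qed
      then have "Poly_Mapping.single 0 (augment F (cvec (svec x 1))) \<in> tpow E (gdeg F 0 x - 0)"
        by (cases "gdeg F 0 x = 0") (simp_all add: single_zero_in_tpow)
      then show ?thesis unfolding 2 by (simp add: D(2) X dg svec_in_hvecs)
    qed (use x d in \<open>simp_all add: D X dg\<close>)
  qed
  have row1: "row_mult v (D (Suc 0)) u = 0" if "u \<noteq> 0" for v u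
    using that by (simp add: D row_mult_def svec_def)
  have "matrix_resolution E J X dg D"
  proof (intro matrix_resolution.intro matrix_resolution_axioms.intro)
    show "positive_graded_ideal E J" by (rule positive_graded_ideal_axioms)
    show "X 0 = {0}" "dg 0 0 = 0" "D 0 = 0" by (simp_all add: X dg D)
    show "D q x \<in> hvecs E (X (q - 1)) (dg (q - 1)) (dg q x)" if "x \<in> X q" for q x
      using that by (rule D_hvecs)
    show "row_mult (D q x) (D (q - 1)) u \<in> (if q \<le> 2 then aug_ideal E else J)" if x: "x \<in> X q" for q x u
    proof -
      have DD: "row_mult (D q x) (D (q - 1)) \<in> hvecs E (X (q - 1 - 1)) (dg (q - 1 - 1)) (dg q x)"
        using D_hvecs[OF x] by (rule row_mult_in_hvecs) (rule D_hvecs)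
      \<comment> \<open>With truncated indices, \<open>q - 1 = 0\<close> is the case where the
        second factor is \<open>D 0\<close>, that is, zero.\<close>
      have "q - 1 = 0 \<or> q = Suc (Suc 0) \<or> (\<exists>i. q = Suc (Suc (Suc i)))" by presburger
      then show ?thesis
      proof (elim disjE exE)
        assume 1: "q - 1 = 0"
        then show ?thesis by (simp add: D(1) aug_ideal_closed)
      next
        assume 2: "q = Suc (Suc 0)"
        have x1: "x \<in> gens F (Suc 0)" using x 2 by (simp add: X)
        have v: "svec x 1 \<in> vecs E (gens F (Suc 0))" using x1 by (intro svec_in_vecs) auto
        have "cvec (d 0 x) \<in> differential F 0 ` cvec ` vecs E (gens F 1)"
          unfolding d(2)[OF x1, symmetric] One_nat_def by (intro imageI v)
        then have "augment F (cvec (d 0 x)) = 0" using ex0 by blast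
        then have "Poly_Mapping.lookup (row_mult (d 0 x) (D (Suc 0)) 0) 0 = 0"
          using aug[of "d 0 x"] hvecs_subset_vecs[OF d(1)[OF x1]] by simp
        then have "Poly_Mapping.lookup (row_mult (d 0 x) (D (Suc 0)) u) 0 = 0"
          using row1[of u] by (cases "u = 0") simp_all
        with hvecsD(2)[OF DD] 2 show ?thesis by (simp add: aug_ideal_def D(3))
      next
        fix i assume 3: "q = Suc (Suc (Suc i))"
        have x1: "x \<in> gens F (Suc (Suc i))" using x 3 by (simp add: X)
        have v: "svec x 1 \<in> vecs E (gens F (Suc (Suc i)))" using x1 by (intro svec_in_vecs) auto
        have "cvec (d (Suc i) x) \<in> differential F (Suc i) ` cvec ` vecs E (gens F (Suc (Suc i)))"
          unfolding d(2)[OF x1, symmetric] One_nat_def by (intro imageI v)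
        then have "differential F i (cvec (d (Suc i) x)) = cvec 0" using ex[of i] by blast
        then have "cvec (row_mult (d (Suc i) x) (d i)) = cvec 0"
          using diff[OF hvecs_subset_vecs[OF d(1)[OF x1]]] by simp
        then show ?thesis using 3 by (simp add: D cvec_eq_iff)
      qed
    qed
    show "\<exists>w\<in>hvecs E (X (Suc q)) (dg (Suc q)) n. \<forall>x. v x - row_mult w (D (Suc q)) x \<in> (if q = 0 then aug_ideal E else J)"
      if v: "v \<in> hvecs E (X q) (dg q) n" and z: "\<And>u. row_mult v (D q) u \<in> (if q \<le> 1 then aug_ideal E else J)" for q n v
    proof -
      \<comment> \<open>A preimage need not be homogeneous, but its component of degree
        \<open>n\<close> is again a preimage, since the matrix has degree \<open>0\<close> and
        \<open>J\<close> is homogeneous.\<close>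
      have lift: ?thesis if q: "q = Suc i" and im: "cvec v \<in> differential F i ` cvec ` vecs E (gens F (Suc i))" for i
      proof -
        obtain w where w: "w \<in> vecs E (gens F (Suc i))" "cvec v = differential F i (cvec w)" using im by blast
        let ?w = "hpart (gdeg F (Suc i)) n w"
        have "hpart (gdeg F i) n (v - row_mult w (d i)) = v - row_mult ?w (d i)"
          unfolding hpart_diff using v q hpart_hvecs[of v E _ "gdeg F i" n] hpart_row_mult[OF w(1) d(1)[of _ i], where n = n]
          by (auto simp: X dg)
        moreover have "v x - row_mult w (d i) x \<in> J" for x
          using w diff[OF w(1)] by (simp add: cvec_eq_iff)
        then have "hpart (gdeg F i) n (v - row_mult w (d i)) x \<in> J" for x
          by (simp add: hpart_def hproj_closed)
        ultimately have "v x - row_mult ?w (d i) x \<in> J" for x by simp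
        with hpart_in_hvecs[OF w(1)] show ?thesis using q by (intro bexI[of _ ?w]) (auto simp: X dg D)
      qed
      consider "q = 0" | "q = Suc 0" | i where "q = Suc (Suc i)" by (metis not0_implies_Suc)
      then show ?thesis
      proof cases
        case 1
        \<comment> \<open>Modulo the augmentation ideal only the constant term of \<open>v 0\<close>
          counts. Passing to the component of degree \<open>n\<close> of a preimage keeps it for
          \<open>n = 0\<close>; for \<open>n > 0\<close> both constant terms are
          \<open>0\<close>.\<close>
        have "Poly_Mapping.lookup (v 0) 0 \<in> augment F ` cvec ` vecs E (gens F 0)" unfolding surj ..
        then obtain w where w: "w \<in> vecs E (gens F 0)" "Poly_Mapping.lookup (v 0) 0 = augment F (cvec w)"
          by blast
        let ?w = "hpart (gdeg F 0) n w"
        have ww: "?w \<in> hvecs E (gens F 0) (gdeg F 0) n" using w(1) by (rule hpart_in_hvecs)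
        have "row_mult ?w (D (Suc 0)) \<in> hvecs E {0} (\<lambda>_. 0) n"
          using ww D_hvecs[of _ "Suc 0"] by (intro row_mult_in_hvecs) (auto simp: X dg)
        note rw = hvecsD(2)[OF this]
        have v': "v \<in> hvecs E {0} (\<lambda>_. 0) n" using v 1 by (simp add: X dg)
        have "v x - row_mult ?w (D (Suc 0)) x \<in> aug_ideal E" for x
        proof (cases "x = 0")
          case True
          have "row_mult ?w (D (Suc 0)) 0 = hproj n (row_mult w (D (Suc 0)) 0)"
            using fun_cong[OF hpart_row_mult[OF w(1), where D = "D (Suc 0)" and Y = "{0}" and dg' = "\<lambda>_. 0" and dg = "gdeg F 0" and n = n], of 0]
              D_hvecs[of _ "Suc 0"] by (simp add: X dg hpart_def)
          then have "Poly_Mapping.lookup (row_mult ?w (D (Suc 0)) 0) 0 = Poly_Mapping.lookup (v 0) 0"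
            using aug[OF w(1)] w(2) lookup_zero_tpow[OF hvecsD(3)[OF v', of 0]] by (simp add: lookup_hproj_zero)
          with True show ?thesis using hvecsD(2)[OF v'] rw by (simp add: aug_ideal_def lookup_minus)
        next
          case False
          then have "v x = 0" using hvecsD(4)[OF v', of x] by auto
          with False show ?thesis using row1[of x] by (simp add: aug_ideal_closed)
        qed
        with ww 1 show ?thesis by (auto simp: X dg)
      next
        case 2
        have v': "v \<in> vecs E (gens F 0)" using v 2 hvecs_subset_vecs by (auto simp: X)
        have "augment F (cvec v) = 0" using z[of 0] aug[OF v'] 2 by (simp add: aug_ideal_def)
        then have "cvec v \<in> {x \<in> cvec ` vecs E (gens F 0). augment F x = 0}" using v' by simp
        then show ?thesis unfolding ex0 One_nat_def by (rule lift[OF 2])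
      next
        case 3
        have v': "v \<in> vecs E (gens F (Suc i))" using v 3 hvecs_subset_vecs by (auto simp: X)
        have "differential F i (cvec v) = cvec 0" using z diff[OF v'] 3 by (simp add: D cvec_eq_iff)
        then have "cvec v \<in> {x \<in> cvec ` vecs E (gens F (Suc i)). differential F i x = cvec 0}" using v' by simp
        then show ?thesis unfolding ex by (rule lift[OF 3])
      qed
    qed
  qed
  with X dg D diff show ?thesis by (intro that[of X dg D]) simp_all
qed

section \<open>From matrices back to a graded free resolution\<close>

context matrix_resolution
begin

lemma D_vecs: "x \<in> X q \<Longrightarrow> D q x \<in> vecs E (X (q - 1))"
  by (rule hvecs_subset_vecs) (rule D_hvecs)

text \<open>\<open>J\<close> is closed under right multiplication, so multiplication by
  \<open>D q\<close> descends to classes.\<close>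

lemma row_mult_cong:
  assumes v: "v \<in> vecs E (X q)" and w: "w \<in> vecs E (X q)" and vw: "cvec v = cvec w"
  shows "row_mult v (D q) u - row_mult w (D q) u \<in> J"
proof -
  have "row_mult v (D q) u - row_mult w (D q) u = row_mult (v - w) (D q) u"
    using row_mult_diff[OF vecsD(1)[OF v] vecsD(1)[OF w], of "D q"] by simp
  also have "\<dots> \<in> J"
    unfolding row_mult_def
  proof (rule J_sum)
    fix x assume "x \<in> {x. (v - w) x \<noteq> 0}"
    then have "x \<in> X q" using vecsD(3)[OF diff_in_vecs[OF v w]] by blast
    moreover have "(v - w) x \<in> J" using vw by (simp add: cvec_eq_iff)
    ultimately show "(v - w) x * D q x u \<in> J" by (intro J_rmult D_carrier)
  qed
  finally show ?thesis .
qed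

text \<open>Exactness is given for homogeneous vectors. A general vector is a finite sum of
  components, each again a cycle because \<open>J\<close> and the augmentation ideal are
  homogeneous, and the lifts are added up.\<close>

lemma exact_vecs:
  assumes v: "v \<in> vecs E (X q)" and z: "\<And>u. row_mult v (D q) u \<in> level E J (q \<le> 1)"
  obtains w where "w \<in> vecs E (X (Suc q))" "\<And>x. v x - row_mult w (D (Suc q)) x \<in> level E J (q = 0)"
proof -
  have "\<exists>w\<in>hvecs E (X (Suc q)) (dg (Suc q)) n. \<forall>x. hpart (dg q) n v x - row_mult w (D (Suc q)) x \<in> level E J (q = 0)" for n
    unfolding level_def
  proof (rule exact)
    show "hpart (dg q) n v \<in> hvecs E (X q) (dg q) n" using v by (rule hpart_in_hvecs)
    fix u
    have "row_mult (hpart (dg q) n v) (D q) u = hpart (dg (q - 1)) n (row_mult v (D q)) u"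
      using hpart_row_mult[OF v, where D = "D q" and Y = "X (q - 1)" and dg' = "dg (q - 1)" and dg = "dg q" and n = n] D_hvecs by simp
    also have "\<dots> \<in> level E J (q \<le> 1)"
      using z[of u] by (auto simp: hpart_def level_def hproj_closed hproj_in_aug_ideal aug_ideal_closed)
    finally show "row_mult (hpart (dg q) n v) (D q) u \<in> (if q \<le> 1 then aug_ideal E else J)"
      by (simp only: level_def)
  qed
  then obtain w where w: "\<And>n. w n \<in> hvecs E (X (Suc q)) (dg (Suc q)) n"
    "\<And>n x. hpart (dg q) n v x - row_mult (w n) (D (Suc q)) x \<in> level E J (q = 0)" by metis
  obtain L where L: "v = (\<Sum>n\<le>L. hpart (dg q) n v)" using hpart_sum[OF v] by metis
  have wv: "w n \<in> vecs E (X (Suc q))" for n using w(1) by (rule hvecs_subset_vecs)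
  show ?thesis
  proof
    show "(\<Sum>n\<le>L. w n) \<in> vecs E (X (Suc q))" using wv by (intro sum_in_vecs)
    fix x
    have rs: "row_mult (\<Sum>n\<le>L. w n) (D (Suc q)) = (\<Sum>n\<le>L. row_mult (w n) (D (Suc q)))"
      by (rule row_mult_sum) (rule wv)
    have "v x - row_mult (\<Sum>n\<le>L. w n) (D (Suc q)) x = (\<Sum>n\<le>L. hpart (dg q) n v x - row_mult (w n) (D (Suc q)) x)"
      using fun_cong[OF L, of x] by (simp add: rs sum_fun_apply sum_subtractf)
    then show "v x - row_mult (\<Sum>n\<le>L. w n) (D (Suc q)) x \<in> level E J (q = 0)"
      using w(2) by (simp add: level_sum)
  qed
qed

lemma row_mult_row_mult:
  assumes v: "v \<in> vecs E (X (Suc q))"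
  shows "row_mult (row_mult v (D (Suc q))) (D q) u \<in> level E J (q \<le> 1)"
proof -
  have "row_mult (row_mult v (D (Suc q))) (D q) u = row_mult v (\<lambda>x. row_mult (D (Suc q) x) (D q)) u"
    using vecsD(1,3)[OF v] vecsD(1)[OF D_vecs] by (intro row_mult_assoc) auto
  also have "\<dots> \<in> level E J (q \<le> 1)"
    unfolding row_mult_def[of v]
  proof (rule level_sum)
    fix x assume "x \<in> {x. v x \<noteq> 0}"
    then have "x \<in> X (Suc q)" using vecsD(3)[OF v] by blast
    from D_D[OF this, of u] show "v x * row_mult (D (Suc q) x) (D q) u \<in> level E J (q \<le> 1)"
      by (intro level_lmult vecsD(2)[OF v]) (auto simp: level_def)
  qed
  finally show ?thesis .
qed

definition rep :: "nat \<Rightarrow> (nat \<Rightarrow> ('v, 'k) tens set) \<Rightarrow> nat \<Rightarrow> ('v, 'k) tens" where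
  "rep q f = (SOME v. v \<in> vecs E (X q) \<and> cvec v = f)"

text \<open>Maps of a \<open>free_complex\<close> act on classes, so a lift is chosen before the
  matrix is applied. Positions shift by one, position \<open>0\<close> being
  \<open>k\<close>.\<close>

definition free_resolution :: "(('v, 'k) tens set, 'k) free_complex" where
  "free_resolution = \<lparr>gens = \<lambda>i. X (Suc i), gdeg = \<lambda>i. dg (Suc i),
    differential = \<lambda>i f. cvec (row_mult (rep (Suc (Suc i)) f) (D (Suc (Suc i)))),
    augment = \<lambda>f. Poly_Mapping.lookup (row_mult (rep (Suc 0) f) (D (Suc 0)) 0) 0\<rparr>"

lemma rep_cvec: "v \<in> vecs E (X q) \<Longrightarrow> rep q (cvec v) \<in> vecs E (X q) \<and> cvec (rep q (cvec v)) = cvec v"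
  unfolding rep_def by (rule someI[of "\<lambda>w. w \<in> vecs E (X q) \<and> cvec w = cvec v" v]) simp

lemma differential_cvec:
  "v \<in> vecs E (X (Suc (Suc i))) \<Longrightarrow> differential free_resolution i (cvec v) = cvec (row_mult v (D (Suc (Suc i))))"
  using rep_cvec[of v "Suc (Suc i)"] by (simp add: free_resolution_def cvec_eq_iff row_mult_cong)

lemma augment_cvec:
  assumes "v \<in> vecs E (X (Suc 0))"
  shows "augment free_resolution (cvec v) = Poly_Mapping.lookup (row_mult v (D (Suc 0)) 0) 0"
proof -
  have "row_mult (rep (Suc 0) (cvec v)) (D (Suc 0)) 0 - row_mult v (D (Suc 0)) 0 \<in> J"
    using rep_cvec[OF assms] assms by (intro row_mult_cong) auto
  from lookup_zero[OF this] show ?thesis by (simp add: free_resolution_def lookup_minus)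
qed

text \<open>This makes the constructed matrices a resolution in the sense of the definition, so that
  a hypothesis on all resolutions can be instantiated.\<close>

lemma graded_free_resolution_free_resolution:
  "graded_free_resolution B BC trivial_module trivial_component free_resolution"
proof -
  let ?F = free_resolution
  have F: "gens ?F i = X (Suc i)" "gdeg ?F i = dg (Suc i)" for i by (simp_all add: free_resolution_def)
  have row_vecs: "row_mult v (D q) \<in> vecs E (X (q - 1))" if "v \<in> vecs E (X q)" for v :: "('v, 'k) tvec" and q
    using that by (rule row_mult_in_vecs) (rule D_vecs)
  have row_add: "row_mult (v + w) (D q) = row_mult v (D q) + row_mult w (D q)"
    if "v \<in> vecs E (X q)" "w \<in> vecs E (X q)" for v w :: "('v, 'k) tvec" and q
    using that by (intro row_mult_add vecsD(1))
  have row_lmult: "row_mult (\<lambda>x. r * v x) (D q) u = r * row_mult v (D q) u" if "v \<in> vecs E (X q)" for v :: "('v, 'k) tvec" and r q u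
    using that by (intro row_mult_lmult vecsD(1))
  have gl0: "graded_linear B (free_module B (X (Suc 0))) (free_component B BC (X (Suc 0)) (dg (Suc 0)))
      trivial_module trivial_component (augment ?F)"
    unfolding graded_linear_def carrier_free_module free_component_eq carrier_B
  proof (intro conjI ballI allI)
    show "augment ?F \<in> cvec ` vecs E (X (Suc 0)) \<rightarrow> carrier trivial_module" by (simp add: trivial_module_def)
  next
    fix x y assume "x \<in> cvec ` vecs E (X (Suc 0))" "y \<in> cvec ` vecs E (X (Suc 0))"
    then obtain v w where "v \<in> vecs E (X (Suc 0))" "x = cvec v" "w \<in> vecs E (X (Suc 0))" "y = cvec w" by blast
    then show "augment ?F (x \<oplus>\<^bsub>free_module B (X (Suc 0))\<^esub> y) = augment ?F x \<oplus>\<^bsub>trivial_module\<^esub> augment ?F y"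
      by (simp add: free_module_add augment_cvec add_in_vecs row_add trivial_module_def lookup_add)
  next
    fix r x assume "r \<in> cls ` tens_carrier E" "x \<in> cvec ` vecs E (X (Suc 0))"
    then obtain s v where "s \<in> tens_carrier E" "r = cls s" "v \<in> vecs E (X (Suc 0))" "x = cvec v" by blast
    then show "augment ?F (r \<odot>\<^bsub>free_module B (X (Suc 0))\<^esub> x) = r \<odot>\<^bsub>trivial_module\<^esub> augment ?F x"
      by (simp add: free_module_smult augment_cvec lmult_in_vecs row_lmult trivial_module_def lookup_zero_mult)
  next
    fix n
    show "augment ?F ` cvec ` hvecs E (X (Suc 0)) (dg (Suc 0)) n \<subseteq> trivial_component n"
    proof (clarsimp)
      fix v :: "('v, 'k) tvec" assume v: "v \<in> hvecs E (X (Suc 0)) (dg (Suc 0)) n"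
      have "row_mult v (D (Suc 0)) \<in> hvecs E (X (Suc 0 - 1)) (dg (Suc 0 - 1)) n"
        using v by (rule row_mult_in_hvecs) (rule D_hvecs)
      from hvecsD(3)[OF this, of 0] have "row_mult v (D (Suc 0)) 0 \<in> tpow E n" by (simp add: dg_0)
      then show "augment ?F (cvec v) \<in> trivial_component n"
        using lookup_zero_tpow[of _ E n] by (auto simp: augment_cvec hvecs_subset_vecs[OF v] trivial_component_def)
    qed
  qed
  have gl: "graded_linear B (free_module B (X (Suc (Suc i)))) (free_component B BC (X (Suc (Suc i))) (dg (Suc (Suc i))))
      (free_module B (X (Suc i))) (free_component B BC (X (Suc i)) (dg (Suc i))) (differential ?F i)" for i
    unfolding graded_linear_def carrier_free_module free_component_eq carrier_B
  proof (intro conjI ballI allI)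
    show "differential ?F i \<in> cvec ` vecs E (X (Suc (Suc i))) \<rightarrow> cvec ` vecs E (X (Suc i))"
      using row_vecs[of _ "Suc (Suc i)"] by (auto simp: differential_cvec)
  next
    fix x y assume "x \<in> cvec ` vecs E (X (Suc (Suc i)))" "y \<in> cvec ` vecs E (X (Suc (Suc i)))"
    then obtain v w where vw: "v \<in> vecs E (X (Suc (Suc i)))" "x = cvec v" "w \<in> vecs E (X (Suc (Suc i)))" "y = cvec w" by blast
    show "differential ?F i (x \<oplus>\<^bsub>free_module B (X (Suc (Suc i)))\<^esub> y) =
        differential ?F i x \<oplus>\<^bsub>free_module B (X (Suc i))\<^esub> differential ?F i y"
      using vw row_vecs[OF vw(1)] row_vecs[OF vw(3)]
      by (simp add: free_module_add[of _ "X (Suc (Suc i))"] free_module_add[of _ "X (Suc i)"] differential_cvec add_in_vecs row_add)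
  next
    fix r x assume "r \<in> cls ` tens_carrier E" "x \<in> cvec ` vecs E (X (Suc (Suc i)))"
    then obtain s v where sv: "s \<in> tens_carrier E" "r = cls s" "v \<in> vecs E (X (Suc (Suc i)))" "x = cvec v" by blast
    have "cvec (row_mult (\<lambda>x. s * v x) (D (Suc (Suc i)))) = cvec (\<lambda>u. s * row_mult v (D (Suc (Suc i))) u)"
      using sv by (simp add: row_lmult cvec_eq_iff)
    then show "differential ?F i (r \<odot>\<^bsub>free_module B (X (Suc (Suc i)))\<^esub> x) = r \<odot>\<^bsub>free_module B (X (Suc i))\<^esub> differential ?F i x"
      using sv free_module_smult[OF row_vecs[OF sv(3)] sv(1), of "X (Suc i)"]
      by (simp add: free_module_smult[of v "X (Suc (Suc i))"] differential_cvec lmult_in_vecs)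
  next
    fix n
    show "differential ?F i ` cvec ` hvecs E (X (Suc (Suc i))) (dg (Suc (Suc i))) n \<subseteq> cvec ` hvecs E (X (Suc i)) (dg (Suc i)) n"
    proof (clarsimp)
      fix v :: "('v, 'k) tvec" assume v: "v \<in> hvecs E (X (Suc (Suc i))) (dg (Suc (Suc i))) n"
      have "row_mult v (D (Suc (Suc i))) \<in> hvecs E (X (Suc (Suc i) - 1)) (dg (Suc (Suc i) - 1)) n"
        using v by (rule row_mult_in_hvecs) (rule D_hvecs)
      then show "differential ?F i (cvec v) \<in> cvec ` hvecs E (X (Suc i)) (dg (Suc i)) n"
        by (simp add: differential_cvec hvecs_subset_vecs[OF v])
    qed
  qed
  have surj: "augment ?F ` cvec ` vecs E (X (Suc 0)) = UNIV"
  proof -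
    have "\<exists>v\<in>vecs E (X (Suc 0)). augment ?F (cvec v) = c" for c
    proof -
      \<comment> \<open>\<open>c\<close> is placed as a constant at position \<open>0\<close>, where
        everything is a cycle because \<open>D 0 = 0\<close>.\<close>
      have s: "svec 0 (Poly_Mapping.single 0 c) \<in> vecs E (X 0)" by (intro svec_in_vecs) (auto simp: X_0)
      from exact_vecs[OF s] obtain w where w: "w \<in> vecs E (X (Suc 0))"
        "\<And>x. svec 0 (Poly_Mapping.single 0 c) x - row_mult w (D (Suc 0)) x \<in> aug_ideal E"
        by (auto simp: D_0 level_def aug_ideal_closed)
      from w(2)[of 0] have "Poly_Mapping.lookup (row_mult w (D (Suc 0)) 0) 0 = c"
        by (simp add: aug_ideal_def svec_def lookup_minus)
      with w(1) show ?thesis by (intro bexI[of _ w]) (simp_all add: augment_cvec)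
    qed
    then show ?thesis by (auto simp: image_image) (metis imageI)
  qed
  have ex0: "{x \<in> cvec ` vecs E (X (Suc 0)). augment ?F x = 0} = differential ?F 0 ` cvec ` vecs E (X (Suc (Suc 0)))"
  proof (intro equalityI subsetI)
    fix x assume "x \<in> {x \<in> cvec ` vecs E (X (Suc 0)). augment ?F x = 0}"
    then obtain v where v: "v \<in> vecs E (X (Suc 0))" "x = cvec v" "augment ?F (cvec v) = 0" by blast
    have "row_mult v (D (Suc 0)) u \<in> aug_ideal E" for u
      using vecsD(2,4)[OF row_vecs[OF v(1)], of u] v augment_cvec[OF v(1)]
      by (cases "u = 0") (auto simp: aug_ideal_def X_0)
    with exact_vecs[OF v(1)] obtain w where w: "w \<in> vecs E (X (Suc (Suc 0)))"
      "\<And>x. v x - row_mult w (D (Suc (Suc 0))) x \<in> J"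
      by (auto simp: level_def)
    then have "x = differential ?F 0 (cvec w)" by (simp add: v(2) differential_cvec cvec_eq_iff)
    with w(1) show "x \<in> differential ?F 0 ` cvec ` vecs E (X (Suc (Suc 0)))" by blast
  next
    fix x assume "x \<in> differential ?F 0 ` cvec ` vecs E (X (Suc (Suc 0)))"
    then obtain v where v: "v \<in> vecs E (X (Suc (Suc 0)))" "x = cvec (row_mult v (D (Suc (Suc 0))))"
      by (auto simp: differential_cvec)
    have r: "row_mult v (D (Suc (Suc 0))) \<in> vecs E (X (Suc 0))" using row_vecs[OF v(1)] by simp
    with v row_mult_row_mult[OF v(1), of 0] show "x \<in> {x \<in> cvec ` vecs E (X (Suc 0)). augment ?F x = 0}"
      by (auto simp: augment_cvec level_def aug_ideal_def)
  qed
  have ex: "{x \<in> cvec ` vecs E (X (Suc (Suc i))). differential ?F i x = cvec 0}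
      = differential ?F (Suc i) ` cvec ` vecs E (X (Suc (Suc (Suc i))))" for i
  proof (intro equalityI subsetI)
    fix x assume "x \<in> {x \<in> cvec ` vecs E (X (Suc (Suc i))). differential ?F i x = cvec 0}"
    then obtain v where v: "v \<in> vecs E (X (Suc (Suc i)))" "x = cvec v" "differential ?F i (cvec v) = cvec 0" by blast
    have "row_mult v (D (Suc (Suc i))) u \<in> level E J (Suc (Suc i) \<le> 1)" for u
      using v differential_cvec[OF v(1)] by (simp add: cvec_eq_iff level_def)
    from exact_vecs[OF v(1) this] obtain w where w: "w \<in> vecs E (X (Suc (Suc (Suc i))))"
      "\<And>x. v x - row_mult w (D (Suc (Suc (Suc i)))) x \<in> J"
      by (auto simp: level_def)
    then have "x = differential ?F (Suc i) (cvec w)" by (simp add: v(2) differential_cvec cvec_eq_iff)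
    with w(1) show "x \<in> differential ?F (Suc i) ` cvec ` vecs E (X (Suc (Suc (Suc i))))" by blast
  next
    fix x assume "x \<in> differential ?F (Suc i) ` cvec ` vecs E (X (Suc (Suc (Suc i))))"
    then obtain v where v: "v \<in> vecs E (X (Suc (Suc (Suc i))))" "x = cvec (row_mult v (D (Suc (Suc (Suc i)))))"
      by (auto simp: differential_cvec)
    have r: "row_mult v (D (Suc (Suc (Suc i)))) \<in> vecs E (X (Suc (Suc i)))" using row_vecs[OF v(1)] by simp
    with v row_mult_row_mult[OF v(1)] show "x \<in> {x \<in> cvec ` vecs E (X (Suc (Suc i))). differential ?F i x = cvec 0}"
      by (auto simp: differential_cvec level_def cvec_eq_iff)
  qed
  show ?thesis
    unfolding graded_free_resolution_def F carrier_free_module free_module_zero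
    using gl0 gl surj ex0 ex by (simp add: trivial_module_def)
qed

end

section \<open>Tor as the homology of the complex of coefficient vectors\<close>

text \<open>Telescoping identities: a difference of formal sums is expressed through differences
  already known to lie in the kernel of the tensor product.\<close>

lemma regroup:
  fixes a :: "'a::ab_group_add"
  shows "n - v - w = (s - sv - sw) + (sv - v) + (sw - w) - (s - n)"
    and "a - n = (a - b - c) + (b - v) + (c - w) - (n - v - w)"
    and "(y - z) - n = (y - v) - (z - w) - (n - (v - w))"
  by (simp_all add: algebra_simps)

text \<open>The additive extension of \<open>h\<close> to the free abelian group, with values in the
  field.\<close>

definition frag_eval :: "('a \<Rightarrow> 'k::field) \<Rightarrow> ('a \<Rightarrow>\<^sub>0 int) \<Rightarrow> 'k" where
  "frag_eval h z = (\<Sum>p\<in>Poly_Mapping.keys z. of_int (Poly_Mapping.lookup z p) * h p)"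

lemma frag_eval_superset:
  "finite S \<Longrightarrow> Poly_Mapping.keys z \<subseteq> S \<Longrightarrow> frag_eval h z = (\<Sum>p\<in>S. of_int (Poly_Mapping.lookup z p) * h p)"
  unfolding frag_eval_def by (rule sum.mono_neutral_left) (auto simp: in_keys_iff)

lemma frag_eval_add: "frag_eval h (y + z) = frag_eval h y + frag_eval h z"
proof -
  let ?S = "Poly_Mapping.keys y \<union> Poly_Mapping.keys z"
  have "frag_eval h (y + z) = (\<Sum>p\<in>?S. of_int (Poly_Mapping.lookup (y + z) p) * h p)"
    using Poly_Mapping.keys_add[of y z] by (intro frag_eval_superset) auto
  also have "\<dots> = frag_eval h y + frag_eval h z"
    by (simp add: frag_eval_superset[of ?S] lookup_add ring_distribs sum.distrib)
  finally show ?thesis .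
qed

lemma frag_eval_zero [simp]: "frag_eval h 0 = 0"
  by (simp add: frag_eval_def)

lemma frag_eval_diff: "frag_eval h (y - z) = frag_eval h y - frag_eval h z"
  using frag_eval_add[of h "y - z" z] by simp

lemma frag_eval_uminus: "frag_eval h (- z) = - frag_eval h z"
  using frag_eval_diff[of h 0 z] by simp

lemma frag_eval_frag_of [simp]: "frag_eval h (frag_of p) = h p"
  by (simp add: frag_eval_def)

lemma frag_eval_sum: "frag_eval h (sum f A) = (\<Sum>i\<in>A. frag_eval h (f i))"
  by (induction A rule: infinite_finite_induct) (simp_all add: frag_eval_add)

text \<open>The model of k \<otimes> P for P free on \<open>X\<close>.\<close>

definition kvecs :: "nat set \<Rightarrow> (nat \<Rightarrow> 'k::field) set" where
  "kvecs X = {w. finite {x. w x \<noteq> 0} \<and> {x. w x \<noteq> 0} \<subseteq> X}"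

lemma kvecsD: "w \<in> kvecs X \<Longrightarrow> finite {x. w x \<noteq> 0}" "w \<in> kvecs X \<Longrightarrow> {x. w x \<noteq> 0} \<subseteq> X"
  by (simp_all add: kvecs_def)

lemma zero_in_kvecs [simp]: "0 \<in> kvecs X" by (simp add: kvecs_def)

lemma kvecs_subsetI: "finite S \<Longrightarrow> S \<subseteq> X \<Longrightarrow> {x. w x \<noteq> 0} \<subseteq> S \<Longrightarrow> w \<in> kvecs X"
  unfolding kvecs_def by (auto intro: finite_subset)

lemma add_in_kvecs: "v \<in> kvecs X \<Longrightarrow> w \<in> kvecs X \<Longrightarrow> v + w \<in> kvecs X"
  by (rule kvecs_subsetI[of "{x. v x \<noteq> 0} \<union> {x. w x \<noteq> 0}"]) (auto simp: kvecs_def)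

lemma diff_in_kvecs: "v \<in> kvecs X \<Longrightarrow> w \<in> kvecs X \<Longrightarrow> v - w \<in> kvecs X"
  by (rule kvecs_subsetI[of "{x. v x \<noteq> 0} \<union> {x. w x \<noteq> 0}"]) (auto simp: kvecs_def)

lemma svec_in_kvecs: "x \<in> X \<Longrightarrow> svec x c \<in> kvecs X"
  unfolding kvecs_def svec_def by (auto intro: finite_subset[of _ "{x}"])

type_synonym ('v, 'k) tfrag = "'k \<times> (nat \<Rightarrow> ('v, 'k) tens set) \<Rightarrow>\<^sub>0 int"

section \<open>The tensor product of \<open>k\<close> with a free module\<close>

context positive_graded_ideal
begin

text \<open>The isomorphism from k \<otimes> P to coefficient vectors, on representatives: the pair
  of \<open>c\<close> and \<open>f\<close> goes to the family of the
  \<open>c * augmentation (f x)\<close>.\<close>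

definition coeffs :: "('v, 'k) tfrag \<Rightarrow> nat \<Rightarrow> 'k" where
  "coeffs z = (\<lambda>x. frag_eval (\<lambda>(c, f). c * augmentation (f x)) z)"

text \<open>The inverse of \<open>coeffs\<close> modulo the relations; \<open>svec x 1\<close> is
  the generator with index \<open>x\<close>.\<close>

definition normal_form :: "(nat \<Rightarrow> 'k) \<Rightarrow> ('v, 'k) tfrag" where
  "normal_form w = (\<Sum>x | w x \<noteq> 0. frag_of (w x, cvec (svec x 1)))"

abbreviation "free_group X \<equiv> free_Abelian_group (UNIV \<times> carrier (free_module B X)) ::
  ('v, 'k) tfrag monoid"

abbreviation "ker X \<equiv> tensor_kernel B trivial_module (free_module B X) ::
  ('v, 'k) tfrag set"

abbreviation "rels X \<equiv> tensor_relations B trivial_module (free_module B X) ::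
  ('v, 'k) tfrag set"

lemma trivial_module_simps [simp]:
  "carrier (trivial_module :: (('v, 'k) tens set, 'k) module) = UNIV"
  "x \<oplus>\<^bsub>(trivial_module :: (('v, 'k) tens set, 'k) module)\<^esub> y = x + y"
  "r \<odot>\<^bsub>trivial_module\<^esub> c = augmentation r * c" for r :: "('v, 'k) tens set" and c :: 'k
  by (simp_all add: trivial_module_def)

lemma coeffs_add: "coeffs (y + z) = coeffs y + coeffs z"
  and coeffs_diff: "coeffs (y - z) = coeffs y - coeffs z"
  and coeffs_zero: "coeffs 0 = 0"
  and coeffs_uminus: "coeffs (- z) = - coeffs z"
  by (simp_all add: coeffs_def frag_eval_add frag_eval_diff frag_eval_uminus fun_eq_iff)

lemma coeffs_frag_of: "coeffs (frag_of (c, cvec v)) = (\<lambda>x. c * Poly_Mapping.lookup (v x) 0)"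
  by (simp add: coeffs_def cvec_def)

lemma free_group_keys: "z \<in> carrier (free_group X) \<longleftrightarrow> Poly_Mapping.keys z \<subseteq> UNIV \<times> cvec ` vecs E X"
  by (simp add: carrier_free_module)

lemma free_group_diff: "y \<in> carrier (free_group X) \<Longrightarrow> z \<in> carrier (free_group X) \<Longrightarrow> y - z \<in> carrier (free_group X)"
  using keys_diff[of y z] by auto

lemma rels_cases:
  assumes "z \<in> rels X"
  obtains c c' v where "v \<in> vecs E X" "z = frag_of (c + c', cvec v) - frag_of (c, cvec v) - frag_of (c', cvec v)"
  | c v w where "v \<in> vecs E X" "w \<in> vecs E X" "z = frag_of (c, cvec (v + w)) - frag_of (c, cvec v) - frag_of (c, cvec w)"
  | c t v where "v \<in> vecs E X" "t \<in> tens_carrier E"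
      "z = frag_of (Poly_Mapping.lookup t 0 * c, cvec v) - frag_of (c, cvec (\<lambda>x. t * v x))"
proof -
  let ?add = "\<lambda>f g. f \<oplus>\<^bsub>free_module B X\<^esub> g" and ?smult = "\<lambda>r f. r \<odot>\<^bsub>free_module B X\<^esub> f"
  show thesis
    using assms unfolding tensor_relations_def carrier_free_module carrier_B trivial_module_simps
  proof (elim UnE CollectE exE conjE)
    fix c c' f assume f: "f \<in> cvec ` vecs E X" and z: "z = frag_of (c + c', f) - frag_of (c, f) - frag_of (c', f)"
    from f obtain v where "v \<in> vecs E X" "f = cvec v" by blast
    with that(1)[of v c c'] z show thesis by simp
  next
    fix c f g assume fg: "f \<in> cvec ` vecs E X" "g \<in> cvec ` vecs E X"
      and z: "z = frag_of (c, ?add f g) - frag_of (c, f) - frag_of (c, g)"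
    from fg obtain v w where "v \<in> vecs E X" "f = cvec v" "w \<in> vecs E X" "g = cvec w" by blast
    with that(2)[of v w c] z show thesis by (simp add: free_module_add)
  next
    fix r c f assume f: "f \<in> cvec ` vecs E X" and r: "r \<in> cls ` tens_carrier E"
      and z: "z = frag_of (augmentation r * c, f) - frag_of (c, ?smult r f)"
    from f r obtain v t where "v \<in> vecs E X" "f = cvec v" "t \<in> tens_carrier E" "r = cls t" by blast
    with that(3)[of v t c] z show thesis by (simp add: free_module_smult)
  qed
qed

lemma rels_memI:
  assumes v: "v \<in> vecs E X"
  shows "frag_of (c + c', cvec v) - frag_of (c, cvec v) - frag_of (c', cvec v) \<in> rels X"
    and "w \<in> vecs E X \<Longrightarrow> frag_of (c, cvec (v + w)) - frag_of (c, cvec v) - frag_of (c, cvec w) \<in> rels X"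
    and "t \<in> tens_carrier E \<Longrightarrow> frag_of (Poly_Mapping.lookup t 0 * c, cvec v) - frag_of (c, cvec (\<lambda>x. t * v x)) \<in> rels X"
proof -
  let ?P = "free_module B X"
  have v': "cvec v \<in> cvec ` vecs E X" using v by blast
  then show "frag_of (c + c', cvec v) - frag_of (c, cvec v) - frag_of (c', cvec v) \<in> rels X"
    unfolding tensor_relations_def carrier_free_module trivial_module_simps by blast
  show "frag_of (c, cvec (v + w)) - frag_of (c, cvec v) - frag_of (c, cvec w) \<in> rels X" if w: "w \<in> vecs E X"
  proof -
    have "cvec w \<in> cvec ` vecs E X" using w by blast
    with v' have "frag_of (c, cvec v \<oplus>\<^bsub>?P\<^esub> cvec w) - frag_of (c, cvec v) - frag_of (c, cvec w) \<in> rels X"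
      unfolding tensor_relations_def carrier_free_module trivial_module_simps by blast
    then show ?thesis by (simp add: free_module_add[OF v w])
  qed
  show "frag_of (Poly_Mapping.lookup t 0 * c, cvec v) - frag_of (c, cvec (\<lambda>x. t * v x)) \<in> rels X" if t: "t \<in> tens_carrier E"
  proof -
    have "cls t \<in> carrier B" using t by (simp add: carrier_B)
    with v' have "frag_of (augmentation (cls t) * c, cvec v) - frag_of (c, cls t \<odot>\<^bsub>?P\<^esub> cvec v) \<in> rels X"
      unfolding tensor_relations_def carrier_free_module trivial_module_simps by blast
    then show ?thesis by (simp add: free_module_smult[OF v t])
  qed
qed

lemma frag_of_carrier: "v \<in> vecs E X \<Longrightarrow> frag_of (c, cvec v) \<in> carrier (free_group X)"
  by (simp add: cvec_in_free_module)

lemma rels_subset: "rels X \<subseteq> carrier (free_group X)"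
proof
  fix z assume "z \<in> rels X"
  then show "z \<in> carrier (free_group X)"
  proof (cases rule: rels_cases)
    case (1 c c' v)
    show ?thesis unfolding 1(2) by (intro free_group_diff frag_of_carrier 1(1))
  next
    case (2 c v w)
    show ?thesis unfolding 2(3) by (intro free_group_diff frag_of_carrier add_in_vecs 2(1,2))
  next
    case (3 c t v)
    show ?thesis unfolding 3(3) by (intro free_group_diff frag_of_carrier lmult_in_vecs 3(1,2))
  qed
qed

lemma ker_subgroup: "subgroup (ker X) (free_group X)"
  unfolding tensor_kernel_def trivial_module_simps
  using rels_subset by (intro group.generate_is_subgroup) auto

lemma ker_carrier: "z \<in> ker X \<Longrightarrow> z \<in> carrier (free_group X)"
  using subgroup.subset[OF ker_subgroup] by blast

lemma ker_zero: "0 \<in> ker X"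
  using subgroup.one_closed[OF ker_subgroup] by simp

lemma ker_add: "y \<in> ker X \<Longrightarrow> z \<in> ker X \<Longrightarrow> y + z \<in> ker X"
  using subgroup.m_closed[OF ker_subgroup] by simp

lemma ker_uminus: "z \<in> ker X \<Longrightarrow> - z \<in> ker X"
  using subgroup.m_inv_closed[OF ker_subgroup, of z] ker_carrier[of z] by simp

lemma ker_diff: "y \<in> ker X \<Longrightarrow> z \<in> ker X \<Longrightarrow> y - z \<in> ker X"
  using ker_add[of y X "- z"] ker_uminus by simp

lemma ker_sum: "(\<And>i. i \<in> A \<Longrightarrow> f i \<in> ker X) \<Longrightarrow> sum f A \<in> ker X"
  by (induction A rule: infinite_finite_induct) (auto intro: ker_add ker_zero)

lemma rels_ker: "z \<in> rels X \<Longrightarrow> z \<in> ker X"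
  unfolding tensor_kernel_def by (rule generate.incl)

text \<open>The three kinds of relations are sent to \<open>0\<close> by additivity in either
  argument and by multiplicativity of the augmentation.\<close>

lemma coeffs_ker: "z \<in> ker X \<Longrightarrow> coeffs z = 0"
proof -
  have "ker X \<subseteq> {z \<in> carrier (free_group X). coeffs z = 0}"
    unfolding tensor_kernel_def trivial_module_simps
  proof (rule group.generate_subgroup_incl)
    show "rels X \<subseteq> {z \<in> carrier (free_group X). coeffs z = 0}"
    proof
      fix z assume z: "z \<in> rels X"
      then have "coeffs z = 0"
      proof (cases rule: rels_cases)
        case (1 c c' v)
        show ?thesis unfolding 1(2) coeffs_diff coeffs_frag_of by (simp add: fun_eq_iff algebra_simps)
      next
        case (2 c v w)
        show ?thesis unfolding 2(3) coeffs_diff coeffs_frag_of by (simp add: fun_eq_iff lookup_add algebra_simps)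
      next
        case (3 c t v)
        show ?thesis unfolding 3(3) coeffs_diff coeffs_frag_of by (simp add: fun_eq_iff lookup_zero_mult)
      qed
      with z rels_subset show "z \<in> {z \<in> carrier (free_group X). coeffs z = 0}" by blast
    qed
    show "subgroup {z \<in> carrier (free_group X). coeffs z = 0} (free_group X)"
    proof (rule group.subgroupI)
      show "{z \<in> carrier (free_group X). coeffs z = 0} \<noteq> {}" by (auto intro!: exI[of _ 0] simp: coeffs_zero)
      fix y z assume "y \<in> {z \<in> carrier (free_group X). coeffs z = 0}" "z \<in> {z \<in> carrier (free_group X). coeffs z = 0}"
      then show "y \<otimes>\<^bsub>free_group X\<^esub> z \<in> {z \<in> carrier (free_group X). coeffs z = 0}"
        using Poly_Mapping.keys_add[of y z] by (auto simp: coeffs_add)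
    qed (auto simp: coeffs_uminus)
  qed simp
  then show "z \<in> ker X \<Longrightarrow> coeffs z = 0" by blast
qed

lemma unit_vecs: "x \<in> X \<Longrightarrow> svec x 1 \<in> vecs E X"
  by (intro svec_in_vecs) auto

text \<open>The additivity relation for \<open>0 + 0\<close> in the first argument is the negative
  of this generator.\<close>

lemma frag_of_zero_ker:
  assumes "v \<in> vecs E X" shows "frag_of (0, cvec v) \<in> ker X"
  using ker_uminus[OF rels_ker[OF rels_memI(1)[OF assms, of 0 0]]] by simp

text \<open>Additional indices contribute only elementary tensors with first factor
  \<open>0\<close>.\<close>

lemma normal_form_superset:
  assumes "finite S" "{x. w x \<noteq> 0} \<subseteq> S" "S \<subseteq> X"
  shows "(\<Sum>x\<in>S. frag_of (w x, cvec (svec x 1))) - normal_form w \<in> ker X"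
proof -
  have "(\<Sum>x\<in>S. frag_of (w x, cvec (svec x 1))) - normal_form w =
      (\<Sum>x\<in>S - {x. w x \<noteq> 0}. frag_of (w x, cvec (svec x 1)))"
    unfolding normal_form_def using assms(1,2) by (rule sum_diff[symmetric])
  also have "\<dots> \<in> ker X"
  proof (rule ker_sum)
    fix x assume "x \<in> S - {x. w x \<noteq> 0}"
    then have "w x = 0" "x \<in> X" using assms(3) by auto
    then show "frag_of (w x, cvec (svec x 1)) \<in> ker X" using frag_of_zero_ker[OF unit_vecs[of x X]] by simp
  qed
  finally show ?thesis .
qed

lemma normal_form_add:
  assumes "v \<in> kvecs X" "w \<in> kvecs X"
  shows "normal_form (v + w) - normal_form v - normal_form w \<in> ker X"
proof -
  let ?S = "{x. v x \<noteq> 0} \<union> {x. w x \<noteq> 0}"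
  let ?n = "\<lambda>w. \<Sum>x\<in>?S. frag_of (w x, cvec (svec x 1))"
  have S: "finite ?S" "?S \<subseteq> X" using assms by (auto simp: kvecs_def)
  have n: "?n u - normal_form u \<in> ker X" if "{x. u x \<noteq> 0} \<subseteq> ?S" for u
    by (rule normal_form_superset[OF S(1) that S(2)])
  have nv: "?n v - normal_form v \<in> ker X" by (rule n) auto
  have nw: "?n w - normal_form w \<in> ker X" by (rule n) auto
  have nvw: "?n (v + w) - normal_form (v + w) \<in> ker X" by (rule n) auto
  have "?n (v + w) - ?n v - ?n w =
      (\<Sum>x\<in>?S. frag_of (v x + w x, cvec (svec x 1)) - frag_of (v x, cvec (svec x 1)) - frag_of (w x, cvec (svec x 1)))"
    by (simp add: sum_subtractf)
  also have "\<dots> \<in> ker X"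
    using S(2) by (intro ker_sum rels_ker rels_memI unit_vecs) auto
  finally have 0: "?n (v + w) - ?n v - ?n w \<in> ker X" .
  have "normal_form (v + w) - normal_form v - normal_form w =
      (?n (v + w) - ?n v - ?n w) + (?n v - normal_form v) + (?n w - normal_form w) - (?n (v + w) - normal_form (v + w))"
    by (rule regroup(1))
  also have "\<dots> \<in> ker X" by (rule ker_diff[OF ker_add[OF ker_add[OF 0 nv] nw] nvw])
  finally show ?thesis .
qed

lemma normal_form_diff:
  assumes "v \<in> kvecs X" "w \<in> kvecs X"
  shows "normal_form (v - w) - (normal_form v - normal_form w) \<in> ker X"
  using ker_uminus[OF normal_form_add[OF diff_in_kvecs[OF assms] assms(2)]] by (simp add: algebra_simps)

lemma lookup_in_kvecs: "v \<in> vecs E X \<Longrightarrow> (\<lambda>x. c * Poly_Mapping.lookup (v x) 0) \<in> kvecs X"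
  unfolding kvecs_def vecs_def by (auto elim!: finite_subset[rotated]) force

text \<open>A one-entry vector is \<open>t\<close> times a generator, and the balancing relation
  moves \<open>t\<close> over to \<open>k\<close>, where only its constant term remains; sums are
  handled by additivity.\<close>

lemma frag_of_normal_form:
  assumes "v \<in> vecs E X"
  shows "frag_of (c, cvec v) - normal_form (\<lambda>x. c * Poly_Mapping.lookup (v x) 0) \<in> ker X"
  using assms
proof (induction rule: vecs_induct)
  case zero
  have "normal_form (\<lambda>x. c * Poly_Mapping.lookup ((0 :: ('v, 'k) tvec) x) 0) = 0"
    by (simp add: normal_form_def)
  moreover have "frag_of (c, cvec 0) \<in> ker X"
    using ker_uminus[OF rels_ker[OF rels_memI(2)[OF zero_in_vecs[of E X] zero_in_vecs[of E X], of c]]] by simp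
  ultimately have "frag_of (c, cvec 0) - normal_form (\<lambda>x. c * Poly_Mapping.lookup ((0 :: ('v, 'k) tvec) x) 0) \<in> ker X"
    by simp
  then show ?case .
next
  case (add v w)
  let ?l = "\<lambda>v x. c * Poly_Mapping.lookup (v x) 0"
  have "?l (v + w) = ?l v + ?l w" by (simp add: fun_eq_iff lookup_add algebra_simps)
  then have 1: "normal_form (?l (v + w)) - normal_form (?l v) - normal_form (?l w) \<in> ker X"
    using normal_form_add[OF lookup_in_kvecs[OF add(1), of c] lookup_in_kvecs[OF add(2), of c]] by simp
  have 2: "frag_of (c, cvec (v + w)) - frag_of (c, cvec v) - frag_of (c, cvec w) \<in> ker X"
    using add(1,2) by (intro rels_ker rels_memI)
  have "frag_of (c, cvec (v + w)) - normal_form (?l (v + w)) =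
      (frag_of (c, cvec (v + w)) - frag_of (c, cvec v) - frag_of (c, cvec w))
      + (frag_of (c, cvec v) - normal_form (?l v)) + (frag_of (c, cvec w) - normal_form (?l w))
      - (normal_form (?l (v + w)) - normal_form (?l v) - normal_form (?l w))"
    by (rule regroup(2))
  also have "\<dots> \<in> ker X" by (rule ker_diff[OF ker_add[OF ker_add[OF 2 add(3)] add(4)] 1])
  finally show ?case .
next
  case (single x t)
  let ?l = "\<lambda>y. c * Poly_Mapping.lookup (svec x t y) 0"
  have sv: "svec x t = (\<lambda>y. t * svec x 1 y)" by (auto simp: svec_def)
  have 1: "frag_of (Poly_Mapping.lookup t 0 * c, cvec (svec x 1)) - frag_of (c, cvec (svec x t)) \<in> ker X"
    unfolding sv using single by (intro rels_ker rels_memI unit_vecs)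
  have "(\<Sum>y\<in>{x}. frag_of (?l y, cvec (svec y 1))) - normal_form ?l \<in> ker X"
    using single by (intro normal_form_superset) (auto simp: svec_def)
  then have 2: "frag_of (Poly_Mapping.lookup t 0 * c, cvec (svec x 1)) - normal_form ?l \<in> ker X"
    by (simp add: svec_def mult.commute)
  from ker_diff[OF 2 1] show ?case by simp
qed

lemma coeffs_normal_form_ker:
  assumes "z \<in> carrier (free_group X)"
  shows "coeffs z \<in> kvecs X \<and> z - normal_form (coeffs z) \<in> ker X"
proof -
  have "Poly_Mapping.keys z \<subseteq> UNIV \<times> cvec ` vecs E X" using assms by (simp only: free_group_keys)
  then show ?thesis
  proof (induction z rule: frag_induction)
    case zero
    have "0 - normal_form 0 = 0" by (simp add: normal_form_def)
    then show ?case unfolding coeffs_zero using ker_zero by (simp only: zero_in_kvecs simp_thms)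
  next
    case (one p)
    then obtain c v where "p = (c, cvec v)" "v \<in> vecs E X" by blast
    then show ?case using frag_of_normal_form[of v X c] lookup_in_kvecs[of v X c] by (simp add: coeffs_frag_of)
  next
    case (diff y z)
    have "(y - z) - normal_form (coeffs y - coeffs z) = (y - normal_form (coeffs y)) - (z - normal_form (coeffs z))
       - (normal_form (coeffs y - coeffs z) - (normal_form (coeffs y) - normal_form (coeffs z)))"
      by (rule regroup(3))
    also have "\<dots> \<in> ker X"
      using diff by (intro ker_diff[OF ker_diff normal_form_diff]) auto
    finally have "y - z - normal_form (coeffs y - coeffs z) \<in> ker X" .
    moreover have "coeffs y - coeffs z \<in> kvecs X" using diff by (intro diff_in_kvecs) auto
    ultimately show ?case unfolding coeffs_diff by blast
  qed
qed

lemma normal_form_carrier: "w \<in> kvecs X \<Longrightarrow> normal_form w \<in> carrier (free_group X)"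
  unfolding normal_form_def
  by (rule sum_closed_free_Abelian_group)
     (auto simp only: frag_of_in_free_Abelian_group carrier_free_module kvecs_def intro!: imageI unit_vecs SigmaI UNIV_I)

lemma coeffs_normal_form: "w \<in> kvecs X \<Longrightarrow> coeffs (normal_form w) = w"
proof
  fix y assume w: "w \<in> kvecs X"
  have "coeffs (normal_form w) y = (\<Sum>x | w x \<noteq> 0. if x = y then w y else 0)"
    unfolding coeffs_def normal_form_def frag_eval_sum
    by (rule sum.cong) (auto simp: cvec_def svec_def simp flip: single_one)
  then show "coeffs (normal_form w) y = w y" using kvecsD(1)[OF w] by (simp add: sum.delta)
qed

text \<open>An element with zero coefficients is congruent to the normal form of \<open>0\<close>,
  which is \<open>0\<close>. So \<open>coeffs\<close> identifies the tensor product with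
  \<open>kvecs X\<close>.\<close>

lemma ker_iff: "z \<in> carrier (free_group X) \<Longrightarrow> z \<in> ker X \<longleftrightarrow> coeffs z = 0"
  using coeffs_normal_form_ker[of z X] coeffs_ker[of z X] by (auto simp: normal_form_def)


abbreviation "tproduct X \<equiv> tensor_product B trivial_module (free_module B X) ::
  ('v, 'k) tfrag set monoid"

text \<open>A fibre of \<open>coeffs\<close>, hence a coset of the kernel: elements of the tensor
  product are named by their coefficient vectors.\<close>

definition coset :: "nat set \<Rightarrow> (nat \<Rightarrow> 'k) \<Rightarrow> ('v, 'k) tfrag set" where
  "coset X w = {z \<in> carrier (free_group X). coeffs z = w}"

lemma ker_coset:
  assumes z: "z \<in> carrier (free_group X)"
  shows "ker X #>\<^bsub>free_group X\<^esub> z = coset X (coeffs z)"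
proof (intro equalityI subsetI)
  fix y assume "y \<in> ker X #>\<^bsub>free_group X\<^esub> z"
  then obtain k where k: "k \<in> ker X" "y = k + z" by (auto simp: r_coset_def)
  then have "y \<in> carrier (free_group X)"
    using z ker_carrier[OF k(1)] Poly_Mapping.keys_add[of k z] by auto
  with k show "y \<in> coset X (coeffs z)" by (simp add: coset_def coeffs_add coeffs_ker)
next
  fix y assume "y \<in> coset X (coeffs z)"
  then have y: "y \<in> carrier (free_group X)" "coeffs y = coeffs z" by (auto simp: coset_def)
  have "y - z \<in> ker X"
    using y by (subst ker_iff[OF free_group_diff[OF y(1) z]]) (simp add: coeffs_diff)
  then show "y \<in> ker X #>\<^bsub>free_group X\<^esub> z"
    by (auto simp: r_coset_def intro!: bexI[of _ "y - z"])
qed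

lemma coset_zero: "coset X 0 = ker X"
proof (intro equalityI subsetI)
  fix z assume "z \<in> coset X 0"
  then have "z \<in> carrier (free_group X)" "coeffs z = 0" by (simp_all only: coset_def mem_Collect_eq)
  then show "z \<in> ker X" by (simp only: ker_iff)
next
  fix z assume "z \<in> ker X"
  with ker_carrier[OF this] coeffs_ker[OF this] show "z \<in> coset X 0" by (simp only: coset_def mem_Collect_eq)
qed

lemma coset_nonempty: "w \<in> kvecs X \<Longrightarrow> normal_form w \<in> coset X w"
  unfolding coset_def using normal_form_carrier coeffs_normal_form by blast

lemma coset_inj: "inj_on (coset X) (kvecs X)"
proof (rule inj_onI)
  fix v w assume "v \<in> kvecs X" "w \<in> kvecs X" "coset X v = coset X w"
  then have "normal_form v \<in> coset X w" using coset_nonempty by blast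
  then show "v = w" using coeffs_normal_form[OF \<open>v \<in> kvecs X\<close>] by (simp add: coset_def)
qed

lemma tproduct_carrier: "carrier (tproduct X) = coset X ` kvecs X"
proof -
  have "carrier (tproduct X) = (\<lambda>z. ker X #>\<^bsub>free_group X\<^esub> z) ` carrier (free_group X)"
    by (auto simp: tensor_product_def FactGroup_def RCOSETS_def)
  also have "\<dots> = (\<lambda>z. coset X (coeffs z)) ` carrier (free_group X)"
    by (rule image_cong) (simp_all only: ker_coset)
  also have "\<dots> = coset X ` kvecs X"
  proof (intro equalityI subsetI)
    fix Z assume "Z \<in> (\<lambda>z. coset X (coeffs z)) ` carrier (free_group X)"
    then show "Z \<in> coset X ` kvecs X" using coeffs_normal_form_ker by blast
  next
    fix Z assume "Z \<in> coset X ` kvecs X"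
    then obtain w where "w \<in> kvecs X" "Z = coset X w" by blast
    then have "Z = coset X (coeffs (normal_form w))" by (simp only: coeffs_normal_form)
    moreover have "normal_form w \<in> carrier (free_group X)"
      using \<open>w \<in> kvecs X\<close> by (rule normal_form_carrier)
    ultimately show "Z \<in> (\<lambda>z. coset X (coeffs z)) ` carrier (free_group X)" by blast
  qed
  finally show ?thesis .
qed

lemma coset_set_mult:
  assumes v: "v \<in> kvecs X"
  shows "coset X v <#>\<^bsub>free_group X\<^esub> coset X w = coset X (v + w)"
proof (intro equalityI subsetI)
  fix z assume "z \<in> coset X v <#>\<^bsub>free_group X\<^esub> coset X w"
  then obtain x y where xy: "x \<in> coset X v" "y \<in> coset X w" "z = x + y" by (auto simp: set_mult_def)
  then show "z \<in> coset X (v + w)"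
    using Poly_Mapping.keys_add[of x y] by (auto simp: coset_def coeffs_add)
next
  fix z assume z: "z \<in> coset X (v + w)"
  have "z - normal_form v \<in> coset X w"
    using z free_group_diff[OF _ normal_form_carrier[OF v], of z] by (simp only: coset_def mem_Collect_eq coeffs_diff coeffs_normal_form[OF v] add_diff_cancel_left' simp_thms)
  then show "z \<in> coset X v <#>\<^bsub>free_group X\<^esub> coset X w"
    unfolding set_mult_def by (intro UN_I[OF coset_nonempty[OF v]] UN_I[of "z - normal_form v"]) simp_all
qed

lemma tproduct_mult: "v \<in> kvecs X \<Longrightarrow> coset X v \<otimes>\<^bsub>tproduct X\<^esub> coset X w = coset X (v + w)"
  using coset_set_mult[of v X w] by (simp add: tensor_product_def FactGroup_def)

lemma tproduct_one: "\<one>\<^bsub>tproduct X\<^esub> = coset X 0"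
  by (simp add: tensor_product_def FactGroup_def coset_zero)

lemma tproduct_group: "Group.group (tproduct X)"
  unfolding tensor_product_def trivial_module_simps
  using comm_group.subgroup_imp_normal[OF abelian_free_Abelian_group ker_subgroup]
  by (rule normal.factorgroup_is_group)

lemma tensor_elem_coset:
  assumes "v \<in> vecs E X"
  shows "tensor_elem B trivial_module (free_module B X) c (cvec v) = coset X (\<lambda>x. c * Poly_Mapping.lookup (v x) 0)"
  using ker_coset[OF frag_of_carrier[OF assms, of c]]
  unfolding tensor_elem_def trivial_module_simps coeffs_frag_of .

lemma uminus_in_kvecs: "w \<in> kvecs X \<Longrightarrow> - w \<in> kvecs X"
  by (simp add: kvecs_def)

text \<open>As \<open>k\<close> lies in degree \<open>0\<close>, an elementary tensor of degree
  \<open>n\<close> has a nonzero coefficient only at generators of degree exactly \<open>n\<close>.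
  Conversely, such a vector is a sum of one-entry vectors, each of which names an elementary
  tensor.\<close>

lemma tensor_component_coset:
  "tensor_component B trivial_module trivial_component (free_module B X) (free_component B BC X dg) n
    = coset X ` {w \<in> kvecs X. \<forall>x. w x \<noteq> 0 \<longrightarrow> dg x = n}" (is "?C = coset X ` ?W")
proof
  let ?S = "{tensor_elem B trivial_module (free_module B X) x y | i j x y. i + j = n \<and>
    x \<in> trivial_component i \<and> y \<in> free_component B BC X dg j}"
  have C: "?C = generate (tproduct X) ?S" by (simp add: tensor_component_def)
  have "subgroup (coset X ` ?W) (tproduct X)"
  proof (rule group.subgroupI[OF tproduct_group])
    show "coset X ` ?W \<subseteq> carrier (tproduct X)" by (auto simp: tproduct_carrier)
    have "0 \<in> ?W" by simp
    then show "coset X ` ?W \<noteq> {}" by blast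
  next
    fix Z assume "Z \<in> coset X ` ?W"
    then obtain w where w: "w \<in> ?W" "Z = coset X w" by blast
    have "inv\<^bsub>tproduct X\<^esub> Z = coset X (- w)"
      using w uminus_in_kvecs[of w X]
      by (intro group.inv_equality[OF tproduct_group]) (auto simp: tproduct_carrier tproduct_mult tproduct_one)
    moreover have "- w \<in> ?W" using w uminus_in_kvecs[of w X] by auto
    ultimately show "inv\<^bsub>tproduct X\<^esub> Z \<in> coset X ` ?W" by blast
  next
    fix Y Z assume "Y \<in> coset X ` ?W" "Z \<in> coset X ` ?W"
    then obtain v w where vw: "v \<in> ?W" "Y = coset X v" "w \<in> ?W" "Z = coset X w" by blast
    have "v + w \<in> ?W"
    proof -
      have "dg x = n" if "v x + w x \<noteq> 0" for x using vw that by (cases "v x = 0") auto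
      then show ?thesis using vw add_in_kvecs[of v X w] by simp
    qed
    moreover have "Y \<otimes>\<^bsub>tproduct X\<^esub> Z = coset X (v + w)" using vw by (simp add: tproduct_mult)
    ultimately show "Y \<otimes>\<^bsub>tproduct X\<^esub> Z \<in> coset X ` ?W" by blast
  qed
  moreover have "?S \<subseteq> coset X ` ?W"
  proof
    fix Z assume "Z \<in> ?S"
    then obtain i j c v where ij: "i + j = n" "c \<in> trivial_component i" "v \<in> hvecs E X dg j"
      "Z = tensor_elem B trivial_module (free_module B X) c (cvec v)"
      unfolding free_component_eq by blast
    let ?w = "\<lambda>x. c * Poly_Mapping.lookup (v x) 0"
    have "dg x = n" if "?w x \<noteq> 0" for x
    proof -
      have "i = 0" using that ij(2) by (auto simp: trivial_component_def split: if_splits)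
      moreover have "v x \<noteq> 0" using that by auto
      then have "dg x \<le> j" using hvecsD(5)[OF ij(3)] by blast
      moreover have "j - dg x = 0"
        using that lookup_zero_tpow[OF hvecsD(3)[OF ij(3)], of x] by (cases "j - dg x") auto
      ultimately show ?thesis using ij(1) by simp
    qed
    moreover have "?w \<in> kvecs X" using hvecs_subset_vecs[OF ij(3)] by (rule lookup_in_kvecs)
    ultimately have "?w \<in> ?W" by blast
    then show "Z \<in> coset X ` ?W"
      unfolding ij(4) tensor_elem_coset[OF hvecs_subset_vecs[OF ij(3)]] by blast
  qed
  ultimately show "?C \<subseteq> coset X ` ?W"
    unfolding C by (intro group.generate_subgroup_incl[OF tproduct_group])
  show "coset X ` ?W \<subseteq> ?C"
  proof -
    have one: "coset X (svec x c) \<in> ?S" if "x \<in> X" "dg x = n" for x c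
    proof -
      have "svec x 1 \<in> hvecs E X dg n" using that by (intro svec_in_hvecs) (auto intro: one_in_tpow)
      moreover have "(\<lambda>y. c * Poly_Mapping.lookup (svec x (1 :: ('v, 'k) tens) y) 0) = svec x c"
        by (auto simp: svec_def simp flip: single_one)
      then have "coset X (svec x c) = tensor_elem B trivial_module (free_module B X) c (cvec (svec x 1))"
        using tensor_elem_coset[OF unit_vecs[OF that(1)], of c] by simp
      moreover have "c \<in> trivial_component 0" by (simp add: trivial_component_def)
      ultimately show ?thesis unfolding free_component_eq
        by (intro CollectI exI[of _ "0::nat"] exI[of _ n] exI[of _ c] exI[of _ "cvec (svec x 1)"] conjI imageI) simp_all
    qed
    have "\<forall>w. w \<in> ?W \<and> {x. w x \<noteq> 0} \<subseteq> S \<longrightarrow> coset X w \<in> ?C" if "finite S" for S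
      using that
    proof (induction S)
      case empty
      have "w = 0" if "{x. w x \<noteq> 0} \<subseteq> {}" for w :: "nat \<Rightarrow> 'k" using that by (auto simp: fun_eq_iff)
      moreover have "coset X 0 \<in> ?C" unfolding C tproduct_one[symmetric] by (rule generate.one)
      ultimately show ?case by blast
    next
      case (insert x S)
      show ?case
      proof (intro allI impI)
        fix w :: "nat \<Rightarrow> 'k" assume w: "w \<in> ?W \<and> {x. w x \<noteq> 0} \<subseteq> insert x S"
        show "coset X w \<in> ?C"
        proof (cases "w x = 0")
          case True
          then have "{x. w x \<noteq> 0} \<subseteq> S" using w by auto
          with w insert.IH show ?thesis by blast
        next
          case False
          then have x: "x \<in> X" "dg x = n" using w by (auto simp: kvecs_def)
          let ?d = "w - svec x (w x)"
          have d: "?d \<in> kvecs X" using w x(1) by (intro diff_in_kvecs svec_in_kvecs) auto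
          moreover have "dg y = n" if "?d y \<noteq> 0" for y using that w by (auto simp: svec_def split: if_splits)
          ultimately have "?d \<in> ?W" by blast
          moreover have "{y. ?d y \<noteq> 0} \<subseteq> S" using w by (auto simp: svec_def)
          ultimately have "coset X ?d \<in> ?C" using insert.IH by blast
          moreover have "coset X (svec x (w x)) \<in> ?C" unfolding C using one[OF x] by (rule generate.incl)
          ultimately have "coset X ?d \<otimes>\<^bsub>tproduct X\<^esub> coset X (svec x (w x)) \<in> ?C"
            unfolding C by (rule generate.eng)
          then show ?thesis using d by (simp add: tproduct_mult)
        qed
      qed
    qed
    then show ?thesis by (auto simp: kvecs_def)
  qed
qed

text \<open>The matrix over \<open>k\<close> of the differential tensored with
  \<open>k\<close>.\<close>

definition residue_matrix :: "(nat \<Rightarrow> ('v, 'k) tvec) \<Rightarrow> nat \<Rightarrow> nat \<Rightarrow> 'k" where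
  "residue_matrix D = (\<lambda>x u. Poly_Mapping.lookup (D x u) 0)"

lemma lookup_row_mult:
  assumes "v \<in> vecs E X"
  shows "Poly_Mapping.lookup (row_mult v D u) 0 = row_mult (\<lambda>x. Poly_Mapping.lookup (v x) 0) (residue_matrix D) u"
proof -
  have "row_mult (\<lambda>x. Poly_Mapping.lookup (v x) 0) (residue_matrix D) u =
      (\<Sum>x | v x \<noteq> 0. Poly_Mapping.lookup (v x) 0 * residue_matrix D x u)"
    using vecsD(1)[OF assms] by (intro row_mult_superset) auto
  then show ?thesis by (simp add: row_mult_def lookup_sum lookup_zero_mult residue_matrix_def)
qed

text \<open>Representatives of one coset all end in one fibre, so the union in
  \<open>tensor_map\<close> collapses to it. The effect on coefficients is additive and is checked
  on generators of the free abelian group, whose factor \<open>c\<close> is absorbed into the vector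
  as a constant tensor.\<close>

lemma tensor_map_coset:
  assumes gl: "\<And>v. v \<in> vecs E X \<Longrightarrow> f (cvec v) = cvec (row_mult v D)"
    and D: "\<And>x. x \<in> X \<Longrightarrow> D x \<in> vecs E Y" and w: "w \<in> kvecs X"
  shows "tensor_map B trivial_module (free_module B Y) f (coset X w) = coset Y (row_mult w (residue_matrix D))"
proof -
  let ?e = "frag_extend (\<lambda>(c :: 'k, y). frag_of (c, f y))"
  have e: "?e z \<in> carrier (free_group Y) \<and> coeffs (?e z) = row_mult (coeffs z) (residue_matrix D) \<and> coeffs z \<in> kvecs X"
    if "z \<in> carrier (free_group X)" for z
  proof -
    have "Poly_Mapping.keys z \<subseteq> UNIV \<times> cvec ` vecs E X" using that by (simp only: free_group_keys)
    then show ?thesis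
    proof (induction z rule: frag_induction)
      case zero
      have "0 \<in> carrier (free_group Y)" "row_mult 0 (residue_matrix D) = 0" by simp_all
      then show ?case unfolding frag_extend_0 coeffs_zero using zero_in_kvecs by metis
    next
      case (one p)
      then obtain c v where p: "p = (c, cvec v)" and v: "v \<in> vecs E X" by blast
      have cv: "(\<lambda>x. Poly_Mapping.single 0 c * v x) \<in> vecs E X" using v by (intro lmult_in_vecs) auto
      have "coeffs (?e (frag_of p)) u = row_mult (coeffs (frag_of p)) (residue_matrix D) u" for u
      proof -
        have "coeffs (?e (frag_of p)) u = c * Poly_Mapping.lookup (row_mult v D u) 0"
          by (simp add: p gl[OF v] coeffs_frag_of)
        also have "\<dots> = Poly_Mapping.lookup (row_mult (\<lambda>x. Poly_Mapping.single 0 c * v x) D u) 0"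
          by (simp add: row_mult_lmult[OF vecsD(1)[OF v]] lookup_zero_mult)
        also have "\<dots> = row_mult (coeffs (frag_of p)) (residue_matrix D) u"
          by (simp add: lookup_row_mult[OF cv] p coeffs_frag_of lookup_zero_mult)
        finally show ?thesis .
      qed
      moreover have "?e (frag_of p) \<in> carrier (free_group Y)"
        using frag_of_carrier[OF row_mult_in_vecs[of v E X D Y], of c] v D by (simp add: p gl[OF v])
      moreover have "coeffs (frag_of p) \<in> kvecs X" using v by (simp add: p coeffs_frag_of lookup_in_kvecs)
      ultimately show ?case by blast
    next
      case (diff y z)
      then show ?case
        by (auto simp only: frag_extend_diff coeffs_diff row_mult_diff kvecsD(1) intro!: free_group_diff diff_in_kvecs)
    qed
  qed
  have ew: "?e z \<in> coset Y (row_mult w (residue_matrix D))" if "z \<in> coset X w" for z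
    using e[of z] that by (simp only: coset_def mem_Collect_eq)
  have "tensor_map B trivial_module (free_module B Y) f (coset X w) = (\<Union>z\<in>coset X w. ker Y #>\<^bsub>free_group Y\<^esub> ?e z)"
    by (auto simp: tensor_map_def set_mult_def r_coset_def)
  also have "\<dots> = (\<Union>z\<in>coset X w. coset Y (row_mult w (residue_matrix D)))"
  proof (rule SUP_cong[OF refl])
    fix z assume "z \<in> coset X w"
    from ew[OF this] show "ker Y #>\<^bsub>free_group Y\<^esub> ?e z = coset Y (row_mult w (residue_matrix D))"
      using ker_coset[of "?e z" Y] by (simp only: coset_def[of Y "row_mult w (residue_matrix D)"] mem_Collect_eq)
  qed
  also have "\<dots> = coset Y (row_mult w (residue_matrix D))" using coset_nonempty[OF w] by blast
  finally show ?thesis .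
qed

end

section \<open>Coefficient vectors and their lifts to constant tensors\<close>

context positive_graded_ideal
begin

definition constants :: "(nat \<Rightarrow> 'k) \<Rightarrow> nat \<Rightarrow> ('v, 'k) tens" where
  "constants w = (\<lambda>x. Poly_Mapping.single 0 (w x))"

lemma lookup_constants [simp]: "Poly_Mapping.lookup (constants w x) 0 = w x"
  by (simp add: constants_def)

lemma constants_eq_0_iff [simp]: "constants w x = 0 \<longleftrightarrow> w x = 0"
  by (metis constants_def lookup_constants Poly_Mapping.lookup_zero single_zero)

lemma constants_in_carrier [simp]: "constants w x \<in> tens_carrier E"
  by (simp add: constants_def)

lemma constants_in_tpow: "constants w x \<in> tpow E 0"
  by (simp add: constants_def single_zero_in_tpow)

lemma constants_in_vecs: "w \<in> kvecs X \<Longrightarrow> constants w \<in> vecs E X"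
  by (auto simp: vecs_def kvecs_def)

lemma lookup_vecs_in_kvecs: "v \<in> vecs E X \<Longrightarrow> (\<lambda>x. Poly_Mapping.lookup (v x) 0) \<in> kvecs X"
  using lookup_in_kvecs[of v X 1] by simp

lemma row_mult_residue:
  "w \<in> kvecs X \<Longrightarrow> row_mult w (residue_matrix D) = (\<lambda>u. Poly_Mapping.lookup (row_mult (constants w) D u) 0)"
  using lookup_row_mult[OF constants_in_vecs, of w X D] by (simp add: fun_eq_iff)

lemma row_mult_residue_in_kvecs:
  assumes "w \<in> kvecs X" "\<And>x. x \<in> X \<Longrightarrow> D x \<in> vecs E Y"
  shows "row_mult w (residue_matrix D) \<in> kvecs Y"
  unfolding row_mult_residue[OF assms(1)]
  by (intro lookup_vecs_in_kvecs row_mult_in_vecs[OF constants_in_vecs[OF assms(1)]] assms(2))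

end

definition degree_part :: "(nat \<Rightarrow> nat) \<Rightarrow> nat \<Rightarrow> (nat \<Rightarrow> 'k::field) \<Rightarrow> nat \<Rightarrow> 'k" where
  "degree_part dg n w = (\<lambda>x. if dg x = n then w x else 0)"

lemma degree_part_in_kvecs: "w \<in> kvecs X \<Longrightarrow> degree_part dg n w \<in> kvecs X"
  by (rule kvecs_subsetI[of "{x. w x \<noteq> 0}"]) (auto simp: kvecs_def degree_part_def)

lemma degree_part_diff: "degree_part dg n (v - w) = degree_part dg n v - degree_part dg n w"
  by (simp add: degree_part_def fun_eq_iff)

lemma degree_part_add: "degree_part dg n (v + w) = degree_part dg n v + degree_part dg n w"
  by (simp add: degree_part_def fun_eq_iff)

lemma degree_part_homogeneous:
  "\<forall>x. w x \<noteq> 0 \<longrightarrow> dg x = m \<Longrightarrow> degree_part dg n w = (if n = m then w else 0)"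
  by (auto simp: degree_part_def fun_eq_iff)

lemma degree_part_sum:
  assumes "w \<in> kvecs X"
  shows "w = (\<Sum>n\<in>dg ` {x. w x \<noteq> 0}. degree_part dg n w)"
proof
  fix x
  have "(\<Sum>n\<in>dg ` {x. w x \<noteq> 0}. degree_part dg n w) x = (\<Sum>n\<in>dg ` {x. w x \<noteq> 0}. if dg x = n then w x else 0)"
    by (simp add: sum_fun_apply degree_part_def)
  also have "\<dots> = w x" using kvecsD(1)[OF assms] by (auto simp: sum.delta)
  finally show "w x = (\<Sum>n\<in>dg ` {x. w x \<noteq> 0}. degree_part dg n w) x" by simp
qed

section \<open>Homology of the residue complex and its grading\<close>

context matrix_resolution
begin

definition cycles :: "nat \<Rightarrow> (nat \<Rightarrow> 'k) set" where
  "cycles q = {w \<in> kvecs (X q). row_mult w (residue_matrix (D q)) = 0}"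

definition boundaries :: "nat \<Rightarrow> (nat \<Rightarrow> 'k) set" where
  "boundaries q = (\<lambda>w. row_mult w (residue_matrix (D (Suc q)))) ` kvecs (X (Suc q))"

lemma residue_in_kvecs: "w \<in> kvecs (X q) \<Longrightarrow> row_mult w (residue_matrix (D q)) \<in> kvecs (X (q - 1))"
  by (erule row_mult_residue_in_kvecs) (rule D_vecs)

text \<open>Entries of a composite of two differentials lie in \<open>J\<close> or in the
  augmentation ideal, and neither contains a nonzero constant term.\<close>

lemma boundaries_subset_cycles: "boundaries q \<subseteq> cycles q"
proof
  fix w assume "w \<in> boundaries q"
  then obtain v where v: "v \<in> kvecs (X (Suc q))" "w = row_mult v (residue_matrix (D (Suc q)))"
    by (auto simp: boundaries_def)
  have w: "w \<in> kvecs (X q)" using residue_in_kvecs[OF v(1)] v(2) by simp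
  note cv = constants_in_vecs[OF v(1)]
  have r: "row_mult (constants v) (D (Suc q)) \<in> vecs E (X q)"
    using cv D_vecs[of _ "Suc q"] by (intro row_mult_in_vecs) auto
  have "row_mult w (residue_matrix (D q)) u = 0" for u
  proof -
    have "row_mult w (residue_matrix (D q)) u = Poly_Mapping.lookup (row_mult (row_mult (constants v) (D (Suc q))) (D q) u) 0"
      by (simp add: v(2) row_mult_residue[OF v(1)] lookup_row_mult[OF r])
    also have "\<dots> = 0"
      using row_mult_row_mult[OF cv, of u] J_aug by (auto simp: level_def aug_ideal_def split: if_splits)
    finally show ?thesis .
  qed
  with w show "w \<in> cycles q" by (simp add: cycles_def fun_eq_iff)
qed

lemma cycles_kvecs: "w \<in> cycles q \<Longrightarrow> w \<in> kvecs (X q)"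
  by (simp add: cycles_def)

lemma boundaries_kvecs: "w \<in> boundaries q \<Longrightarrow> w \<in> kvecs (X q)"
  using boundaries_subset_cycles cycles_kvecs by blast

lemma cycles_diff: "v \<in> cycles q \<Longrightarrow> w \<in> cycles q \<Longrightarrow> v - w \<in> cycles q"
proof -
  assume vw: "v \<in> cycles q" "w \<in> cycles q"
  then have "row_mult (v - w) (residue_matrix (D q)) = row_mult v (residue_matrix (D q)) - row_mult w (residue_matrix (D q))"
    by (intro row_mult_diff kvecsD(1)[OF cycles_kvecs])
  with vw show ?thesis by (simp add: cycles_def diff_in_kvecs)
qed

lemma boundaries_diff: "v \<in> boundaries q \<Longrightarrow> w \<in> boundaries q \<Longrightarrow> v - w \<in> boundaries q"
proof -
  assume "v \<in> boundaries q" "w \<in> boundaries q"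
  then obtain x y where xy: "x \<in> kvecs (X (Suc q))" "v = row_mult x (residue_matrix (D (Suc q)))"
    "y \<in> kvecs (X (Suc q))" "w = row_mult y (residue_matrix (D (Suc q)))" by (auto simp: boundaries_def)
  have "v - w = row_mult (x - y) (residue_matrix (D (Suc q)))"
    unfolding xy(2,4) by (rule row_mult_diff[symmetric, OF kvecsD(1)[OF xy(1)] kvecsD(1)[OF xy(3)]])
  then show ?thesis unfolding boundaries_def using diff_in_kvecs[OF xy(1,3)] by blast
qed

lemma boundaries_zero: "0 \<in> boundaries q"
proof -
  have "row_mult 0 (residue_matrix (D (Suc q))) \<in> boundaries q"
    unfolding boundaries_def by (intro imageI zero_in_kvecs)
  then show ?thesis by (simp only: row_mult_zero_left)
qed

lemma cycles_zero: "0 \<in> cycles q"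
  using boundaries_zero boundaries_subset_cycles by blast

lemma boundaries_add: "v \<in> boundaries q \<Longrightarrow> w \<in> boundaries q \<Longrightarrow> v + w \<in> boundaries q"
  using boundaries_diff[of v q "0 - w"] boundaries_diff[OF boundaries_zero, of w q] by simp

lemma cycles_add: "v \<in> cycles q \<Longrightarrow> w \<in> cycles q \<Longrightarrow> v + w \<in> cycles q"
  using cycles_diff[of v q "0 - w"] cycles_diff[OF cycles_zero, of w q] by simp

lemma boundaries_sum: "(\<And>i. i \<in> A \<Longrightarrow> f i \<in> boundaries q) \<Longrightarrow> sum f A \<in> boundaries q"
  by (induction A rule: infinite_finite_induct) (auto intro: boundaries_add boundaries_zero)

text \<open>A homogeneous entry with nonzero constant term has degree \<open>0\<close>, so it links
  generators of equal degree. Hence the residue complex splits into parts of single degrees.\<close>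

lemma residue_homogeneous:
  assumes "x \<in> X q" "residue_matrix (D q) x u \<noteq> 0"
  shows "dg q x = dg (q - 1) u"
proof -
  note Dx = D_hvecs[OF assms(1)]
  have nz: "Poly_Mapping.lookup (D q x u) 0 \<noteq> 0" using assms(2) by (simp add: residue_matrix_def)
  then have "D q x u \<noteq> 0" by auto
  then have "dg (q - 1) u \<le> dg q x" using hvecsD(5)[OF Dx] by blast
  moreover have "dg q x - dg (q - 1) u = 0"
    using nz lookup_zero_tpow[OF hvecsD(3)[OF Dx, of u]] by blast
  ultimately show ?thesis by simp
qed

lemma degree_part_residue:
  assumes w: "w \<in> kvecs (X q)"
  shows "row_mult (degree_part (dg q) n w) (residue_matrix (D q)) = degree_part (dg (q - 1)) n (row_mult w (residue_matrix (D q)))"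
proof
  fix u
  have "row_mult (degree_part (dg q) n w) (residue_matrix (D q)) u =
      (\<Sum>x | w x \<noteq> 0. degree_part (dg q) n w x * residue_matrix (D q) x u)"
    using kvecsD(1)[OF w] by (intro row_mult_superset) (auto simp: degree_part_def)
  also have "\<dots> = (\<Sum>x | w x \<noteq> 0. if dg (q - 1) u = n then w x * residue_matrix (D q) x u else 0)"
  proof (rule sum.cong[OF refl])
    fix x assume "x \<in> {x. w x \<noteq> 0}"
    then have "x \<in> X q" using kvecsD(2)[OF w] by blast
    from residue_homogeneous[OF this, of u]
    show "degree_part (dg q) n w x * residue_matrix (D q) x u =
        (if dg (q - 1) u = n then w x * residue_matrix (D q) x u else 0)"
      by (cases "residue_matrix (D q) x u = 0") (auto simp: degree_part_def)
  qed
  also have "\<dots> = degree_part (dg (q - 1)) n (row_mult w (residue_matrix (D q))) u"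
    by (simp add: degree_part_def row_mult_def)
  finally show "row_mult (degree_part (dg q) n w) (residue_matrix (D q)) u =
      degree_part (dg (q - 1)) n (row_mult w (residue_matrix (D q))) u" .
qed

lemma cycles_degree_part: "w \<in> cycles q \<Longrightarrow> degree_part (dg q) n w \<in> cycles q"
  using degree_part_residue[of w q n] by (auto simp: cycles_def degree_part_in_kvecs) (simp add: degree_part_def fun_eq_iff)

lemma boundaries_degree_part: "w \<in> boundaries q \<Longrightarrow> degree_part (dg q) n w \<in> boundaries q"
proof -
  assume "w \<in> boundaries q"
  then obtain v where v: "v \<in> kvecs (X (Suc q))" "w = row_mult v (residue_matrix (D (Suc q)))"
    by (auto simp: boundaries_def)
  have "degree_part (dg q) n w = row_mult (degree_part (dg (Suc q)) n v) (residue_matrix (D (Suc q)))"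
    using degree_part_residue[OF v(1), of n] v(2) by simp
  then show ?thesis unfolding boundaries_def using degree_part_in_kvecs[OF v(1)] by blast
qed

text \<open>Modulo the augmentation ideal a vector over \<open>T(V)\<close> is its vector of
  constant terms, and for a vector of degree \<open>n\<close> these sit at generators of degree
  exactly \<open>n\<close>. From right to left, the bounding vector is cut down to its part of
  degree \<open>n\<close> before it is lifted.\<close>

lemma tor_vanishes_iff:
  "tor_vanishes i n \<longleftrightarrow> (\<forall>w\<in>cycles (Suc i). (\<forall>x. w x \<noteq> 0 \<longrightarrow> dg (Suc i) x = n) \<longrightarrow> w \<in> boundaries (Suc i))"
proof
  assume tv: "tor_vanishes i n"
  show "\<forall>w\<in>cycles (Suc i). (\<forall>x. w x \<noteq> 0 \<longrightarrow> dg (Suc i) x = n) \<longrightarrow> w \<in> boundaries (Suc i)"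
  proof (intro ballI impI)
    fix w assume w: "w \<in> cycles (Suc i)" and n: "\<forall>x. w x \<noteq> 0 \<longrightarrow> dg (Suc i) x = n"
    note wk = cycles_kvecs[OF w]
    have cw: "constants w \<in> hvecs E (X (Suc i)) (dg (Suc i)) n"
      using n kvecsD[OF wk] by (auto simp: hvecs_def intro: constants_in_tpow)
    have "row_mult (constants w) (D (Suc i)) \<in> vecs E (X (Suc i - 1))"
      using constants_in_vecs[OF wk] by (rule row_mult_in_vecs) (rule D_vecs)
    then have "row_mult (constants w) (D (Suc i)) u \<in> aug_ideal E" for u
      using w fun_cong[OF row_mult_residue[OF wk, of "D (Suc i)"], of u] vecsD(2)[of _ E _ u]
      by (auto simp: aug_ideal_def cycles_def)
    with tv cw obtain v where v: "v \<in> hvecs E (X (Suc (Suc i))) (dg (Suc (Suc i))) n"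
      "\<And>x. constants w x - row_mult v (D (Suc (Suc i))) x \<in> aug_ideal E"
      unfolding tor_vanishes_def by blast
    have vv: "v \<in> vecs E (X (Suc (Suc i)))" using v(1) by (rule hvecs_subset_vecs)
    have "w x = row_mult (\<lambda>x. Poly_Mapping.lookup (v x) 0) (residue_matrix (D (Suc (Suc i)))) x" for x
      using v(2)[of x] by (simp add: aug_ideal_def lookup_minus lookup_row_mult[OF vv])
    then have "w = row_mult (\<lambda>x. Poly_Mapping.lookup (v x) 0) (residue_matrix (D (Suc (Suc i))))" by blast
    then show "w \<in> boundaries (Suc i)"
      unfolding boundaries_def using lookup_vecs_in_kvecs[OF vv] by blast
  qed
next
  assume cb: "\<forall>w\<in>cycles (Suc i). (\<forall>x. w x \<noteq> 0 \<longrightarrow> dg (Suc i) x = n) \<longrightarrow> w \<in> boundaries (Suc i)"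
  show "tor_vanishes i n"
    unfolding tor_vanishes_def
  proof (intro ballI impI)
    fix v assume v: "v \<in> hvecs E (X (Suc i)) (dg (Suc i)) n" and z: "\<forall>u. row_mult v (D (Suc i)) u \<in> aug_ideal E"
    have vv: "v \<in> vecs E (X (Suc i))" using v by (rule hvecs_subset_vecs)
    let ?w = "\<lambda>x. Poly_Mapping.lookup (v x) 0"
    have "row_mult ?w (residue_matrix (D (Suc i))) u = 0" for u
      using z lookup_row_mult[OF vv, of "D (Suc i)" u] by (simp add: aug_ideal_def)
    then have cyc: "?w \<in> cycles (Suc i)" using lookup_vecs_in_kvecs[OF vv] by (simp add: cycles_def fun_eq_iff)
    have hom: "dg (Suc i) x = n" if "?w x \<noteq> 0" for x
    proof -
      have "v x \<noteq> 0" using that by auto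
      then have "dg (Suc i) x \<le> n" using hvecsD(5)[OF v] by blast
      moreover have "n - dg (Suc i) x = 0"
        using that lookup_zero_tpow[OF hvecsD(3)[OF v], of x] by (cases "n - dg (Suc i) x") auto
      ultimately show ?thesis by simp
    qed
    have "?w \<in> boundaries (Suc i)" using cyc hom by (rule cb[rule_format])
    then obtain b where b: "b \<in> kvecs (X (Suc (Suc i)))" "?w = row_mult b (residue_matrix (D (Suc (Suc i))))"
      by (auto simp: boundaries_def)
    let ?b = "degree_part (dg (Suc (Suc i))) n b"
    have bk: "?b \<in> kvecs (X (Suc (Suc i)))" using b(1) by (rule degree_part_in_kvecs)
    have "row_mult ?b (residue_matrix (D (Suc (Suc i)))) = degree_part (dg (Suc i)) n ?w"
      using degree_part_residue[OF b(1), of n] b(2) by simp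
    also have "\<dots> = ?w" using degree_part_homogeneous[of ?w "dg (Suc i)" n n] hom by simp
    finally have eq: "?w x = row_mult ?b (residue_matrix (D (Suc (Suc i)))) x" for x by (rule fun_cong[OF sym])
    have cb: "constants ?b \<in> hvecs E (X (Suc (Suc i))) (dg (Suc (Suc i))) n"
      using kvecsD[OF bk] by (auto simp: hvecs_def degree_part_def intro: constants_in_tpow split: if_splits)
    have "row_mult (constants ?b) (D (Suc (Suc i))) \<in> vecs E (X (Suc (Suc i) - 1))"
      using constants_in_vecs[OF bk] by (rule row_mult_in_vecs) (rule D_vecs)
    note rc = vecsD(2)[OF this]
    have "v x - row_mult (constants ?b) (D (Suc (Suc i))) x \<in> aug_ideal E" for x
    proof -
      have "Poly_Mapping.lookup (row_mult (constants ?b) (D (Suc (Suc i))) x) 0 = Poly_Mapping.lookup (v x) 0"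
        using eq[of x] fun_cong[OF row_mult_residue[OF bk, of "D (Suc (Suc i))"], of x] by (simp only:)
      then show ?thesis using rc[of x] vecsD(2)[OF vv, of x] by (simp add: aug_ideal_def lookup_minus)
    qed
    with cb show "\<exists>w\<in>hvecs E (X (Suc (Suc i))) (dg (Suc (Suc i))) n. \<forall>x. v x - row_mult w (D (Suc (Suc i))) x \<in> aug_ideal E"
      by blast
  qed
qed

text \<open>Cycles and boundaries contain the components of their elements, so homology is the
  direct sum of its graded parts, and two of them exhaust it exactly when all others vanish. For
  \<open>m \<noteq> n\<close> the two parts intersect trivially, by comparing components.\<close>

lemma purity_iff:
  fixes q :: nat
  assumes "m \<noteq> n"
  defines "H k \<equiv> {w \<in> cycles q. \<forall>x. w x \<noteq> 0 \<longrightarrow> dg q x = k}"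
  shows "(\<forall>w\<in>cycles q. \<exists>y\<in>H m. \<exists>z\<in>H n. w - (y + z) \<in> boundaries q) \<and>
      (\<forall>y\<in>H m. \<forall>z\<in>H n. y - z \<in> boundaries q \<longrightarrow> y \<in> boundaries q)
    \<longleftrightarrow> (\<forall>k. k \<noteq> m \<longrightarrow> k \<noteq> n \<longrightarrow> H k \<subseteq> boundaries q)"
proof (intro iffI conjI allI impI ballI subsetI)
  fix k w assume dec: "(\<forall>w\<in>cycles q. \<exists>y\<in>H m. \<exists>z\<in>H n. w - (y + z) \<in> boundaries q) \<and>
      (\<forall>y\<in>H m. \<forall>z\<in>H n. y - z \<in> boundaries q \<longrightarrow> y \<in> boundaries q)"
    and k: "k \<noteq> m" "k \<noteq> n" and w: "w \<in> H k"
  then obtain y z where yz: "y \<in> H m" "z \<in> H n" "w - (y + z) \<in> boundaries q"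
    unfolding H_def by blast
  have "degree_part (dg q) k (w - (y + z)) = w"
    using degree_part_homogeneous[of w "dg q" k k] degree_part_homogeneous[of y "dg q" m k]
      degree_part_homogeneous[of z "dg q" n k] w yz(1,2) k
    unfolding degree_part_diff degree_part_add H_def by simp
  with boundaries_degree_part[OF yz(3), of k] show "w \<in> boundaries q" by simp
next
  assume van: "\<forall>k. k \<noteq> m \<longrightarrow> k \<noteq> n \<longrightarrow> H k \<subseteq> boundaries q"
  let ?d = "degree_part (dg q)"
  have dH: "?d k w \<in> H k" if "w \<in> cycles q" for k w
    using cycles_degree_part[OF that, of k] by (auto simp: H_def degree_part_def)
  fix w assume w: "w \<in> cycles q"
  let ?K = "dg q ` {x. w x \<noteq> 0}"
  have K: "finite ?K" using kvecsD(1)[OF cycles_kvecs[OF w]] by simp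
  have zero: "?d k w = 0" if "k \<notin> ?K" for k using that by (auto simp: degree_part_def fun_eq_iff)
  have "w = (\<Sum>k\<in>?K. ?d k w)" using degree_part_sum[OF cycles_kvecs[OF w], of "dg q"] .
  \<comment> \<open>\<open>m\<close> and \<open>n\<close> may be missing among the degrees occurring
    in \<open>w\<close>; they are added with zero components so that both can be split off.\<close>
  also have "\<dots> = (\<Sum>k\<in>?K \<union> {m, n}. ?d k w)"
    using K zero by (intro sum.mono_neutral_left) auto
  also have "\<dots> = (\<Sum>k\<in>(?K - {m, n}) \<union> {m, n}. ?d k w)" by (rule sum.cong) auto
  also have "\<dots> = (\<Sum>k\<in>?K - {m, n}. ?d k w) + (\<Sum>k\<in>{m, n}. ?d k w)"
    using K by (intro sum.union_disjoint) auto
  finally have "w - (?d m w + ?d n w) = (\<Sum>k\<in>?K - {m, n}. ?d k w)"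
    using assms(1) by (simp add: algebra_simps)
  moreover have "(\<Sum>k\<in>?K - {m, n}. ?d k w) \<in> boundaries q"
  proof (rule boundaries_sum)
    fix k assume "k \<in> ?K - {m, n}"
    then show "?d k w \<in> boundaries q" using van dH[OF w, of k] by blast
  qed
  ultimately show "\<exists>y\<in>H m. \<exists>z\<in>H n. w - (y + z) \<in> boundaries q"
    using dH[OF w] by (intro bexI[of _ "?d m w"] bexI[of _ "?d n w"]) simp_all
next
  fix y z assume y: "y \<in> H m" and z: "z \<in> H n" and yz: "y - z \<in> boundaries q"
  have "degree_part (dg q) m (y - z) = y"
    using degree_part_homogeneous[of y "dg q" m m] degree_part_homogeneous[of z "dg q" n m] y z assms(1)
    unfolding degree_part_diff H_def by simp
  with boundaries_degree_part[OF yz, of m] show "y \<in> boundaries q" by simp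
qed

text \<open>Stated for any \<open>F\<close> whose generators, degrees and differentials come from
  the matrices, to cover both the constructed resolution and a given one that was lifted. Along the
  injection \<open>coset\<close>, Tor becomes cycles modulo boundaries of the residue complex. A
  positive \<open>i\<close> selects the second clause of \<open>tor_cycles\<close>.\<close>

lemma two_pure_Tor_iff:
  fixes F :: "(('v, 'k) tens set, 'k) free_complex"
  assumes gens: "\<And>i. gens F i = X (Suc i)" and gdeg: "\<And>i. gdeg F i = dg (Suc i)"
    and diff: "\<And>i v. v \<in> vecs E (X (Suc (Suc i))) \<Longrightarrow>
      differential F i (cvec v) = cvec (row_mult v (D (Suc (Suc i))))"
    and mn: "m \<noteq> n" and i: "i = Suc j"
  shows "two_pure (Tor B trivial_module F i) (Tor_component B BC trivial_module trivial_component F i) m n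
    \<longleftrightarrow> (\<forall>k. k \<noteq> m \<longrightarrow> k \<noteq> n \<longrightarrow> tor_vanishes i k)"
proof -
  let ?M = "trivial_module :: (('v, 'k) tens set, 'k) module"
  let ?X = "X (Suc i)"
  let ?c = "coset ?X"
  let ?Z = "cycles (Suc i)" and ?Bd = "boundaries (Suc i)"
  define H where "H = (\<lambda>k. {w \<in> ?Z. \<forall>x. w x \<noteq> 0 \<longrightarrow> dg (Suc i) x = k})"
  have td: "tor_differential B ?M F k (coset (X (Suc (Suc k))) w) = coset (X (Suc k)) (row_mult w (residue_matrix (D (Suc (Suc k)))))"
    if "w \<in> kvecs (X (Suc (Suc k)))" for k w
    unfolding tor_differential_def gens using diff[of _ k] D_vecs[of _ "Suc (Suc k)"] that
    by (intro tensor_map_coset) auto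
  have cyc: "tor_cycles B ?M F i = ?c ` ?Z"
  proof -
    have "coset (X i) (row_mult w (residue_matrix (D (Suc i)))) = coset (X i) 0 \<longleftrightarrow> row_mult w (residue_matrix (D (Suc i))) = 0"
      if "w \<in> kvecs ?X" for w
      using residue_in_kvecs[OF that] inj_on_eq_iff[OF coset_inj, of _ "X i" 0] by simp
    then show ?thesis
      unfolding i tor_cycles.simps kernel_def gens tproduct_carrier tproduct_one
      by (auto simp: td cycles_def i)
  qed
  have bd: "tor_boundaries B ?M F i = ?c ` ?Bd"
    unfolding tor_boundaries_def gens tproduct_carrier boundaries_def
    by (auto simp: td image_image)
  \<comment> \<open>The class in Tor of the cycle with coefficient vector \<open>z\<close>: a set of
    cosets, one for each boundary added.\<close>
  define cl where "cl = (\<lambda>z. ?c ` ((\<lambda>b. b + z) ` ?Bd))"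
  have cosetB: "tor_boundaries B ?M F i #>\<^bsub>tproduct ?X\<^esub> ?c z = cl z" if "z \<in> kvecs ?X" for z
    unfolding bd cl_def r_coset_def by (auto simp: tproduct_mult boundaries_kvecs)
  have cl_eq: "cl y = cl z \<longleftrightarrow> y - z \<in> ?Bd" if y: "y \<in> ?Z" and z: "z \<in> ?Z" for y z
  proof -
    have sub: "(\<lambda>b. b + z) ` ?Bd \<subseteq> kvecs ?X" if "z \<in> ?Z" for z
      using boundaries_kvecs cycles_kvecs[OF that] by (auto intro: add_in_kvecs)
    have "cl y = cl z \<longleftrightarrow> (\<lambda>b. b + y) ` ?Bd = (\<lambda>b. b + z) ` ?Bd"
      unfolding cl_def by (rule inj_on_image_eq_iff[OF coset_inj sub[OF y] sub[OF z]])
    also have "\<dots> \<longleftrightarrow> y - z \<in> ?Bd"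
    proof
      assume eq: "(\<lambda>b. b + y) ` ?Bd = (\<lambda>b. b + z) ` ?Bd"
      have "0 + y \<in> (\<lambda>b. b + y) ` ?Bd" using boundaries_zero by blast
      then obtain b where "b \<in> ?Bd" "0 + y = b + z" unfolding eq by blast
      then show "y - z \<in> ?Bd" by (simp add: algebra_simps)
    next
      assume d: "y - z \<in> ?Bd"
      show "(\<lambda>b. b + y) ` ?Bd = (\<lambda>b. b + z) ` ?Bd"
      proof (intro equalityI subsetI)
        fix x assume "x \<in> (\<lambda>b. b + y) ` ?Bd"
        then obtain b where "b \<in> ?Bd" "x = (b + (y - z)) + z" by auto
        then show "x \<in> (\<lambda>b. b + z) ` ?Bd" using boundaries_add[OF _ d] by blast
      next
        fix x assume "x \<in> (\<lambda>b. b + z) ` ?Bd"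
        then obtain b where "b \<in> ?Bd" "x = (b - (y - z)) + y" by auto
        then show "x \<in> (\<lambda>b. b + y) ` ?Bd" using boundaries_diff[OF _ d] by blast
      qed
    qed
    finally show ?thesis .
  qed
  have cl_mult: "cl y <#>\<^bsub>tproduct ?X\<^esub> cl z = cl (y + z)" if y: "y \<in> ?Z" and z: "z \<in> ?Z" for y z
  proof (intro equalityI subsetI)
    fix x assume "x \<in> cl y <#>\<^bsub>tproduct ?X\<^esub> cl z"
    then obtain b b' where b: "b \<in> ?Bd" "b' \<in> ?Bd" "x = ?c (b + y) \<otimes>\<^bsub>tproduct ?X\<^esub> ?c (b' + z)"
      unfolding cl_def set_mult_def by blast
    have "x = ?c ((b + b') + (y + z))"
      using tproduct_mult[OF add_in_kvecs[OF boundaries_kvecs[OF b(1)] cycles_kvecs[OF y]]] b(3) by (simp add: ac_simps)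
    then show "x \<in> cl (y + z)" unfolding cl_def using boundaries_add[OF b(1,2)] by blast
  next
    fix x assume "x \<in> cl (y + z)"
    then obtain b where b: "b \<in> ?Bd" "x = ?c (b + (y + z))" unfolding cl_def by blast
    then have "x = ?c (b + y) \<otimes>\<^bsub>tproduct ?X\<^esub> ?c (0 + z)"
      using tproduct_mult[OF add_in_kvecs[OF boundaries_kvecs[OF b(1)] cycles_kvecs[OF y]]] by (simp add: ac_simps)
    then show "x \<in> cl y <#>\<^bsub>tproduct ?X\<^esub> cl z"
      unfolding cl_def set_mult_def using b(1) boundaries_zero[of "Suc i"] by blast
  qed
  \<comment> \<open>\<open>Tor\<close> is formed in the chain group with its carrier cut down to
    cycles; products of sets and cosets depend on the multiplication alone.\<close>
  have setm: "S <#>\<^bsub>G\<lparr>carrier := C\<rparr>\<^esub> T = S <#>\<^bsub>G\<^esub> T" for S T C and G :: "('v, 'k) tfrag set monoid"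
    by (simp add: set_mult_def)
  have rc: "S #>\<^bsub>G\<lparr>carrier := C\<rparr>\<^esub> x = S #>\<^bsub>G\<^esub> x" for S x C and G :: "('v, 'k) tfrag set monoid"
    by (simp add: r_coset_def)
  have Tc: "carrier (Tor B ?M F i) = cl ` ?Z"
    unfolding Tor_def FactGroup_def gens cyc RCOSETS_def
    by (auto simp: rc cosetB cycles_kvecs)
  have T1: "\<one>\<^bsub>Tor B ?M F i\<^esub> = cl 0"
    unfolding Tor_def FactGroup_def by (simp add: bd cl_def)
  have Tm: "cl y \<otimes>\<^bsub>Tor B ?M F i\<^esub> cl z = cl (y + z)" if "y \<in> ?Z" "z \<in> ?Z" for y z
    unfolding Tor_def FactGroup_def gens using cl_mult[OF that] by (simp add: setm)
  have TC: "Tor_component B BC ?M trivial_component F i k = cl ` H k" for k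
  proof -
    have "?c ` ?Z \<inter> ?c ` {w \<in> kvecs ?X. \<forall>x. w x \<noteq> 0 \<longrightarrow> dg (Suc i) x = k} = ?c ` (?Z \<inter> {w \<in> kvecs ?X. \<forall>x. w x \<noteq> 0 \<longrightarrow> dg (Suc i) x = k})"
      by (rule inj_on_image_Int[OF coset_inj, symmetric]) (auto intro: cycles_kvecs)
    also have "?Z \<inter> {w \<in> kvecs ?X. \<forall>x. w x \<noteq> 0 \<longrightarrow> dg (Suc i) x = k} = H k"
      by (auto simp: H_def cycles_kvecs)
    finally show ?thesis
      unfolding Tor_component_def gens gdeg cyc tensor_component_coset
      by (auto simp: cosetB H_def cycles_kvecs image_image)
  qed
  have HZ: "y \<in> ?Z" if "y \<in> H k" for y k using that by (simp add: H_def)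
  have "two_pure (Tor B ?M F i) (Tor_component B BC ?M trivial_component F i) m n \<longleftrightarrow>
      cl ` ?Z = {cl (y + z) | y z. y \<in> H m \<and> z \<in> H n} \<and> cl ` H m \<inter> cl ` H n = {cl 0}"
  proof -
    have "cl ` H m <#>\<^bsub>Tor B ?M F i\<^esub> cl ` H n = {cl (y + z) | y z. y \<in> H m \<and> z \<in> H n}"
      unfolding set_mult_def using Tm[OF HZ HZ] by blast
    then show ?thesis unfolding two_pure_def Tc T1 TC by simp
  qed
  also have "\<dots> \<longleftrightarrow> (\<forall>w\<in>?Z. \<exists>y\<in>H m. \<exists>z\<in>H n. w - (y + z) \<in> ?Bd) \<and>
      (\<forall>y\<in>H m. \<forall>z\<in>H n. y - z \<in> ?Bd \<longrightarrow> y \<in> ?Bd)"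
  proof (intro arg_cong2[where f = "(\<and>)"])
    let ?S = "{cl (y + z) | y z. y \<in> H m \<and> z \<in> H n}"
    have Z: "y + z \<in> ?Z" if "y \<in> H m" "z \<in> H n" for y z
      using HZ[OF that(1)] HZ[OF that(2)] by (rule cycles_add)
    show "cl ` ?Z = ?S \<longleftrightarrow> (\<forall>w\<in>?Z. \<exists>y\<in>H m. \<exists>z\<in>H n. w - (y + z) \<in> ?Bd)"
    proof
      assume eq: "cl ` ?Z = ?S"
      show "\<forall>w\<in>?Z. \<exists>y\<in>H m. \<exists>z\<in>H n. w - (y + z) \<in> ?Bd"
      proof
        fix w assume w: "w \<in> ?Z"
        then have "cl w \<in> ?S" unfolding eq[symmetric] by (rule imageI)
        then obtain y z where yz: "y \<in> H m" "z \<in> H n" "cl w = cl (y + z)" by blast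
        then show "\<exists>y\<in>H m. \<exists>z\<in>H n. w - (y + z) \<in> ?Bd" using cl_eq[OF w Z[OF yz(1,2)]] by blast
      qed
    next
      assume dec: "\<forall>w\<in>?Z. \<exists>y\<in>H m. \<exists>z\<in>H n. w - (y + z) \<in> ?Bd"
      show "cl ` ?Z = ?S"
      proof (intro equalityI subsetI)
        fix W assume "W \<in> cl ` ?Z"
        then obtain w where w: "w \<in> ?Z" "W = cl w" by blast
        with dec obtain y z where yz: "y \<in> H m" "z \<in> H n" "w - (y + z) \<in> ?Bd" by blast
        then have "W = cl (y + z)" using cl_eq[OF w(1) Z[OF yz(1,2)]] w(2) by blast
        with yz show "W \<in> ?S" by blast
      next
        fix W assume "W \<in> ?S"
        then obtain y z where yz: "y \<in> H m" "z \<in> H n" "W = cl (y + z)" by blast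
        show "W \<in> cl ` ?Z" unfolding yz(3) using Z[OF yz(1,2)] by (rule imageI)
      qed
    qed
    have H0: "0 \<in> H k" for k using cycles_zero by (simp add: H_def)
    have "cl ` H m \<inter> cl ` H n = {cl 0} \<longleftrightarrow> (\<forall>y\<in>H m. \<forall>z\<in>H n. cl y = cl z \<longrightarrow> cl y = cl 0)"
      using H0 by blast
    then show "cl ` H m \<inter> cl ` H n = {cl 0} \<longleftrightarrow> (\<forall>y\<in>H m. \<forall>z\<in>H n. y - z \<in> ?Bd \<longrightarrow> y \<in> ?Bd)"
      using cl_eq[OF HZ HZ] cl_eq[OF HZ cycles_zero] by simp
  qed
  also have "\<dots> \<longleftrightarrow> (\<forall>k. k \<noteq> m \<longrightarrow> k \<noteq> n \<longrightarrow> H k \<subseteq> ?Bd)"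
    unfolding H_def by (rule purity_iff[OF mn])
  also have "\<dots> \<longleftrightarrow> (\<forall>k. k \<noteq> m \<longrightarrow> k \<noteq> n \<longrightarrow> tor_vanishes i k)"
    unfolding tor_vanishes_iff H_def by blast
  finally show ?thesis .
qed

end

section \<open>The opposite algebra\<close>

text \<open>For \<open>i \<ge> 2\<close> the factor \<open>i div 2\<close> is positive. Distinct
  degrees are what makes \<open>two_pure\<close> express a direct sum of two parts.\<close>

lemma koszul_degree_neq: "a < b \<Longrightarrow> 2 \<le> i \<Longrightarrow> koszul_degree a i \<noteq> koszul_degree b i"
  by (auto simp: koszul_degree_def)

text \<open>The hypothesis is evaluated at the one resolution constructed over \<open>A\<close> and
  yields vanishing of Tor outside the two degrees; balance carries this to the matrices of the
  arbitrary resolution \<open>F\<close> over the opposite algebra.\<close>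

lemma ab_koszul_tau:
  fixes Ra Rb :: "('v, 'k::field) tens set"
  assumes E: "finite E" and ab: "2 \<le> a" "a < b"
    and Ra: "Ra \<subseteq> tpow E a" "0 \<in> Ra" and Rb: "Rb \<subseteq> tpow E b" "0 \<in> Rb"
    and koszul: "ab_koszul E a b Ra Rb"
  shows "ab_koszul E a b (tau ` Ra) (tau ` Rb)"
proof -
  define J where "J = relation_ideal E Ra Rb"
  have J: "positive_graded_ideal E J"
    unfolding J_def using ab Ra Rb by (intro relation_ideal_positive_graded[of a b]) auto
  interpret A: positive_graded_ideal E J by (rule J)
  interpret O: positive_graded_ideal E "tau ` J" using J by (rule positive_graded_ideal_tau)
  have tauJ: "relation_ideal E (tau ` Ra) (tau ` Rb) = tau ` J"
    unfolding J_def using ab Ra Rb by (intro relation_ideal_tau[of a b]) auto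
  obtain X dg D where XD: "matrix_resolution E J X dg D"
    using A.matrix_resolution_exists[OF E] .
  interpret XD: matrix_resolution E J X dg D by (rule XD)
  have pure: "two_pure (Tor A.B trivial_module XD.free_resolution i)
      (Tor_component A.B A.BC trivial_module trivial_component XD.free_resolution i)
      (koszul_degree a i) (koszul_degree b i)" if "2 \<le> i" for i
    using koszul XD.graded_free_resolution_free_resolution that
    unfolding ab_koszul_def Let_def J_def[symmetric] by blast
  show ?thesis
    unfolding ab_koszul_def Let_def tauJ
  proof (intro allI impI)
    fix F :: "(('v, 'k) tens set, 'k) free_complex" and i :: nat
    assume F: "graded_free_resolution O.B O.BC trivial_module trivial_component F" and i: "2 \<le> i"
    obtain X' dg' D' where XD': "matrix_resolution E (tau ` J) X' dg' D'"
      and gens: "\<And>i. X' (Suc i) = gens F i" and gdeg: "\<And>i. dg' (Suc i) = gdeg F i"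
      and diff: "\<And>i v. v \<in> vecs E (gens F (Suc i)) \<Longrightarrow>
        differential F i (O.cvec v) = O.cvec (row_mult v (D' (Suc (Suc i))))"
      using O.resolution_matrices[OF F] by metis
    interpret XD': matrix_resolution E "tau ` J" X' dg' D' by (rule XD')
    interpret resolution_pair E J X dg D X' dg' D' ..
    obtain j where j: "i = Suc j" using i by (cases i) auto
    have "XD.tor_vanishes i k" if "k \<noteq> koszul_degree a i" "k \<noteq> koszul_degree b i" for k
      using XD.two_pure_Tor_iff[of XD.free_resolution, OF _ _ XD.differential_cvec koszul_degree_neq[OF ab(2) i] j]
        pure[OF i] that by (simp add: XD.free_resolution_def)
    then have "XD'.tor_vanishes i k" if "k \<noteq> koszul_degree a i" "k \<noteq> koszul_degree b i" for k
      using that tor_vanishes_balanced by blast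
    then show "two_pure (Tor O.B trivial_module F i) (Tor_component O.B O.BC trivial_module trivial_component F i)
        (koszul_degree a i) (koszul_degree b i)"
      using XD'.two_pure_Tor_iff[of F, OF _ _ _ koszul_degree_neq[OF ab(2) i] j] gens gdeg diff by simp
  qed
qed

theorem proposition4p16:
  fixes scale :: "'k::field \<Rightarrow> 'v::ab_group_add \<Rightarrow> 'v"
    and E :: "'v set"
    and a b :: nat
    and Ra Rb :: "('v, 'k) tens set"
  assumes "finite_dimensional_vector_space scale E"
    and "2 \<le> a" and "a < b"
    and "module.subspace tscale Ra" and "Ra \<subseteq> tpow E a"
    and "module.subspace tscale Rb" and "Rb \<subseteq> tpow E b"
    and "exclusive E a b Ra Rb"
  shows "ab_koszul E a b (tau ` Ra) (tau ` Rb) \<longleftrightarrow> ab_koszul E a b Ra Rb"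
proof
  interpret V: finite_dimensional_vector_space scale E by fact
  interpret T: vector_space "tscale :: 'k \<Rightarrow> ('v, 'k) tens \<Rightarrow> ('v, 'k) tens" by (rule vector_space_tscale)
  have zero: "0 \<in> Ra" "0 \<in> Rb" using assms(4,6) by (auto intro: T.subspace_0)
  show "ab_koszul E a b (tau ` Ra) (tau ` Rb)" if "ab_koszul E a b Ra Rb"
    using V.finite_Basis assms(2,3,5) zero(1) assms(7) zero(2) that by (rule ab_koszul_tau)
  show "ab_koszul E a b Ra Rb" if tau: "ab_koszul E a b (tau ` Ra) (tau ` Rb)"
  proof -
    have "tau ` Ra \<subseteq> tpow E a" "0 \<in> tau ` Ra" "tau ` Rb \<subseteq> tpow E b" "0 \<in> tau ` Rb"
      using assms(5,7) zero tau_zero by (auto intro: rev_image_eqI)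
    \<comment> \<open>Reversing the reversed relations gives back \<open>Ra\<close> and
      \<open>Rb\<close>.\<close>
    from ab_koszul_tau[OF V.finite_Basis assms(2,3) this tau] show ?thesis by (simp add: image_image)
  qed
qed

end
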